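(* Given a graph $G$ and an integer $k$, one can in time $2^{\mathcal{O}(k\log k)}\cdot |G|^{\mathcal{O}(1)}$ construct a data structure that may answer the following queries in time $k^{\mathcal{O}(1)}$: given $u,v\in V(G)$ and a set $S$ consisting of at most $k$ vertices of $G$, does $G\models \mathsf{conn}(u,v,S)$? The space usage of the data structure is $k^{\mathcal{O}(1)}\cdot |G|^2$.
   Context: Graphs are finite, undirected and loopless; $|G|$ is the number of vertices. $G\models\mathsf{conn}(u,v,S)$ means that there is a $u$-$v$ path in $G$ that contains no vertex of $S$ (in particular it fails if $u\in S$ or $v\in S$). Computation is in the word RAM model with words of length $\mathcal{O}(\log n)$. *)

theory Defs
  imports
    Complex_Main
    "HOL-Library.Landau_Symbols"
    "Graph_Theory.Pair_Digraph"
    "Graph_Theory.Vertex_Walk"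
begin

unbundle bit_operations_syntax

section \<open>Word RAM\<close>

text \<open>
  A machine has a fixed program, registers and a random access memory. All contents are words,
  i.e. naturals below \<open>2 ^ w\<close> for the word length \<open>w\<close>, and all arithmetic is modulo \<open>2 ^ w\<close>.
  As addresses come from registers, only the cells below \<open>2 ^ w\<close> are accessible. Registers are
  addressed only by the literals in the program, so every program uses a constant number of them.
\<close>

datatype binop = Add | Sub | Mul | Div | Mod | And | Or | Xor | Shl | Shr

text \<open>As usual in HOL, \<open>x div 0 = 0\<close> and \<open>x mod 0 = x\<close>. Subtraction wraps around.\<close>

fun eval_binop :: "nat \<Rightarrow> binop \<Rightarrow> nat \<Rightarrow> nat \<Rightarrow> nat" where
  "eval_binop w Add x y = (x + y) mod 2 ^ w"
| "eval_binop w Sub x y = nat ((int x - int y) mod 2 ^ w)"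
| "eval_binop w Mul x y = (x * y) mod 2 ^ w"
| "eval_binop w Div x y = (x div y) mod 2 ^ w"
| "eval_binop w Mod x y = (x mod y) mod 2 ^ w"
| "eval_binop w And x y = (x AND y) mod 2 ^ w"
| "eval_binop w Or x y = (x OR y) mod 2 ^ w"
| "eval_binop w Xor x y = (x XOR y) mod 2 ^ w"
| "eval_binop w Shl x y = push_bit y x mod 2 ^ w"
| "eval_binop w Shr x y = drop_bit y x mod 2 ^ w"

datatype instr =
    Const nat nat  \<comment> \<open>\<open>r := c\<close>\<close>
  | Bin binop nat nat nat  \<comment> \<open>\<open>r := r1 op r2\<close>\<close>
  | Load nat nat  \<comment> \<open>\<open>r := mem[r1]\<close>\<close>
  | Store nat nat  \<comment> \<open>\<open>mem[r] := r1\<close>\<close>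
  | Jump nat
  | JumpEq nat nat nat  \<comment> \<open>jump to the third argument if \<open>r1 = r2\<close>\<close>
  | JumpLess nat nat nat  \<comment> \<open>jump to the third argument if \<open>r1 < r2\<close>\<close>

type_synonym program = "instr list"

record state =
  pc :: nat
  regs :: "nat \<Rightarrow> nat"
  mem :: "nat \<Rightarrow> nat"

fun exec_instr :: "nat \<Rightarrow> instr \<Rightarrow> state \<Rightarrow> state" where
  "exec_instr w (Const r c) s =
     s\<lparr>pc := pc s + 1, regs := (regs s)(r := c mod 2 ^ w)\<rparr>"
| "exec_instr w (Bin f r r1 r2) s =
     s\<lparr>pc := pc s + 1, regs := (regs s)(r := eval_binop w f (regs s r1) (regs s r2))\<rparr>"
| "exec_instr w (Load r r1) s =
     s\<lparr>pc := pc s + 1, regs := (regs s)(r := mem s (regs s r1))\<rparr>"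
| "exec_instr w (Store r r1) s =
     s\<lparr>pc := pc s + 1, mem := (mem s)(regs s r := regs s r1)\<rparr>"
| "exec_instr w (Jump l) s = s\<lparr>pc := l\<rparr>"
| "exec_instr w (JumpEq r1 r2 l) s =
     s\<lparr>pc := (if regs s r1 = regs s r2 then l else pc s + 1)\<rparr>"
| "exec_instr w (JumpLess r1 r2 l) s =
     s\<lparr>pc := (if regs s r1 < regs s r2 then l else pc s + 1)\<rparr>"

definition halted :: "program \<Rightarrow> state \<Rightarrow> bool" where
  "halted P s \<longleftrightarrow> length P \<le> pc s"

definition step :: "nat \<Rightarrow> program \<Rightarrow> state \<Rightarrow> state" where
  "step w P s = (if halted P s then s else exec_instr w (P ! pc s) s)"

text \<open>A halted machine idles, so \<open>t\<close> is an upper bound on the number of executed instructions.\<close>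

definition halts_within :: "nat \<Rightarrow> program \<Rightarrow> nat \<Rightarrow> state \<Rightarrow> state \<Rightarrow> bool" where
  "halts_within w P t s s' \<longleftrightarrow> (step w P ^^ t) s = s' \<and> halted P s'"

text \<open>The words \<open>xs\<close> at addresses \<open>0, 1, \<dots>\<close>, the word \<open>x\<close> in register 0, and 0 everywhere else.\<close>

definition init_state :: "nat list \<Rightarrow> nat \<Rightarrow> state" where
  "init_state xs x =
     \<lparr>pc = 0, regs = (\<lambda>_. 0)(0 := x), mem = (\<lambda>i. if i < length xs then xs ! i else 0)\<rparr>"

text \<open>
  A word length of \<open>O(log n)\<close>. The parameter \<open>k\<close> occurs because it is an input number and has to
  fit into a word; for \<open>k \<le> n\<close> this is \<open>O(log n)\<close> outright.
\<close>

definition word_length :: "nat \<Rightarrow> nat \<Rightarrow> nat \<Rightarrow> nat" where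
  "word_length c n k = c * nat \<lceil>log 2 (real (n + k + 2))\<rceil>"


section \<open>Data structures\<close>

text \<open>
  The construction leaves a data structure \<open>D\<close>, a block of words, at addresses
  \<open>0, \<dots>, length D - 1\<close>, and its size in register 0. Nothing else is passed on to the queries:
  these start in a fresh memory that contains just \<open>D\<close>, directly followed by the query, with the
  address of the query in register 0. The answer is returned in register 0.
\<close>

definition constructs :: "nat \<Rightarrow> program \<Rightarrow> nat list \<Rightarrow> nat \<Rightarrow> nat list \<Rightarrow> bool" where
  "constructs w P input t D \<longleftrightarrow>
     (\<exists>s. halts_within w P t (init_state input 0) s \<and>
          regs s 0 = length D \<and> (\<forall>i < length D. mem s i = D ! i))"

definition answers :: "nat \<Rightarrow> program \<Rightarrow> nat list \<Rightarrow> nat list \<Rightarrow> nat \<Rightarrow> bool \<Rightarrow> bool" where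
  "answers w Q D query t b \<longleftrightarrow>
     (\<exists>s. halts_within w Q t (init_state (D @ query) (length D)) s \<and>
          regs s 0 = (if b then 1 else 0))"


section \<open>Graphs\<close>

definition conn :: "'a pair_pre_digraph \<Rightarrow> 'a \<Rightarrow> 'a \<Rightarrow> 'a set \<Rightarrow> bool" where
  "conn G u v S \<longleftrightarrow>
     (\<exists>p. vpath p (with_proj G) \<and> hd p = u \<and> last p = v \<and> set p \<inter> S = {})"

text \<open>
  Input for the construction, for a graph with vertices \<open>0, \<dots>, n - 1\<close>: the numbers \<open>n\<close> and \<open>k\<close>,
  followed by the adjacency matrix row by row.
\<close>

definition graph_input :: "nat pair_pre_digraph \<Rightarrow> nat \<Rightarrow> nat list" where
  "graph_input G k =
     (let n = card (pverts G)
      in [n, k] @ [if (i, j) \<in> parcs G then 1 else 0. i \<leftarrow> [0..<n], j \<leftarrow> [0..<n]])"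

definition query_input :: "nat \<Rightarrow> nat \<Rightarrow> nat list \<Rightarrow> nat list" where
  "query_input u v xs = [u, v, length xs] @ xs"

text \<open>\<open>f(x) = x\<^bsup>O(1)\<^esup>\<close>\<close>

definition polynomially_bounded :: "(nat \<Rightarrow> real) \<Rightarrow> bool" where
  "polynomially_bounded f \<longleftrightarrow> (\<exists>d::nat. f \<in> O(\<lambda>x. real x ^ d))"

end

theory Submission
  imports Defs
begin

text \<open>
  Fix a depth-first search tree of the graph, with an artificial root joining the components, so that
  every edge connects a vertex with one of its ancestors. Removing a set of failed vertices splits the
  tree into subtrees, one for each surviving subtree root; only the subtrees that contain a query vertex or
  whose parent and descendants both meet failed vertices have to be handled explicitly. The remaining
  subtrees hang below a failed vertex and contain no failures. They only have edges to the ancestors of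
  that vertex, and for each of them the first \<open>k\<close> neighbours above it are stored: at most
  \<open>k\<close> of its neighbours fail, so either one stored neighbour survives or the subtree is isolated
  from above. Prefix sums of edge counts, ordered by these neighbours, tell in \<open>k\<^sup>O\<^sup>(\<^sup>1\<^sup>)\<close> time whether two
  explicit subtrees are joined by an edge or through such a hanging subtree. A query then computes the
  connected components of the resulting graph on \<open>O(k)\<close> subtrees. Both programs are compiled from a
  small structured language to the word RAM.
\<close>

section \<open>Rooted trees and depth-first search trees\<close>

text \<open>Query time may depend on \<open>k\<close> only, yet a failed vertex can have any number
  of hanging subtrees. They are never enumerated, only counted through their edges, and counts are
  additive. A piece of the broken tree is a subtree minus disjoint subtrees rooted at failures, so
  whatever is tabulated per subtree is available per piece by subtraction; likewise, a sum over the
  hanging subtrees below \<open>f\<close> is a sum over all children of \<open>f\<close> minus the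
  at most \<open>k\<close> children containing failures. Along the path to \<open>f\<close>, the
  piece that ends at a failed vertex \<open>x\<close> is an interval of numbers, so the hanging
  subtrees whose \<open>j\<close>-th neighbour lies in it are isolated by two prefix sums; a table
  of predecessors spares the search for their ends. One rank per hanging subtree is enough: its
  topmost surviving neighbour acts as a hub to which the pieces of all its surviving neighbours are
  linked. Each of these pieces ends at a failed vertex above or at \<open>f\<close>, so the failed
  vertices, with \<open>u\<close> and \<open>v\<close>, name all explicit pieces. Intermediate
  counts may wrap modulo \<open>2 ^ w\<close>; a link count itself is nonnegative and below
  \<open>2 ^ w\<close>, so its vanishing is still decided.\<close>

locale ranked_tree =
  fixes N :: nat and par :: "nat \<Rightarrow> nat"
  assumes N_pos: "0 < N" and par_less: "0 < i \<Longrightarrow> i < N \<Longrightarrow> par i < i"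
begin

inductive anc :: "nat \<Rightarrow> nat \<Rightarrow> bool" where
  anc_refl: "b < N \<Longrightarrow> anc b b"
| anc_up: "0 < b \<Longrightarrow> b < N \<Longrightarrow> anc a (par b) \<Longrightarrow> anc a b"

lemma par_less_N: "0 < i \<Longrightarrow> i < N \<Longrightarrow> par i < N"
  using par_less[of i] by simp

lemma anc_N: "anc a b \<Longrightarrow> b < N"
  by (induction rule: anc.induct) auto

lemma anc_le: "anc a b \<Longrightarrow> a \<le> b"
proof (induction rule: anc.induct)
  case (anc_up b a)
  then show ?case using par_less[of b] by simp
qed simp

lemma anc_N1: "anc a b \<Longrightarrow> a < N"
  by (rule le_less_trans[OF anc_le anc_N])

lemma anc_trans: "anc b c \<Longrightarrow> anc a b \<Longrightarrow> anc a c"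
  by (induction rule: anc.induct) (auto intro: anc_up)

lemma anc_par: "0 < b \<Longrightarrow> b < N \<Longrightarrow> anc (par b) b"
  by (rule anc_up) (auto intro: anc_refl par_less_N)

lemma anc_strict: "anc a b \<Longrightarrow> a \<noteq> b \<Longrightarrow> 0 < b \<and> anc a (par b)"
  by (erule anc.cases) auto

lemma anc_antisym: "anc a b \<Longrightarrow> anc b a \<Longrightarrow> a = b"
  by (rule le_antisym[OF anc_le anc_le])

lemma anc_linear: "anc b c \<Longrightarrow> anc a c \<Longrightarrow> anc a b \<or> anc b a"
proof (induction rule: anc.induct)
  case (anc_up c b)
  show ?case
  proof (cases "a = c")
    case True
    then show ?thesis using anc.anc_up[OF anc_up.hyps] by simp
  next
    case False
    then have "anc a (par c)" using anc_strict[OF anc_up.prems] by simp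
    then show ?thesis by (rule anc_up.IH)
  qed
qed simp

text \<open>The ancestors of one vertex form a chain, and parents have smaller numbers, so on that
  chain the tree order is the order of the numbers. Comparing numbers is thus enough to locate a
  vertex on a path.\<close>

lemma anc_linear_le: "anc a c \<Longrightarrow> anc b c \<Longrightarrow> a \<le> b \<Longrightarrow> anc a b"
  using anc_linear[of b c a] anc_le[of b a] anc_refl[OF anc_N1, of a c] by auto

lemma anc_of_0: "anc a 0 \<Longrightarrow> a = 0"
  using anc_le by auto

lemma child_ex: "anc a b \<Longrightarrow> a \<noteq> b \<Longrightarrow> \<exists>c. 0 < c \<and> par c = a \<and> anc c b"
proof (induction rule: anc.induct)
  case (anc_up b a)
  show ?case
  proof (cases "a = par b")
    case True
    then show ?thesis using anc_up.hyps anc_refl by blast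
  next
    case False
    then obtain c where "0 < c" "par c = a" "anc c (par b)" using anc_up.IH by blast
    then show ?thesis using anc.anc_up[of b c] anc_up.hyps by blast
  qed
qed simp

lemma child_unique:
  assumes "0 < c" "par c = a" "anc c b" "0 < c'" "par c' = a" "anc c' b"
  shows "c = c'"
proof -
  have *: "c = c'" if "anc c c'" "0 < c" "par c = par c'" for c c'
  proof (rule ccontr)
    assume "c \<noteq> c'"
    then have "anc c (par c')" using anc_strict[OF that(1)] by blast
    then have "c \<le> par c'" by (rule anc_le)
    moreover have "par c < c" by (rule par_less[OF that(2) anc_N1[OF that(1)]])
    ultimately show False using that by simp
  qed
  from anc_linear[OF assms(3,6)] show ?thesis
    using *[of c c'] *[of c' c] assms by auto
qed

text \<open>The value 0 doubles as "not a proper ancestor", which is unambiguous since the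
  artificial root is nobody's child. One table of \<open>child\<close> therefore serves for ancestor
  tests and for finding the top of the piece below a failed vertex.\<close>

definition child :: "nat \<Rightarrow> nat \<Rightarrow> nat" where
  "child a b = (if anc a b \<and> a \<noteq> b then THE c. 0 < c \<and> par c = a \<and> anc c b else 0)"

lemma child_props:
  assumes "anc a b" "a \<noteq> b"
  shows "0 < child a b" "par (child a b) = a" "anc (child a b) b"
proof -
  have "\<exists>!c. 0 < c \<and> par c = a \<and> anc c b"
    using child_ex[OF assms] child_unique by blast
  from theI'[OF this] assms show "0 < child a b" "par (child a b) = a" "anc (child a b) b"
    by (auto simp: child_def)
qed

lemma child_eq:
  assumes "0 < c" "par c = a" "anc c b"
  shows "child a b = c"
proof -
  have cN: "c < N" by (rule anc_N1[OF assms(3)])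
  have "anc a c" "a < c" using anc_par[OF assms(1) cN] par_less[OF assms(1) cN] assms(2) by auto
  then have ab: "anc a b" "a \<noteq> b" using anc_trans[OF assms(3)] anc_le[OF assms(3)] by auto
  show ?thesis by (rule child_unique[OF child_props[OF ab] assms])
qed

lemma child_pos_iff: "0 < child a b \<longleftrightarrow> anc a b \<and> a \<noteq> b"
  using child_props by (auto simp: child_def)

lemma child_0: "child a 0 = 0"
  using anc_of_0 by (auto simp: child_def)

lemma child_par: "0 < b \<Longrightarrow> b < N \<Longrightarrow> child (par b) b = b"
  by (rule child_eq) (auto intro: anc_refl)

text \<open>The recurrence behind the computation of \<open>child\<close>: climb from
  \<open>b\<close> until the parent is \<open>a\<close>.\<close>

lemma child_step:
  assumes "0 < b" "b < N" "par b \<noteq> a"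
  shows "child a b = child a (par b)"
proof (cases "anc a (par b)")
  case True
  note c = child_props[OF True assms(3)[symmetric]]
  show ?thesis by (rule child_eq[OF c(1,2) anc_up[OF assms(1,2) c(3)]])
next
  case False
  then have "\<not> (anc a b \<and> a \<noteq> b)" using anc_strict by blast
  then show ?thesis using False by (auto simp: child_def)
qed

definition children :: "nat \<Rightarrow> nat set" where
  "children f = {c. 0 < c \<and> c < N \<and> par c = f}"

lemma finite_children [simp]: "finite (children f)"
  by (auto simp: children_def)

end

section \<open>Neighbours above a subtree and prefix sums ordered by them\<close>

locale dfs_tree = ranked_tree +
  fixes adj :: "nat \<Rightarrow> nat \<Rightarrow> bool"
  assumes adj_sym: "adj i j \<Longrightarrow> adj j i"
    and adj_range: "adj i j \<Longrightarrow> 0 < i \<and> i < N"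
    and adj_anc: "adj i j \<Longrightarrow> anc i j \<or> anc j i"
    and adj_par: "0 < i \<Longrightarrow> i < N \<Longrightarrow> par i \<noteq> 0 \<Longrightarrow> adj (par i) i"
begin

text \<open>Ordered pairs are counted, so an edge inside both subtrees counts twice. Only vanishing
  matters in the end, and the double sum is additive in either subtree.\<close>

definition subtree_edges :: "nat \<Rightarrow> nat \<Rightarrow> nat" where
  "subtree_edges a b =
     (\<Sum>p<N. \<Sum>q<N. if anc a p \<and> anc b q \<and> adj p q then 1 else 0)"

definition nbr :: "nat \<Rightarrow> nat \<Rightarrow> bool" where
  "nbr c p \<longleftrightarrow> anc p c \<and> p \<noteq> c \<and> (\<exists>q. anc c q \<and> adj q p)"

definition nbr_rank :: "nat \<Rightarrow> nat \<Rightarrow> nat" where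
  "nbr_rank c p = card {p'. p' < p \<and> nbr c p'}"

text \<open>The neighbour with exactly \<open>j\<close> neighbours above it; all neighbours of
  \<open>c\<close> lie on one chain. The default \<open>N\<close> exceeds every vertex, so a missing
  neighbour falls into no interval. The set under \<open>Max\<close> has at most one element;
  \<open>Max\<close> is the form in which a loop that keeps its last hit delivers it.\<close>

definition low :: "nat \<Rightarrow> nat \<Rightarrow> nat" where
  "low j c = (if \<exists>p<N. nbr c p \<and> nbr_rank c p = j then Max {p. p < N \<and> nbr c p \<and> nbr_rank c p = j} else N)"

lemma nbr_rank_less: "p < p' \<Longrightarrow> nbr c p \<Longrightarrow> nbr_rank c p < nbr_rank c p'"
  unfolding nbr_rank_def by (rule psubset_card_mono) auto

lemma nbr_N: "nbr c p \<Longrightarrow> p < N"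
  using anc_N1 by (auto simp: nbr_def)

lemma low_eq:
  assumes "nbr c p" shows "low (nbr_rank c p) c = p"
proof -
  have "{p'. p' < N \<and> nbr c p' \<and> nbr_rank c p' = nbr_rank c p} = {p}"
    using assms nbr_N nbr_rank_less by (auto, metis nat_neq_iff)
  then show ?thesis using assms nbr_N by (auto simp: low_def)
qed

lemma low_nbr: "low j c < N \<Longrightarrow> nbr c (low j c)"
  using Max_in[of "{p. p < N \<and> nbr c p \<and> nbr_rank c p = j}"]
  by (auto simp: low_def split: if_splits)

text \<open>Prefix sums over the siblings of \<open>c\<close> in the order of their
  \<open>j\<close>-th neighbours, ties included. The sibling itself is the key, so no sorted array
  is needed; key 0 stands for the empty prefix.\<close>

definition low_prefix :: "nat \<Rightarrow> nat \<Rightarrow> nat \<Rightarrow> nat" where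
  "low_prefix j c y =
     (if c = 0 then 0 else \<Sum>c'\<in>{c' \<in> children (par c). low j c' \<le> low j c}. subtree_edges c' y)"

text \<open>A relation rather than a function, because several children may attain the maximal
  \<open>low j\<close>. By \<open>low_prefix_pred\<close>, every choice gives the same prefix
  sum.\<close>

definition is_pred :: "nat \<Rightarrow> nat \<Rightarrow> nat \<Rightarrow> nat \<Rightarrow> bool" where
  "is_pred j f x c \<longleftrightarrow> c < N \<and>
     (if \<forall>c'\<in>children f. x < low j c' then c = 0
      else c \<in> children f \<and> low j c \<le> x \<and> (\<forall>c'\<in>children f. low j c' \<le> x \<longrightarrow> low j c' \<le> low j c))"

lemma low_prefix_pred:
  assumes "is_pred j f x c"
  shows "low_prefix j c y = (\<Sum>c'\<in>{c' \<in> children f. low j c' \<le> x}. subtree_edges c' y)"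
proof (cases "\<forall>c'\<in>children f. x < low j c'")
  case True
  then have "{c' \<in> children f. low j c' \<le> x} = {}" by auto
  then have "(\<Sum>c'\<in>{c' \<in> children f. low j c' \<le> x}. subtree_edges c' y) = 0" by (simp only: sum.empty)
  with True assms show ?thesis by (simp add: is_pred_def low_prefix_def)
next
  case False
  then have c: "c \<in> children f" "low j c \<le> x" "\<And>c'. c' \<in> children f \<Longrightarrow> low j c' \<le> x \<Longrightarrow> low j c' \<le> low j c"
    using assms by (auto simp: is_pred_def)
  then have "0 < c" "par c = f" by (auto simp: children_def)
  moreover have "{c' \<in> children f. low j c' \<le> low j c} = {c' \<in> children f. low j c' \<le> x}"
    using c by force
  ultimately show ?thesis by (simp add: low_prefix_def)
qed

end

section \<open>The pieces into which failed vertices cut the tree\<close>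

locale failures = dfs_tree +
  fixes S :: "nat set"
  assumes S_range: "S \<subseteq> {1..<N}"
begin

lemma finite_S [simp]: "finite S"
  using S_range finite_subset by blast

lemma S_pos: "x \<in> S \<Longrightarrow> 0 < x \<and> x < N"
  using S_range by force

text \<open>\<open>c\<close> is the top of the piece of \<open>y\<close>. A failed \<open>y\<close>
  is assigned to the piece that ends at it from above, since \<open>z = y\<close> is exempt; this is
  how failed vertices come to name pieces. If its parent has failed too, \<open>y\<close> is its own
  top.\<close>

definition is_root :: "nat \<Rightarrow> nat \<Rightarrow> bool" where
  "is_root c y \<longleftrightarrow> 0 < c \<and> anc c y \<and> (par c = 0 \<or> par c \<in> S) \<and> (\<forall>z\<in>S. anc c z \<longrightarrow> anc z y \<longrightarrow> z = y)"

lemma is_root_unique: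
  assumes "is_root c y" "is_root c' y" shows "c = c'"
proof -
  have *: "c = c'" if c: "is_root c y" "is_root c' y" "anc c c'" for c c'
  proof (rule ccontr)
    assume "c \<noteq> c'"
    then have a: "anc c (par c')" "0 < c'" using anc_strict that(3) by auto
    then have "0 < par c'" using anc_le c(1) unfolding is_root_def by force
    then have "par c' \<in> S" using c(2) unfolding is_root_def by simp
    moreover have N: "c' < N" using anc_N1 c(2) unfolding is_root_def by blast
    then have "anc (par c') c'" "par c' < c'" using anc_par par_less a by auto
    moreover have "anc c' y" using c(2) unfolding is_root_def by blast
    then have "anc (par c') y" "par c' < y" using anc_trans calculation anc_le by (blast, force)
    ultimately show False using c(1) a unfolding is_root_def by blast
  qed
  have "anc c y" "anc c' y" using assms unfolding is_root_def by auto
  then show ?thesis using anc_linear * assms by metis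
qed

text \<open>Induction along parents: below a surviving parent the top is inherited, below a failed
  parent or the artificial root \<open>y\<close> starts a new piece.\<close>

lemma is_root_ex: "0 < y \<Longrightarrow> y < N \<Longrightarrow> \<exists>c. is_root c y"
proof (induction y rule: less_induct)
  case (less y)
  show ?case
  proof (cases "par y = 0 \<or> par y \<in> S")
    case True
    then have "is_root y y" using less.prems anc_refl anc_antisym by (auto simp: is_root_def)
    then show ?thesis by blast
  next
    case False
    then obtain c where c: "is_root c (par y)" using less par_less par_less_N by blast
    have "is_root c y"
      unfolding is_root_def
    proof (intro conjI ballI impI)
      show "anc c y" using c anc_up less.prems by (auto simp: is_root_def)
      fix z assume z: "z \<in> S" "anc c z" "anc z y"
      show "z = y"
      proof (rule ccontr)
        assume "z \<noteq> y"
        then have "anc z (par y)" using anc_strict z by blast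
        then show False using c z False unfolding is_root_def by blast
      qed
    qed (use c in \<open>auto simp: is_root_def\<close>)
    then show ?thesis by blast
  qed
qed

definition root :: "nat \<Rightarrow> nat" where
  "root y = (SOME c. is_root c y)"

lemma is_root_root: "0 < y \<Longrightarrow> y < N \<Longrightarrow> is_root (root y) y"
  unfolding root_def by (rule someI_ex[OF is_root_ex])

lemma root_eqI: "is_root c y \<Longrightarrow> root y = c"
  unfolding root_def by (rule is_root_unique[OF someI])

abbreviation "guard y \<equiv> par (root y)"

lemma root_props:
  assumes "0 < y" "y < N"
  shows "0 < root y" "anc (root y) y" "guard y = 0 \<or> guard y \<in> S" "root y < N" "root y \<le> y"
    "anc (guard y) y" "guard y < y" "\<And>z. z \<in> S \<Longrightarrow> anc (root y) z \<Longrightarrow> anc z y \<Longrightarrow> z = y"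
proof -
  note r = is_root_root[OF assms, unfolded is_root_def]
  show *: "0 < root y" "anc (root y) y" "guard y = 0 \<or> guard y \<in> S"
    "\<And>z. z \<in> S \<Longrightarrow> anc (root y) z \<Longrightarrow> anc z y \<Longrightarrow> z = y"
    using r by auto
  show **: "root y < N" "root y \<le> y" by (rule anc_N1[OF *(2)], rule anc_le[OF *(2)])
  show "anc (guard y) y" by (rule anc_trans[OF *(2) anc_par[OF *(1) **(1)]])
  show "guard y < y" using par_less[OF *(1) **(1)] **(2) by simp
qed

text \<open>Makes \<open>guard y\<close> computable as the maximum of the failed proper ancestors of
  \<open>y\<close>, with default 0; \<open>child_guard\<close> then reads the top of the piece off
  the table of \<open>child\<close>.\<close>

lemma guard_Max:
  assumes "0 < y" "y < N" "z \<in> insert 0 S" "anc z y" "z \<noteq> y"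
  shows "z \<le> guard y"
proof (cases "z = 0")
  case False
  then have z: "z \<in> S" using assms by simp
  note r = root_props[OF assms(1,2)]
  have "\<not> anc (root y) z" using r(8)[OF z] assms by blast
  then have a: "anc z (root y)" "z \<noteq> root y" using anc_linear[OF r(2) assms(4)] anc_refl[OF r(4)] by auto
  show ?thesis by (rule anc_le[OF conjunct2[OF anc_strict[OF a]]])
qed simp

lemma child_guard: "0 < y \<Longrightarrow> y < N \<Longrightarrow> child (guard y) y = root y"
  using root_props by (intro child_eq) auto

lemma root_fixed:
  assumes "0 < y" "y < N" "par y = 0 \<or> par y \<in> S" shows "root y = y"
  by (rule root_eqI) (use assms anc_refl anc_antisym in \<open>auto simp: is_root_def\<close>)

lemma root_par:
  assumes "0 < y" "y < N" "par y \<noteq> 0" "par y \<notin> S" shows "root (par y) = root y"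
proof (rule root_eqI, unfold is_root_def, intro conjI ballI impI)
  note r = root_props[OF assms(1,2)]
  have "root y \<noteq> y" using r(3) assms by auto
  then show a: "anc (root y) (par y)" using anc_strict[OF r(2)] by blast
  fix z assume z: "z \<in> S" "anc (root y) z" "anc z (par y)"
  have "anc z y" by (rule anc_up[OF assms(1,2) z(3)])
  then have "z = y" using r(8) z by blast
  then have "y \<le> par y" using anc_le[OF z(3)] by simp
  then show "z = par y" using par_less[OF assms(1,2)] by simp
qed (use root_props[OF assms(1,2)] in auto)

text \<open>The surviving part of the piece of \<open>y\<close>, without \<open>y\<close> itself if
  it has failed. It is empty for a failed child of a failed vertex.\<close>

definition comp_of :: "nat \<Rightarrow> nat set" where
  "comp_of y = {q. 0 < q \<and> q < N \<and> q \<notin> S \<and> root q = root y}"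

lemma finite_comp_of [simp]: "finite (comp_of y)"
  by (auto simp: comp_of_def)

text \<open>The topmost failure between \<open>root y\<close> and \<open>q\<close>, which is the one
  with the smallest number, has \<open>root y\<close> as its top, as nothing failed lies in
  between.\<close>

lemma failed_below:
  assumes "0 < y" "y < N" "z \<in> S" "anc (root y) z" "anc z q"
  shows "\<exists>g\<in>S. root g = root y \<and> anc g q"
proof -
  define P where "P z \<longleftrightarrow> z \<in> S \<and> anc (root y) z \<and> anc z q" for z
  define g where "g = (LEAST z. P z)"
  have "P z" using assms by (simp add: P_def)
  then have g: "P g" unfolding g_def by (rule LeastI)
  have le: "g \<le> z" if "P z" for z unfolding g_def by (rule Least_le[of P, OF that])
  have "is_root (root y) g" unfolding is_root_def
  proof (intro conjI ballI impI)
    fix z' assume z': "z' \<in> S" "anc (root y) z'" "anc z' g"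
    have "anc z' q" by (rule anc_trans[OF _ z'(3)]) (use g in \<open>simp add: P_def\<close>)
    then have "P z'" using z' by (simp add: P_def)
    from le[OF this] show "z' = g" using anc_le[OF z'(3)] by simp
  qed (use g root_props[OF assms(1,2)] in \<open>auto simp: P_def\<close>)
  from root_eqI[OF this] show ?thesis using g unfolding P_def by blast
qed

lemma comp_of_iff:
  assumes "0 < y" "y < N"
  shows "q \<in> comp_of y \<longleftrightarrow> anc (root y) q \<and> (\<forall>g\<in>S. root g = root y \<longrightarrow> \<not> anc g q)"
proof
  assume q: "q \<in> comp_of y"
  then have q': "0 < q" "q < N" "q \<notin> S" "root q = root y" by (auto simp: comp_of_def)
  note r = root_props[OF q'(1,2)]
  have "\<not> anc g q" if "g \<in> S" "root g = root y" for g
  proof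
    assume "anc g q"
    moreover have "anc (root q) g" using root_props(2)[of g] S_pos[OF that(1)] that(2) q'(4) by simp
    ultimately have "g = q" using r(8) that by blast
    then show False using that q' by simp
  qed
  then show "anc (root y) q \<and> (\<forall>g\<in>S. root g = root y \<longrightarrow> \<not> anc g q)"
    using r(2) q'(4) by auto
next
  assume *: "anc (root y) q \<and> (\<forall>g\<in>S. root g = root y \<longrightarrow> \<not> anc g q)"
  note r = root_props[OF assms]
  have q: "0 < q" "q < N" using anc_le[of "root y" q] anc_N[of "root y" q] * r(1) by auto
  have no: "\<not> (anc (root y) z \<and> anc z q)" if "z \<in> S" for z
    using failed_below[OF assms that] * by blast
  have "q \<notin> S" using no[of q] * anc_refl[OF q(2)] by blast
  moreover have "is_root (root y) q" using * no r unfolding is_root_def by blast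
  then have "root q = root y" by (rule root_eqI)
  ultimately show "q \<in> comp_of y" using q by (simp add: comp_of_def)
qed

lemma failed_disjoint:
  assumes "g \<in> S" "g' \<in> S" "root g = root g'" "anc g q" "anc g' q"
  shows "g = g'"
proof -
  have *: "g = g'" if "g \<in> S" "g' \<in> S" "root g = root g'" "anc g g'" for g g'
    using root_props(8)[of g' g] root_props(2)[of g] S_pos that by auto
  from anc_linear[OF assms(4,5)] show ?thesis using *[of g g'] *[of g' g] assms(1-3) by auto
qed

text \<open>The subtrees of the failed vertices with top \<open>root y\<close> are disjoint and lie
  in the subtree of \<open>root y\<close>; what they leave over is \<open>comp_of y\<close>. So if
  \<open>R b\<close> is a sum over the subtree of \<open>b\<close>, this is the sum over the
  surviving piece.\<close>

definition comp_sum :: "(nat \<Rightarrow> int) \<Rightarrow> nat \<Rightarrow> int" where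
  "comp_sum R y = R (root y) - (\<Sum>g\<in>{g \<in> S. root g = root y}. R g)"

lemma comp_sum_eq:
  assumes "0 < y" "y < N"
    and R: "\<And>b. 0 < b \<Longrightarrow> b < N \<Longrightarrow> R b = (\<Sum>q\<in>{..<N}. if anc b q then r q else 0)"
  shows "comp_sum R y = (\<Sum>q\<in>comp_of y. r q)"
proof -
  let ?G = "{g \<in> S. root g = root y}"
  have "(\<Sum>g\<in>?G. R g) = (\<Sum>g\<in>?G. \<Sum>q\<in>{..<N}. if anc g q then r q else 0)"
    using R S_pos by (intro sum.cong) auto
  also have "\<dots> = (\<Sum>q\<in>{..<N}. \<Sum>g\<in>?G. if anc g q then r q else 0)"
    by (rule sum.swap)
  also have "\<dots> = (\<Sum>q\<in>{..<N}. if \<exists>g\<in>?G. anc g q then r q else 0)"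
  proof (intro sum.cong refl)
    fix q
    show "(\<Sum>g\<in>?G. if anc g q then r q else 0) = (if \<exists>g\<in>?G. anc g q then r q else 0)"
    proof (cases "\<exists>g\<in>?G. anc g q")
      case True
      then obtain g where g: "g \<in> ?G" "anc g q" by blast
      \<comment> \<open>By \<open>failed_disjoint\<close>, \<open>g\<close> is the only element of
        \<open>?G\<close> above \<open>q\<close>, so the inner sum has a single nonzero term at
        most.\<close>
      have "(\<Sum>g\<in>?G. if anc g q then r q else 0) = (\<Sum>g'\<in>?G. if g' = g then r q else 0)"
        using g failed_disjoint by (intro sum.cong refl) auto
      with True g show ?thesis by simp
    qed auto
  qed
  finally have "comp_sum R y = (\<Sum>q\<in>{..<N}. if anc (root y) q then r q else 0)
      - (\<Sum>q\<in>{..<N}. if \<exists>g\<in>?G. anc g q then r q else 0)"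
    using R root_props[OF assms(1,2)] by (simp add: comp_sum_def)
  also have "\<dots> = (\<Sum>q\<in>{..<N}. (if anc (root y) q then r q else 0) - (if \<exists>g\<in>?G. anc g q then r q else 0))"
    by (simp only: sum_subtractf)
  also have "\<dots> = (\<Sum>q\<in>{..<N}. if q \<in> comp_of y then r q else 0)"
  proof (intro sum.cong refl)
    fix q
    have "anc (root y) q" if "g \<in> ?G" "anc g q" for g
      using that root_props(2)[of g] S_pos[of g] anc_trans[of g q "root g"] by auto
    then show "(if anc (root y) q then r q else 0) - (if \<exists>g\<in>?G. anc g q then r q else 0)
      = (if q \<in> comp_of y then r q else 0)"
      unfolding comp_of_iff[OF assms(1,2)] by auto
  qed
  also have "\<dots> = (\<Sum>q\<in>comp_of y. r q)"
    by (rule sum.mono_neutral_cong_right) (auto simp: comp_of_def)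
  finally show ?thesis .
qed

end

section \<open>Connectivity after vertex failures\<close>

context failures
begin

section \<open>Edge counts between surviving pieces\<close>

definition subtree :: "nat \<Rightarrow> nat set" where
  "subtree a = {p. anc a p}"

lemma subtree_subset: "subtree a \<subseteq> {..<N}"
  using anc_N by (auto simp: subtree_def)

lemma finite_subtree [simp]: "finite (subtree a)"
  by (rule finite_subset[OF subtree_subset]) simp

definition edges :: "nat set \<Rightarrow> nat set \<Rightarrow> int" where
  "edges A B = (\<Sum>p\<in>A. \<Sum>q\<in>B. if adj p q then 1 else 0)"

lemma edges_nonneg: "0 \<le> edges A B"
  unfolding edges_def by (intro sum_nonneg) auto

lemma edges_le:
  assumes "A \<subseteq> {..<N}" "B \<subseteq> {..<N}"
  shows "edges A B \<le> int (N * N)"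
proof -
  have "edges A B \<le> (\<Sum>p\<in>A. \<Sum>q\<in>B. 1)"
    unfolding edges_def by (intro sum_mono) auto
  also have "\<dots> = int (card A * card B)" by simp
  also have "\<dots> \<le> int (N * N)"
    using card_mono[OF _ assms(1)] card_mono[OF _ assms(2)] by (intro of_nat_mono mult_le_mono) auto
  finally show ?thesis .
qed

lemma edges_eq_0_iff:
  assumes "finite A" "finite B"
  shows "edges A B = 0 \<longleftrightarrow> (\<forall>p\<in>A. \<forall>q\<in>B. \<not> adj p q)"
  unfolding edges_def using assms
  by (subst sum_nonneg_eq_0_iff) (auto intro!: sum_nonneg simp: sum_nonneg_eq_0_iff)

text \<open>Brings the count into the form that \<open>comp_sum_eq\<close> asks for: a sum over the
  subtree of \<open>b\<close>, with \<open>a\<close> fixed.\<close>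

lemma subtree_edges_right:
  "int (subtree_edges a b) = (\<Sum>q\<in>{..<N}. if anc b q then (\<Sum>p\<in>subtree a. if adj p q then 1 else 0) else 0)"
proof -
  have "int (subtree_edges a b) = (\<Sum>p<N. \<Sum>q<N. if anc a p \<and> anc b q \<and> adj p q then 1 else 0)"
    unfolding subtree_edges_def of_nat_sum by (intro sum.cong refl) auto
  also have "\<dots> = (\<Sum>q<N. \<Sum>p<N. if anc a p \<and> anc b q \<and> adj p q then 1 else 0)"
    by (rule sum.swap)
  also have "\<dots> = (\<Sum>q<N. if anc b q then (\<Sum>p\<in>subtree a. if adj p q then 1 else 0) else 0)"
  proof (intro sum.cong refl)
    fix q
    have "(\<Sum>p<N. if anc a p \<and> adj p q then 1 else 0) = (\<Sum>p\<in>subtree a. if adj p q then 1 else (0::int))"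
      using anc_N by (intro sum.mono_neutral_cong_right) (auto simp: subtree_def)
    then show "(\<Sum>p<N. if anc a p \<and> anc b q \<and> adj p q then 1 else 0) =
      (if anc b q then (\<Sum>p\<in>subtree a. if adj p q then 1 else 0) else (0::int))" by auto
  qed
  finally show ?thesis .
qed

lemma comp_sum_right:
  assumes "0 < y" "y < N"
  shows "comp_sum (\<lambda>b. int (subtree_edges a b)) y = edges (subtree a) (comp_of y)"
  unfolding edges_def by (subst comp_sum_eq[OF assms subtree_edges_right]) (rule sum.swap)

lemma comp_sum_left:
  assumes "0 < x" "x < N"
  shows "comp_sum (\<lambda>a. edges (subtree a) B) x = edges (comp_of x) B"
proof -
  have "edges (subtree a) B = (\<Sum>p\<in>{..<N}. if anc a p then (\<Sum>q\<in>B. if adj p q then 1 else 0) else 0)" for a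
    unfolding edges_def using anc_N by (intro sum.mono_neutral_cong_left) (auto simp: subtree_def)
  from comp_sum_eq[OF assms this] show ?thesis by (simp add: edges_def)
qed

lemma comp_sum_cong:
  "0 < y \<Longrightarrow> y < N \<Longrightarrow> (\<And>b. 0 < b \<Longrightarrow> b < N \<Longrightarrow> R b = R' b) \<Longrightarrow> comp_sum R y = comp_sum R' y"
  unfolding comp_sum_def using root_props S_pos
  by (intro arg_cong2[of _ _ _ _ "(-)"] sum.cong) auto

lemma comp_sum_sum:
  "comp_sum (\<lambda>b. \<Sum>c\<in>A. F c b) y = (\<Sum>c\<in>A. comp_sum (F c) y)"
  unfolding comp_sum_def sum_subtractf by (subst sum.swap) simp

section \<open>Links between pieces, direct and through hanging subtrees\<close>

definition link1 :: "nat \<Rightarrow> nat \<Rightarrow> int" where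
  "link1 x y = comp_sum (\<lambda>a. comp_sum (\<lambda>b. int (subtree_edges a b)) y) x"

text \<open>Failed subtrees are cut out in both arguments, one after the other; this takes at most
  \<open>(card S + 1) ^ 2\<close> table entries.\<close>

lemma link1_eq:
  assumes "0 < x" "x < N" "0 < y" "y < N"
  shows "link1 x y = edges (comp_of x) (comp_of y)"
  unfolding link1_def comp_sum_right[OF assms(3,4)] comp_sum_left[OF assms(1,2)] ..

definition hanging :: "nat \<Rightarrow> nat set" where
  "hanging f = {c \<in> children f. \<forall>g\<in>S. \<not> anc c g}"

text \<open>A child of \<open>f\<close> with a failure in its subtree is the top of a topmost such
  failure, and conversely. Hence there are at most \<open>card S\<close> of these children, and a
  query finds them among the tops of the failed vertices.\<close>

lemma not_hanging:
  assumes "f \<in> S"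
  shows "{c \<in> children f. \<exists>g\<in>S. anc c g} = root ` {g \<in> S. guard g = f}"
proof (intro equalityI subsetI)
  fix c assume "c \<in> {c \<in> children f. \<exists>g\<in>S. anc c g}"
  then obtain g where c: "0 < c" "c < N" "par c = f" and g: "g \<in> S" "anc c g"
    by (auto simp: children_def)
  have rc: "root c = c" using root_fixed c assms by simp
  from failed_below[OF c(1,2) g(1), of g] g anc_refl S_pos
  obtain g' where "g' \<in> S" "root g' = c" unfolding rc by blast
  then show "c \<in> root ` {g \<in> S. guard g = f}" using c(3) by force
next
  fix c assume "c \<in> root ` {g \<in> S. guard g = f}"
  then obtain g where g: "g \<in> S" "guard g = f" "c = root g" by auto
  with root_props[of g] S_pos[of g] show "c \<in> {c \<in> children f. \<exists>g\<in>S. anc c g}"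
    by (auto simp: children_def)
qed

text \<open>Edges into the piece of \<open>y\<close> from those subtrees hanging below
  \<open>f\<close> whose \<open>j\<close>-th neighbour lies strictly between \<open>guard x\<close>
  and \<open>x\<close>. The two prefixes differ by all children of \<open>f\<close> with
  \<open>low j\<close> in this range, and \<open>x - 1\<close> excludes \<open>x\<close> itself; the
  last sum takes off the children that contain failures.\<close>

definition link2 :: "(nat \<Rightarrow> nat \<Rightarrow> nat \<Rightarrow> nat) \<Rightarrow> nat \<Rightarrow> nat \<Rightarrow> nat \<Rightarrow> nat \<Rightarrow> int" where
  "link2 pr f j x y =
     comp_sum (\<lambda>b. int (low_prefix j (pr j f (x - 1)) b)) y
     - comp_sum (\<lambda>b. int (low_prefix j (pr j f (guard x)) b)) y
     - (\<Sum>c\<in>{c \<in> root ` {g \<in> S. guard g = f}. guard x < low j c \<and> low j c < x}.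
          comp_sum (\<lambda>b. int (subtree_edges c b)) y)"

lemma link2_eq:
  assumes f: "f \<in> S" and x: "0 < x" "x < N" and y: "0 < y" "y < N"
    and pr: "is_pred j f (x - 1) (pr j f (x - 1))" "is_pred j f (guard x) (pr j f (guard x))"
  shows "link2 pr f j x y = (\<Sum>c\<in>{c \<in> hanging f. guard x < low j c \<and> low j c < x}. edges (subtree c) (comp_of y))"
proof -
  let ?F = "\<lambda>c. edges (subtree c) (comp_of y)"
  have prefix: "comp_sum (\<lambda>b. int (low_prefix j (pr j f z) b)) y = (\<Sum>c\<in>{c \<in> children f. low j c \<le> z}. ?F c)"
    if "is_pred j f z (pr j f z)" for z
    unfolding low_prefix_pred[OF that] of_nat_sum comp_sum_sum comp_sum_right[OF y] ..
  have gx: "guard x < x" using root_props[OF x] by simp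
  let ?M = "{c \<in> children f. guard x < low j c \<and> low j c < x}"
  have "{c \<in> children f. low j c \<le> x - 1} = {c \<in> children f. low j c \<le> guard x} \<union> ?M"
    using gx by auto
  then have 1: "(\<Sum>c\<in>{c \<in> children f. low j c \<le> x - 1}. ?F c)
      = (\<Sum>c\<in>{c \<in> children f. low j c \<le> guard x}. ?F c) + (\<Sum>c\<in>?M. ?F c)"
    by (simp only:, subst sum.union_disjoint) auto
  let ?A = "{c \<in> hanging f. guard x < low j c \<and> low j c < x}"
  let ?B = "{c \<in> root ` {g \<in> S. guard g = f}. guard x < low j c \<and> low j c < x}"
  have "?M = ?A \<union> ?B" "?A \<inter> ?B = {}"
    unfolding not_hanging[OF f, symmetric] hanging_def by auto
  then have 2: "(\<Sum>c\<in>?M. ?F c) = (\<Sum>c\<in>?A. ?F c) + (\<Sum>c\<in>?B. ?F c)"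
    by (simp only:, subst sum.union_disjoint) (auto simp: hanging_def)
  show ?thesis
    unfolding link2_def prefix[OF pr(1)] prefix[OF pr(2)] comp_sum_right[OF y] 1 2 by simp
qed

text \<open>The condition \<open>anc x f\<close> puts the segment between \<open>guard x\<close> and
  \<open>x\<close> on the path to \<open>f\<close>, where the neighbours of subtrees hanging below
  \<open>f\<close> lie. The second summand singles out the piece of \<open>x\<close> as the place of
  the \<open>j\<close>-th neighbour, so \<open>link\<close> is not symmetric.\<close>

definition link :: "(nat \<Rightarrow> nat \<Rightarrow> nat \<Rightarrow> nat) \<Rightarrow> nat \<Rightarrow> nat \<Rightarrow> nat \<Rightarrow> int" where
  "link pr J x y = link1 x y + (\<Sum>f\<in>S. if anc x f then (\<Sum>j<J. link2 pr f j x y) else 0)"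

definition good_pred :: "(nat \<Rightarrow> nat \<Rightarrow> nat \<Rightarrow> nat) \<Rightarrow> nat \<Rightarrow> bool" where
  "good_pred pr J \<longleftrightarrow> (\<forall>j<J. \<forall>f<N. \<forall>x<N. is_pred j f x (pr j f x))"

lemma link2_eq':
  assumes "good_pred pr J" "j < J" "f \<in> S" "0 < x" "x < N" "0 < y" "y < N"
  shows "link2 pr f j x y = (\<Sum>c\<in>{c \<in> hanging f. guard x < low j c \<and> low j c < x}. edges (subtree c) (comp_of y))"
proof -
  have "f < N" "x - 1 < N" "guard x < N"
    using S_pos[OF assms(3)] assms(5) root_props(7)[OF assms(4,5)] by auto
  then show ?thesis using assms by (intro link2_eq) (auto simp: good_pred_def)
qed

lemma link2_nonneg:
  assumes "good_pred pr J" "j < J" "f \<in> S" "0 < x" "x < N" "0 < y" "y < N"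
  shows "0 \<le> link2 pr f j x y"
  unfolding link2_eq'[OF assms] by (intro sum_nonneg edges_nonneg)

lemma comp_of_subset: "comp_of y \<subseteq> {..<N}"
  by (auto simp: comp_of_def)

text \<open>Nonnegativity lets a sum of counts vanish only if every count does. The upper bound is
  what allows a machine that knows the value modulo \<open>2 ^ w\<close> only to test it for
  0.\<close>

lemma link_bounds:
  assumes "good_pred pr J" "0 < x" "x < N" "0 < y" "y < N"
  shows "0 \<le> link pr J x y" "link pr J x y \<le> int (N * N + card S * (J * (N * (N * N))))"
proof -
  have l2: "link2 pr f j x y \<le> int (N * (N * N))" if "j < J" "f \<in> S" for j f
  proof -
    let ?A = "{c \<in> hanging f. guard x < low j c \<and> low j c < x}"
    have "link2 pr f j x y \<le> (\<Sum>c\<in>?A. int (N * N))"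
      unfolding link2_eq'[OF assms(1) that assms(2-5)]
      by (intro sum_mono edges_le subtree_subset comp_of_subset)
    also have "\<dots> = int (card ?A * (N * N))" by simp
    also have "card ?A \<le> card {..<N}"
      by (rule card_mono) (auto simp: hanging_def children_def)
    then have "int (card ?A * (N * N)) \<le> int (N * (N * N))"
      by (intro of_nat_mono mult_le_mono1) simp
    finally show ?thesis .
  qed
  have l2s: "(if anc x f then (\<Sum>j<J. link2 pr f j x y) else 0) \<le> int (J * (N * (N * N)))" if "f \<in> S" for f
  proof -
    have "(\<Sum>j<J. link2 pr f j x y) \<le> (\<Sum>j<J. int (N * (N * N)))"
      by (rule sum_mono) (use l2 that in auto)
    also have "\<dots> = int (J * (N * (N * N)))" by simp
    finally show ?thesis by auto
  qed
  have "(\<Sum>f\<in>S. if anc x f then (\<Sum>j<J. link2 pr f j x y) else 0) \<le> (\<Sum>f\<in>S. int (J * (N * (N * N))))"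
    by (rule sum_mono) (rule l2s)
  also have "\<dots> = int (card S * (J * (N * (N * N))))" by simp
  finally show "link pr J x y \<le> int (N * N + card S * (J * (N * (N * N))))"
    using edges_le[OF comp_of_subset comp_of_subset, of x y] link1_eq[OF assms(2-5)]
    unfolding link_def by simp
  show "0 \<le> link pr J x y"
    unfolding link_def link1_eq[OF assms(2-5)]
    by (intro add_nonneg_nonneg edges_nonneg sum_nonneg)
       (use link2_nonneg[OF assms(1) _ _ assms(2-5)] in \<open>auto intro!: sum_nonneg\<close>)
qed

lemma link_pos_iff:
  assumes "good_pred pr J" "0 < x" "x < N" "0 < y" "y < N"
  shows "0 < link pr J x y \<longleftrightarrow>
    (\<exists>p\<in>comp_of x. \<exists>q\<in>comp_of y. adj p q) \<or>
    (\<exists>f\<in>S. anc x f \<and> (\<exists>j<J. \<exists>c\<in>hanging f. guard x < low j c \<and> low j c < x \<and>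
       (\<exists>p\<in>subtree c. \<exists>q\<in>comp_of y. adj p q)))"
proof -
  let ?A = "\<lambda>f j. {c \<in> hanging f. guard x < low j c \<and> low j c < x}"
  have fin: "finite (?A f j)" for f j by (auto simp: hanging_def)
  have l2: "link2 pr f j x y = 0 \<longleftrightarrow> (\<forall>c\<in>?A f j. \<not> (\<exists>p\<in>subtree c. \<exists>q\<in>comp_of y. adj p q))"
    if "f \<in> S" "j < J" for f j
  proof -
    have "link2 pr f j x y = 0 \<longleftrightarrow> (\<forall>c\<in>?A f j. edges (subtree c) (comp_of y) = 0)"
      unfolding link2_eq'[OF assms(1) that(2,1) assms(2-5)]
      by (rule sum_nonneg_eq_0_iff[OF fin edges_nonneg])
    then show ?thesis by (simp add: edges_eq_0_iff)
  qed
  have l2n: "0 \<le> link2 pr f j x y" if "f \<in> S" "j < J" for f j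
    by (rule link2_nonneg[OF assms(1) that(2,1) assms(2-5)])
  let ?G = "\<lambda>f. if anc x f then (\<Sum>j<J. link2 pr f j x y) else 0"
  have G: "0 \<le> ?G f" "?G f = 0 \<longleftrightarrow> (anc x f \<longrightarrow> (\<forall>j<J. link2 pr f j x y = 0))" if "f \<in> S" for f
  proof -
    have "0 \<le> (\<Sum>j<J. link2 pr f j x y)" by (rule sum_nonneg) (use l2n[OF that] in simp)
    then show "0 \<le> ?G f" by simp
    have "(\<Sum>j<J. link2 pr f j x y) = 0 \<longleftrightarrow> (\<forall>j\<in>{..<J}. link2 pr f j x y = 0)"
      by (rule sum_nonneg_eq_0_iff) (use l2n[OF that] in simp_all)
    then show "?G f = 0 \<longleftrightarrow> (anc x f \<longrightarrow> (\<forall>j<J. link2 pr f j x y = 0))" by (simp add: Ball_def)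
  qed
  have "link pr J x y = 0 \<longleftrightarrow> edges (comp_of x) (comp_of y) = 0 \<and> sum ?G S = 0"
    unfolding link_def link1_eq[OF assms(2-5)]
    by (rule add_nonneg_eq_0_iff[OF edges_nonneg sum_nonneg[OF G(1)]])
  also have "sum ?G S = 0 \<longleftrightarrow> (\<forall>f\<in>S. ?G f = 0)"
    by (rule sum_nonneg_eq_0_iff[OF finite_S G(1)])
  also have "\<dots> \<longleftrightarrow> (\<forall>f\<in>S. anc x f \<longrightarrow> (\<forall>j<J. \<forall>c\<in>?A f j. \<not> (\<exists>p\<in>subtree c. \<exists>q\<in>comp_of y. adj p q)))"
  proof (rule ball_cong[OF refl])
    fix f assume f: "f \<in> S"
    have "(\<forall>j<J. link2 pr f j x y = 0) \<longleftrightarrow>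
        (\<forall>j<J. \<forall>c\<in>?A f j. \<not> (\<exists>p\<in>subtree c. \<exists>q\<in>comp_of y. adj p q))"
      by (intro all_cong) (rule l2[OF f])
    then show "?G f = 0 \<longleftrightarrow> (anc x f \<longrightarrow> (\<forall>j<J. \<forall>c\<in>?A f j. \<not> (\<exists>p\<in>subtree c. \<exists>q\<in>comp_of y. adj p q)))"
      unfolding G(2)[OF f] by simp
  qed
  finally have *: "link pr J x y = 0 \<longleftrightarrow> edges (comp_of x) (comp_of y) = 0 \<and>
      (\<forall>f\<in>S. anc x f \<longrightarrow> (\<forall>j<J. \<forall>c\<in>?A f j. \<not> (\<exists>p\<in>subtree c. \<exists>q\<in>comp_of y. adj p q)))" .
  have "0 < link pr J x y \<longleftrightarrow> \<not> (link pr J x y = 0)"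
    using link_bounds(1)[OF assms] by linarith
  also have "\<dots> \<longleftrightarrow> \<not> (\<forall>p\<in>comp_of x. \<forall>q\<in>comp_of y. \<not> adj p q) \<or>
      \<not> (\<forall>f\<in>S. anc x f \<longrightarrow> (\<forall>j<J. \<forall>c\<in>?A f j. \<not> (\<exists>p\<in>subtree c. \<exists>q\<in>comp_of y. adj p q)))"
    unfolding * edges_eq_0_iff[OF finite_comp_of finite_comp_of] by (rule de_Morgan_conj)
  finally show ?thesis by (simp add: Bex_def conj_assoc)
qed

section \<open>Reachability among surviving vertices, expressed by links\<close>

definition reach :: "nat \<Rightarrow> nat \<Rightarrow> bool" where
  "reach = (\<lambda>p q. adj p q \<and> p \<notin> S \<and> q \<notin> S)\<^sup>*\<^sup>*"

lemma reach_refl: "reach p p"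
  by (simp add: reach_def)

lemma reach_trans: "reach p q \<Longrightarrow> reach q r \<Longrightarrow> reach p r"
  unfolding reach_def by (rule rtranclp_trans)

lemma reach_adj: "adj p q \<Longrightarrow> p \<notin> S \<Longrightarrow> q \<notin> S \<Longrightarrow> reach p q"
  unfolding reach_def by auto

lemma reach_sym: "reach p q \<Longrightarrow> reach q p"
  unfolding reach_def
proof (induction rule: rtranclp_induct)
  case (step q r)
  then show ?case using adj_sym by (intro converse_rtranclp_into_rtranclp[of _ r q]) auto
qed simp

text \<open>The climb from a surviving vertex to the top of its piece uses tree edges between
  surviving vertices only, so each piece is connected.\<close>

lemma reach_root: "0 < q \<Longrightarrow> q < N \<Longrightarrow> q \<notin> S \<Longrightarrow> reach (root q) q"
proof (induction q rule: less_induct)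
  case (less q)
  show ?case
  proof (cases "par q = 0 \<or> par q \<in> S")
    case True
    then show ?thesis using root_fixed[OF less.prems(1,2)] reach_refl by simp
  next
    case False
    have "reach (root (par q)) (par q)"
      using less.IH[OF par_less[OF less.prems(1,2)]] par_less_N[OF less.prems(1,2)] False by simp
    moreover have "reach (par q) q"
      using reach_adj adj_par[OF less.prems(1,2)] False less.prems(3) by simp
    ultimately show ?thesis using reach_trans root_par[OF less.prems(1,2)] False by metis
  qed
qed

lemma reach_comp:
  assumes "p \<in> comp_of y" "q \<in> comp_of y" shows "reach p q"
proof -
  have "reach (root y) p" "reach (root y) q"
    using reach_root[of p] reach_root[of q] assms by (auto simp: comp_of_def)
  then show ?thesis using reach_sym reach_trans by blast
qed

lemma hangingD:
  assumes "f \<in> S" "c \<in> hanging f"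
  shows "0 < c" "c < N" "par c = f" "anc f c" "c \<notin> S" "root c = c" "subtree c = comp_of c"
proof -
  show c: "0 < c" "c < N" "par c = f" using assms by (auto simp: hanging_def children_def)
  show "anc f c" using anc_par c by blast
  have no: "\<not> anc c g" if "g \<in> S" for g using assms that by (simp add: hanging_def)
  show "c \<notin> S" using no[of c] anc_refl c by blast
  show r: "root c = c" using root_fixed c assms by simp
  show "subtree c = comp_of c"
    using comp_of_iff[OF c(1,2)] no root_props(2) S_pos unfolding subtree_def r
    by (auto) (metis)
qed

text \<open>The reason why an interval of numbers describes a piece: nothing fails strictly between
  \<open>guard x\<close> and \<open>x\<close> on the path to \<open>x\<close>.\<close>

lemma mem_comp_between:
  assumes x: "0 < x" "x < N" and p: "anc p x" "guard x < p" "p < x"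
  shows "p \<in> comp_of x"
proof -
  note r = root_props[OF x]
  have a: "anc (root x) p"
  proof (cases "p = root x")
    case True
    then show ?thesis using anc_refl r by simp
  next
    case False
    have "\<not> anc p (root x)"
    proof
      assume "anc p (root x)"
      then have "anc p (guard x)" using anc_strict False by blast
      then show False using anc_le p(2) by force
    qed
    then show ?thesis using anc_linear[OF p(1) r(2)] by blast
  qed
  have "\<not> anc g p" if "g \<in> S" "root g = root x" for g
  proof
    assume "anc g p"
    then have "anc g x" by (rule anc_trans[OF p(1)])
    moreover have "anc (root x) g" using root_props(2)[of g] S_pos[OF that(1)] that(2) by simp
    ultimately have "g = x" using r(8) that by blast
    then show False using anc_le[OF \<open>anc g p\<close>] p(3) by simp
  qed
  then show ?thesis using comp_of_iff[OF x] a by blast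
qed

text \<open>An indirect link is realised by a walk: from the \<open>j\<close>-th neighbour, which
  lies in the piece of \<open>x\<close>, into the hanging subtree, through this connected subtree,
  and out along the counted edge.\<close>

lemma link_sound:
  assumes "good_pred pr J" "0 < x" "x < N" "0 < y" "y < N" "0 < link pr J x y"
  shows "\<exists>p\<in>comp_of x. \<exists>q\<in>comp_of y. reach p q"
  using assms(6) unfolding link_pos_iff[OF assms(1-5)]
proof (elim disjE bexE exE conjE)
  fix p q assume "p \<in> comp_of x" "q \<in> comp_of y" "adj p q"
  then show ?thesis using reach_adj by (auto simp: comp_of_def)
next
  fix f j c p q
  assume f: "f \<in> S" "anc x f" and "j < J" and c: "c \<in> hanging f" "guard x < low j c" "low j c < x"
    and p: "p \<in> subtree c" and q: "q \<in> comp_of y" "adj p q"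
  note h = hangingD[OF f(1) c(1)]
  let ?l = "low j c"
  have "?l < N" using c(3) assms(3) by simp
  then obtain r where l: "anc ?l c" "?l \<noteq> c" "anc c r" "adj r ?l"
    using low_nbr unfolding nbr_def by blast
  have "anc ?l f" using anc_strict[OF l(1,2)] h(3) by simp
  then have "anc ?l x" using anc_linear_le[OF _ f(2)] c(3) by simp
  from mem_comp_between[OF assms(2,3) this c(2,3)] have lx: "?l \<in> comp_of x" .
  have r: "r \<in> comp_of c" "p \<in> comp_of c" using l(3) p h(7) by (auto simp: subtree_def)
  then have "reach ?l r" using reach_adj adj_sym[OF l(4)] lx by (auto simp: comp_of_def)
  moreover have "reach p q" using reach_adj q r by (auto simp: comp_of_def)
  ultimately have "reach ?l q" using reach_comp[OF r] reach_trans by blast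
  then show ?thesis using lx q by blast
qed

text \<open>On the way down from \<open>p\<close> to \<open>f\<close>, the first failed vertex
  \<open>y\<close> ends the piece of \<open>p\<close>; there is one because \<open>f\<close> has
  failed. So every piece that a hanging subtree touches is named by a failed vertex.\<close>

lemma hanging_nbr_failed:
  assumes "f \<in> S" "c \<in> hanging f" "nbr c p" "p \<notin> S"
  shows "\<exists>y\<in>S. anc y f \<and> anc p y \<and> p < y \<and> root y = root p \<and> (\<exists>q\<in>subtree c. \<exists>r\<in>comp_of y. adj q r)"
proof -
  note h = hangingD[OF assms(1,2)]
  from assms(3) obtain q where q: "anc p c" "p \<noteq> c" "anc c q" "adj q p" by (auto simp: nbr_def)
  have p: "0 < p" "p < N" using adj_range[OF adj_sym[OF q(4)]] by auto
  have pf: "anc p f" using anc_strict[OF q(1,2)] h(3) by simp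
  define y where "y = (LEAST y. y \<in> S \<and> anc p y \<and> anc y f)"
  have "f \<in> S \<and> anc p f \<and> anc f f" using assms(1) pf anc_refl S_pos by blast
  then have y: "y \<in> S" "anc p y" "anc y f"
    unfolding y_def using LeastI[of "\<lambda>y. y \<in> S \<and> anc p y \<and> anc y f" f] by auto
  have yl: "y \<le> z" if "z \<in> S" "anc p z" "anc z f" for z
    unfolding y_def using that by (intro Least_le) simp
  note r = root_props[OF p]
  have "is_root (root p) y" unfolding is_root_def
  proof (intro conjI ballI impI)
    show "anc (root p) y" by (rule anc_trans[OF y(2) r(2)])
    fix z assume z: "z \<in> S" "anc (root p) z" "anc z y"
    show "z = y"
    proof (cases "anc p z")
      case True
      then have "y \<le> z" using yl z anc_trans[OF y(3) z(3)] by blast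
      then show ?thesis using anc_le[OF z(3)] by simp
    next
      case False
      then have "anc z p" using anc_linear[OF y(2) z(3)] by blast
      then have "z = p" using r(8) z by blast
      then show ?thesis using z assms(4) by simp
    qed
  qed (use r in auto)
  then have ry: "root y = root p" by (rule root_eqI)
  then have "p \<in> comp_of y" using p assms(4) by (simp add: comp_of_def)
  moreover have "p \<noteq> y" using y assms(4) by blast
  ultimately show ?thesis using y ry q anc_le[OF y(2)] by (intro bexI[of _ y]) (auto simp: subtree_def)
qed

text \<open>\<open>x\<close> ends the piece of the topmost surviving neighbour \<open>p0\<close>.
  All neighbours above \<open>p0\<close> have failed, so the rank of \<open>p0\<close> is among the
  tabulated ones and the hanging subtree is counted at \<open>x\<close>. Every surviving neighbour,
  \<open>p0\<close> included, then receives a link from \<open>x\<close>.\<close>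

lemma hanging_link:
  assumes "good_pred pr J" "card S \<le> J" "f \<in> S" "c \<in> hanging f"
  shows "\<exists>x\<in>S. \<forall>p. nbr c p \<longrightarrow> p \<notin> S \<longrightarrow> (\<exists>y\<in>S. root y = root p \<and> 0 < link pr J x y)"
proof (cases "\<exists>p. nbr c p \<and> p \<notin> S")
  case False
  then show ?thesis using assms(3) by blast
next
  case True
  note h = hangingD[OF assms(3,4)]
  define p0 where "p0 = (LEAST p. nbr c p \<and> p \<notin> S)"
  from True have p0: "nbr c p0" "p0 \<notin> S"
    unfolding p0_def using LeastI_ex[of "\<lambda>p. nbr c p \<and> p \<notin> S"] by auto
  have p0l: "p \<in> S" if "nbr c p" "p < p0" for p
    using not_less_Least[of p "\<lambda>p. nbr c p \<and> p \<notin> S"] that unfolding p0_def by blast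
  obtain x where x: "x \<in> S" "anc x f" "anc p0 x" "p0 < x" "root x = root p0"
    using hanging_nbr_failed[OF assms(3,4) p0] by blast
  define j where "j = nbr_rank c p0"
  \<comment> \<open>Strictness, witnessed by the failure \<open>x\<close> below \<open>p0\<close>,
    saves one rank: the ranks below \<open>card S\<close> suffice, so \<open>k\<close> levels of
    tables do.\<close>
  have "{p'. p' < p0 \<and> nbr c p'} \<subset> S"
  proof
    show "{p'. p' < p0 \<and> nbr c p'} \<subseteq> S" using p0l by blast
    have "x \<notin> {p'. p' < p0 \<and> nbr c p'}" using x(4) by simp
    then show "{p'. p' < p0 \<and> nbr c p'} \<noteq> S" using x(1) by blast
  qed
  then have "j < card S" unfolding j_def nbr_rank_def by (rule psubset_card_mono[OF finite_S])
  then have j: "j < J" using assms(2) by simp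
  have low: "low j c = p0" unfolding j_def by (rule low_eq[OF p0(1)])
  have p0N: "0 < p0" "p0 < N" using p0(1) adj_range[OF adj_sym] unfolding nbr_def by blast+
  have lx: "guard x < low j c" "low j c < x"
    using root_props(7)[OF p0N] x by (auto simp: low)
  have "\<exists>y\<in>S. root y = root p \<and> 0 < link pr J x y" if p: "nbr c p" "p \<notin> S" for p
  proof -
    obtain y where y: "y \<in> S" "root y = root p" "\<exists>q\<in>subtree c. \<exists>r\<in>comp_of y. adj q r"
      using hanging_nbr_failed[OF assms(3,4) p] by blast
    have "0 < link pr J x y"
      using link_pos_iff[OF assms(1), of x y] S_pos[OF x(1)] S_pos[OF y(1)] assms(3,4) x(2) j lx y(3) by blast
    then show ?thesis using y by blast
  qed
  then show ?thesis using x(1) by blast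
qed

text \<open>\<open>I\<close> consists of the items, that is, the vertices that name pieces. The
  relation is on tops because several items may name the same piece.\<close>

definition linked :: "(nat \<Rightarrow> nat \<Rightarrow> nat \<Rightarrow> nat) \<Rightarrow> nat \<Rightarrow> nat set \<Rightarrow> nat rel" where
  "linked pr J I = {(root x, root y) | x y. x \<in> I \<and> y \<in> I \<and> link pr J x y \<noteq> 0}"

text \<open>Right to left, each link is a walk. Left to right, the walk from \<open>u\<close> may
  pass through pieces without an item. Such a piece, once entered, is a hanging subtree; while the
  walk stays in it, the invariant is carried by all its surviving neighbours at once, which
  \<open>hanging_link\<close> ties together.\<close>

theorem reach_iff_linked:
  assumes pr: "good_pred pr J" "card S \<le> J" and I: "I \<subseteq> {1..<N}" "S \<subseteq> I"
    and u: "u \<in> I" "u \<notin> S" and v: "v \<in> I" "v \<notin> S"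
  shows "reach u v \<longleftrightarrow> (root u, root v) \<in> (linked pr J I \<union> (linked pr J I)\<inverse>)\<^sup>*"
proof
  let ?K = "linked pr J I" and ?E = "(linked pr J I \<union> (linked pr J I)\<inverse>)\<^sup>*"
  have IN: "0 < x" "x < N" if "x \<in> I" for x using that I by force+
  have pos: "0 < link pr J x y" if "x \<in> I" "y \<in> I" "link pr J x y \<noteq> 0" for x y
    using link_bounds(1)[OF pr(1) IN(1)[OF that(1)] IN(2)[OF that(1)] IN(1)[OF that(2)] IN(2)[OF that(2)]]
      that(3) by simp
  have symE: "(b, a) \<in> ?E" if "(a, b) \<in> ?E" for a b
    using rtrancl_converseI[OF that] by (simp add: converse_Un Un_commute)
  show "reach u v" if "(root u, root v) \<in> ?E"
  proof -
    have "\<forall>q. 0 < q \<longrightarrow> q < N \<longrightarrow> q \<notin> S \<longrightarrow> root q = root v \<longrightarrow> reach u q"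
      using that
    proof (induction rule: rtrancl_induct)
      case base
      have "u \<in> comp_of u" using u IN[OF u(1)] by (simp add: comp_of_def)
      from reach_comp[OF this] show ?case by (simp add: comp_of_def)
    next
      case (step d e)
      have link: "\<exists>p\<in>comp_of x. \<exists>q\<in>comp_of y. reach p q" if "x \<in> I" "y \<in> I" "link pr J x y \<noteq> 0" for x y
        by (rule link_sound[OF pr(1) IN(1)[OF that(1)] IN(2)[OF that(1)] IN(1)[OF that(2)] IN(2)[OF that(2)]
          pos[OF that]])
      from step(2) obtain x y where xy: "x \<in> I" "y \<in> I" "root x = d" "root y = e"
        and or: "link pr J x y \<noteq> 0 \<or> link pr J y x \<noteq> 0"
        unfolding linked_def by auto
      have "\<exists>p\<in>comp_of x. \<exists>q\<in>comp_of y. reach p q"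
        using or
      proof
        assume "link pr J x y \<noteq> 0"
        from link[OF xy(1,2) this] show ?thesis .
      next
        assume "link pr J y x \<noteq> 0"
        from link[OF xy(2,1) this] show ?thesis using reach_sym by blast
      qed
      then obtain p q where p: "p \<in> comp_of x" and q: "q \<in> comp_of y" and pq: "reach p q" by blast
      have "reach u p" using step(3) p xy by (auto simp: comp_of_def)
      then have uq: "reach u q" using pq reach_trans by blast
      show ?case
      proof (intro allI impI)
        fix q' assume "0 < q'" "q' < N" "q' \<notin> S" "root q' = e"
        then have "q' \<in> comp_of y" using xy by (simp add: comp_of_def)
        then show "reach u q'" using reach_comp[OF q] reach_trans[OF uq] by blast
      qed
    qed
    then show ?thesis using v(2) IN[OF v(1)] by blast
  qed
  show "(root u, root v) \<in> ?E" if "reach u v"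
  proof -
    define rel where "rel q \<longleftrightarrow> (\<exists>x\<in>I. root x = root q)" for q
    \<comment> \<open>In a piece without an item, all surviving neighbours must be connected to
      \<open>u\<close>, not just the one through which the walk came, because it may leave to any of
      them.\<close>
    define good where "good q \<longleftrightarrow> (if rel q then (root u, root q) \<in> ?E
      else \<forall>p. nbr (root q) p \<longrightarrow> p \<notin> S \<longrightarrow> (root u, root p) \<in> ?E)" for q
    have E1: "(root x, root y) \<in> ?E" if "x \<in> I" "y \<in> I" "0 < link pr J x y" for x y
      using that unfolding linked_def by (intro r_into_rtrancl) force
    \<comment> \<open>A top with a neighbour other than 0 is not a child of the artificial root, so
      its parent has failed. A failure inside the subtree would yield a topmost one with the same
      top, and that would be an item of this piece.\<close>
    have nonrel: "par (root q) \<in> S \<and> root q \<in> hanging (par (root q))"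
      if q: "0 < q" "q < N" "q \<notin> S" "\<not> rel q" and p: "nbr (root q) p" "p \<noteq> 0" for q p
    proof -
      note r = root_props[OF q(1,2)]
      have "par (root q) \<noteq> 0"
      proof
        assume "par (root q) = 0"
        moreover have "anc p (par (root q))" using p(1) anc_strict[of p "root q"] unfolding nbr_def by blast
        ultimately show False using anc_of_0 p(2) by simp
      qed
      then have "par (root q) \<in> S" using r(3) by simp
      moreover have "\<not> anc (root q) g" if "g \<in> S" for g
      proof
        assume "anc (root q) g"
        from failed_below[OF q(1,2) that this, of g] anc_refl S_pos[OF that]
        obtain g' where "g' \<in> S" "root g' = root q" by blast
        then show False using q(4) I(2) unfolding rel_def by blast
      qed
      ultimately show ?thesis using r by (simp add: hanging_def children_def)
    qed
    \<comment> \<open>No failure has this top, so nothing is cut out and the piece is the whole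
      subtree.\<close>
    have nonrel_comp: "r \<in> comp_of q" if q: "0 < q" "q < N" "q \<notin> S" "\<not> rel q" and r: "anc (root q) r" for q r
    proof -
      have "\<not> (g \<in> S \<and> root g = root q)" for g using q(4) I(2) unfolding rel_def by blast
      then show ?thesis using comp_of_iff[OF q(1,2)] r by blast
    qed
    \<comment> \<open>Edges run along ancestor lines and the piece is closed downwards, so an edge
      can leave it only to a proper ancestor of its top.\<close>
    have nbrI: "nbr (root q) r"
      if "0 < q" "q < N" "q \<notin> S" "\<not> rel q" "adj q r" "root r \<noteq> root q" for q r
    proof -
      have a: "\<not> anc (root q) r" using nonrel_comp[OF that(1-4)] that(6) unfolding comp_of_def by blast
      note rq = root_props(2)[OF that(1,2)]
      have "anc r q"
      proof (rule ccontr)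
        assume "\<not> anc r q"
        then have "anc q r" using adj_anc[OF that(5)] by blast
        then have "anc (root q) r" by (rule anc_trans[OF _ rq])
        then show False using a by blast
      qed
      then have "anc r (root q)" using anc_linear[OF rq] a by blast
      moreover have "r \<noteq> root q" using a root_props(4)[OF that(1,2)] anc_refl by blast
      ultimately show ?thesis using rq that(5) unfolding nbr_def by blast
    qed
    have "good q \<and> 0 < q \<and> q < N \<and> q \<notin> S" if "reach u q" for q
      using that unfolding reach_def
    proof (induction rule: rtranclp_induct)
      case base
      then show ?case using u IN[OF u(1)] by (auto simp: good_def rel_def)
    next
      case (step q r)
      then have q: "good q" "0 < q" "q < N" "q \<notin> S" and r: "r \<notin> S" "adj q r" by auto
      have r': "0 < r" "r < N" using adj_range[OF adj_sym[OF r(2)]] by auto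
      have "good r"
      proof (cases "root r = root q")
        case True
        then show ?thesis using q(1) by (simp add: good_def rel_def)
      next
        case neq: False
        show ?thesis
        proof (cases "rel q")
          case rq: True
          then obtain x where x: "x \<in> I" "root x = root q" unfolding rel_def by blast
          have uq: "(root u, root q) \<in> ?E" using q(1) rq by (simp add: good_def)
          show ?thesis
          proof (cases "rel r")
            case rr: True
            then obtain y where y: "y \<in> I" "root y = root r" unfolding rel_def by blast
            have "q \<in> comp_of x" "r \<in> comp_of y" using q r r' x y by (auto simp: comp_of_def)
            then have "0 < link pr J x y"
              using link_pos_iff[OF pr(1) IN(1)[OF x(1)] IN(2)[OF x(1)] IN(1)[OF y(1)] IN(2)[OF y(1)]]
                r(2) by blast
            from E1[OF x(1) y(1) this] have "(root q, root r) \<in> ?E" using x y by simp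
            from rtrancl_trans[OF uq this] show ?thesis using rr by (simp add: good_def)
          next
            case rr: False
            have nq: "nbr (root r) q" using nbrI[OF r' r(1) rr adj_sym[OF r(2)]] neq by simp
            from nonrel[OF r' r(1) rr nq] q(2)
            have h: "par (root r) \<in> S" "root r \<in> hanging (par (root r))" by auto
            from hanging_link[OF pr h] obtain z where z: "z \<in> S"
              "\<And>p. nbr (root r) p \<Longrightarrow> p \<notin> S \<Longrightarrow> \<exists>y\<in>S. root y = root p \<and> 0 < link pr J z y" by blast
            have zp: "(root z, root p) \<in> ?E" if p: "nbr (root r) p" "p \<notin> S" for p
            proof -
              obtain y where "y \<in> S" "root y = root p" "0 < link pr J z y" using z(2)[OF p] by blast
              then show ?thesis using E1[of z y] z(1) I(2) by auto
            qed
            \<comment> \<open>From the piece of \<open>q\<close> back to the hub \<open>z\<close>,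
              and from there on to the piece of \<open>p\<close>.\<close>
            have "(root u, root p) \<in> ?E" if "nbr (root r) p" "p \<notin> S" for p
              using rtrancl_trans[OF uq rtrancl_trans[OF symE[OF zp[OF nq q(4)]] zp[OF that]]] .
            then show ?thesis using rr by (simp add: good_def)
          qed
        next
          case rq: False
          have nr: "nbr (root q) r" by (rule nbrI[OF q(2-4) rq r(2) neq])
          then have ur: "(root u, root r) \<in> ?E" using q(1) rq r(1) by (simp add: good_def)
          \<comment> \<open>Two adjacent pieces cannot both lack an item: each end of the edge would
            lie above the top of the other piece, making \<open>q\<close> and \<open>r\<close>
            ancestors of each other.\<close>
          have "rel r"
          proof (rule ccontr)
            assume rr: "\<not> rel r"
            have "nbr (root r) q" using nbrI[OF r' r(1) rr adj_sym[OF r(2)]] neq by simp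
            then have 1: "anc q (root r)" by (simp add: nbr_def)
            have 2: "anc r (root q)" using nr by (simp add: nbr_def)
            have "q = r"
              by (rule anc_antisym[OF anc_trans[OF root_props(2)[OF r'] 1] anc_trans[OF root_props(2)[OF q(2,3)] 2]])
            then show False using neq by simp
          qed
          then show ?thesis using ur by (simp add: good_def)
        qed
      qed
      then show ?case using r r' by blast
    qed
    from this[OF that] have "good v" by blast
    moreover have "rel v" using v(1) unfolding rel_def by blast
    ultimately show ?thesis by (simp add: good_def)
  qed
qed

end

section \<open>Depth-first search\<close>

abbreviation "anc_in \<equiv> ranked_tree.anc"

lemma anc_extend:
  assumes t: "ranked_tree N par" and t': "ranked_tree N' par'" and le: "N \<le> N'"
    and eq: "\<And>k. 0 < k \<Longrightarrow> k < N \<Longrightarrow> par' k = par k"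
    and "anc_in N par a b"
  shows "anc_in N' par' a b"
proof -
  interpret A: ranked_tree N par by (rule t)
  interpret B: ranked_tree N' par' by (rule t')
  from assms(5) show ?thesis
  proof (induction rule: A.anc.induct)
    case (anc_refl b)
    then show ?case using le B.anc_refl[of b] by simp
  next
    case (anc_up b a)
    then show ?case using le eq[of b] B.anc_up[of b a] by simp
  qed
qed

text \<open>
  The first \<open>i\<close> vertices of \<open>{..<n}\<close> carry the numbers \<open>1, \<dots>, i\<close>, and 0 means unnumbered. Number 0
  in the tree stands for an additional root. In the last conjunct, \<open>i\<close> is the most recent vertex:
  only its ancestors have unnumbered neighbours.
\<close>

definition dfs_numbering ::
  "nat \<Rightarrow> (nat \<Rightarrow> nat \<Rightarrow> bool) \<Rightarrow> nat \<Rightarrow> (nat \<Rightarrow> nat) \<Rightarrow> (nat \<Rightarrow> nat) \<Rightarrow> (nat \<Rightarrow> nat) \<Rightarrow> bool"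
where
  "dfs_numbering n A i ord num par \<longleftrightarrow>
     (\<forall>k. 0 < k \<longrightarrow> k \<le> i \<longrightarrow> ord k < n \<and> num (ord k) = k) \<and>
     (\<forall>x<n. num x \<le> i \<and> (num x \<noteq> 0 \<longrightarrow> ord (num x) = x)) \<and>
     (\<forall>k. 0 < k \<longrightarrow> k \<le> i \<longrightarrow> par k < k) \<and>
     (\<forall>k. 0 < k \<longrightarrow> k \<le> i \<longrightarrow> par k \<noteq> 0 \<longrightarrow> A (ord (par k)) (ord k)) \<and>
     (\<forall>a b. 0 < a \<longrightarrow> a \<le> i \<longrightarrow> 0 < b \<longrightarrow> b \<le> i \<longrightarrow> A (ord a) (ord b) \<longrightarrow>
        anc_in (i + 1) par a b \<or> anc_in (i + 1) par b a) \<and>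
     (\<forall>a x. 0 < a \<longrightarrow> a \<le> i \<longrightarrow> x < n \<longrightarrow> num x = 0 \<longrightarrow> A (ord a) x \<longrightarrow> anc_in (i + 1) par a i)"

lemma dfs_numberingD:
  assumes "dfs_numbering n A i ord num par"
  shows "\<And>k. 0 < k \<Longrightarrow> k \<le> i \<Longrightarrow> ord k < n"
    "\<And>k. 0 < k \<Longrightarrow> k \<le> i \<Longrightarrow> num (ord k) = k"
    "\<And>x. x < n \<Longrightarrow> num x \<le> i"
    "\<And>x. x < n \<Longrightarrow> num x \<noteq> 0 \<Longrightarrow> ord (num x) = x"
    "\<And>k. 0 < k \<Longrightarrow> k \<le> i \<Longrightarrow> par k < k"
    "\<And>k. 0 < k \<Longrightarrow> k \<le> i \<Longrightarrow> par k \<noteq> 0 \<Longrightarrow> A (ord (par k)) (ord k)"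
    "\<And>a b. 0 < a \<Longrightarrow> a \<le> i \<Longrightarrow> 0 < b \<Longrightarrow> b \<le> i \<Longrightarrow> A (ord a) (ord b) \<Longrightarrow>
       anc_in (i + 1) par a b \<or> anc_in (i + 1) par b a"
    "\<And>a x. 0 < a \<Longrightarrow> a \<le> i \<Longrightarrow> x < n \<Longrightarrow> num x = 0 \<Longrightarrow> A (ord a) x \<Longrightarrow> anc_in (i + 1) par a i"
proof -
  note * = assms[unfolded dfs_numbering_def]
  note 1 = *[THEN conjunct1] and 2 = *[THEN conjunct2, THEN conjunct1]
    and 3 = *[THEN conjunct2, THEN conjunct2, THEN conjunct1]
    and 4 = *[THEN conjunct2, THEN conjunct2, THEN conjunct2, THEN conjunct1]
    and 5 = *[THEN conjunct2, THEN conjunct2, THEN conjunct2, THEN conjunct2, THEN conjunct1]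
    and 6 = *[THEN conjunct2, THEN conjunct2, THEN conjunct2, THEN conjunct2, THEN conjunct2]
  show "ord k < n" "num (ord k) = k" if "0 < k" "k \<le> i" for k using 1 that by simp_all
  show "num x \<le> i" if "x < n" for x using 2 that by simp
  show "ord (num x) = x" if "x < n" "num x \<noteq> 0" for x using 2 that by simp
  show "par k < k" if "0 < k" "k \<le> i" for k using 3 that by simp
  show "A (ord (par k)) (ord k)" if "0 < k" "k \<le> i" "par k \<noteq> 0" for k using 4 that by simp
  show "anc_in (i + 1) par a b \<or> anc_in (i + 1) par b a"
    if "0 < a" "a \<le> i" "0 < b" "b \<le> i" "A (ord a) (ord b)" for a b
    using 5 that by simp
  show "anc_in (i + 1) par a i" if "0 < a" "a \<le> i" "x < n" "num x = 0" "A (ord a) x" for a x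
    using 6[rule_format, OF that] .
qed

lemma dfs_numbering_0: "(\<And>x. x < n \<Longrightarrow> num x = 0) \<Longrightarrow> dfs_numbering n A 0 ord num par"
  unfolding dfs_numbering_def by auto

text \<open>By counting: otherwise \<open>num\<close> would map \<open>n\<close> vertices
  injectively to \<open>i\<close> numbers.\<close>

lemma dfs_numbering_unnumbered:
  assumes "dfs_numbering n A i ord num par" "i < n"
  shows "\<exists>x<n. num x = 0"
proof (rule ccontr)
  assume "\<not> (\<exists>x<n. num x = 0)"
  then have nz: "num x \<noteq> 0" if "x < n" for x using that by simp
  note D = dfs_numberingD(4)[OF assms(1) _ nz] dfs_numberingD(3)[OF assms(1)]
  have "inj_on num {..<n}" by (rule inj_on_inverseI[of _ ord]) (rule D(1); simp)
  moreover have "num ` {..<n} \<subseteq> {1..i}"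
  proof (rule image_subsetI)
    fix x assume "x \<in> {..<n}"
    then show "num x \<in> {1..i}" using nz[of x] D(2)[of x] by simp
  qed
  ultimately have "card {..<n} \<le> card {1..i}" by (rule card_inj_on_le) simp
  then show False using assms(2) by simp
qed

lemma dfs_numbering_step:
  assumes D: "dfs_numbering n A i ord num par" and sym: "\<And>x y. A x y \<Longrightarrow> A y x"
    and x: "x < n" "num x = 0" and j: "j \<le> i" "j = 0 \<or> A (ord j) x"
    and last: "\<And>j' x'. j' \<le> i \<Longrightarrow> x' < n \<Longrightarrow> num x' = 0 \<Longrightarrow> A (ord j') x' \<Longrightarrow> 0 < j' \<Longrightarrow> j' \<le> j"
  shows "dfs_numbering n A (Suc i) (ord(Suc i := x)) (num(x := Suc i)) (par(Suc i := j))"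
proof -
  let ?ord = "ord(Suc i := x)" and ?num = "num(x := Suc i)" and ?par = "par(Suc i := j)"
  note d = dfs_numberingD[OF D]
  note d1 = d(1,2) and d2 = d(3,4) and d3 = d(5) and d4 = d(6) and d5 = d(7) and d6 = d(8)
  have t: "ranked_tree (i + 1) par"
    by (rule ranked_tree.intro) (simp, rule d3, simp_all)
  have t': "ranked_tree (Suc i + 1) ?par"
  proof (rule ranked_tree.intro)
    fix k assume "0 < k" "k < Suc i + 1"
    then show "?par k < k" using d3[of k] j(1) by (cases "k = Suc i") simp_all
  qed simp
  have ext: "anc_in (Suc i + 1) ?par a b" if "anc_in (i + 1) par a b" for a b
    by (rule anc_extend[OF t t' _ _ that]) simp_all
  have new: "anc_in (Suc i + 1) ?par (Suc i) (Suc i)"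
    by (rule ranked_tree.anc_refl[OF t']) simp
  \<comment> \<open>With \<open>y = x\<close> this also shows that all numbered neighbours of
    \<open>x\<close> become its ancestors, so the new edges join ancestors with descendants.\<close>
  have up: "anc_in (Suc i + 1) ?par a (Suc i)" if a: "0 < a" "a \<le> i" "y < n" "num y = 0" "A (ord a) y" for a y
  proof -
    have aj: "a \<le> j" by (rule last[OF a(2,3,4,5,1)])
    then have j0: "0 < j" using a(1) by (rule less_le_trans[rotated])
    then have "A (ord j) x" using j(2) by blast
    from ranked_tree.anc_linear_le[OF t d6[OF a] d6[OF j0 j(1) x this] aj] have "anc_in (i + 1) par a j" .
    from ext[OF this] have "anc_in (Suc i + 1) ?par a (?par (Suc i))" by simp
    then show ?thesis by (rule ranked_tree.anc_up[OF t', rotated 2]) simp_all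
  qed
  have ne: "ord k \<noteq> x" if "0 < k" "k \<le> i" for k using d1(2)[OF that] x that by force
  show ?thesis
    unfolding dfs_numbering_def
  proof (intro conjI allI impI)
    fix k assume k: "0 < k" "k \<le> Suc i"
    show "?ord k < n" using k x d1(1)[of k] by (cases "k = Suc i") simp_all
    show "?num (?ord k) = k" using k d1(2)[of k] ne[of k] by (cases "k = Suc i") simp_all
    show "?par k < k" using k d3[of k] j by (cases "k = Suc i") simp_all
    assume p: "?par k \<noteq> 0"
    show "A (?ord (?par k)) (?ord k)"
    proof (cases "k = Suc i")
      case True
      then show ?thesis using p j by auto
    next
      case False
      then have ki: "k \<le> i" using k by simp
      then have "par k \<noteq> Suc i" using d3[of k] k by simp
      then show ?thesis using d4[of k] k p False ki by simp
    qed
  next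
    fix y assume y: "y < n"
    show "?num y \<le> Suc i" using d2[of y] y by auto
    assume "?num y \<noteq> 0"
    then show "?ord (?num y) = y" using d2[of y] y by auto
  next
    fix a b assume ab: "0 < a" "a \<le> Suc i" "0 < b" "b \<le> Suc i" "A (?ord a) (?ord b)"
    consider "a = Suc i" "b = Suc i" | "a = Suc i" "b \<le> i" | "a \<le> i" "b = Suc i" | "a \<le> i" "b \<le> i"
      using ab by linarith
    then show "anc_in (Suc i + 1) ?par a b \<or> anc_in (Suc i + 1) ?par b a"
    proof cases
      case 1
      then show ?thesis using new by simp
    next
      case 2
      then have "A (ord b) x" using ab sym by simp
      from up[OF ab(3) 2(2) x this] show ?thesis using 2 by simp
    next
      case 3
      then have "A (ord a) x" using ab by simp
      from up[OF ab(1) 3(1) x this] show ?thesis using 3 by simp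
    next
      case 4
      then have "A (ord a) (ord b)" using ab by simp
      then show ?thesis using d5[of a b] ab 4 ext[of a b] ext[of b a] by simp blast
    qed
  next
    fix a y assume a: "0 < a" "a \<le> Suc i" "y < n" "?num y = 0" "A (?ord a) y"
    show "anc_in (Suc i + 1) ?par a (Suc i)"
    proof (cases "a = Suc i")
      case True
      then show ?thesis using new by simp
    next
      case False
      then show ?thesis using up[of a y] a by (auto split: if_splits)
    qed
  qed
qed

text \<open>Once \<open>n\<close> numbers are given out, \<open>ord\<close> is injective on a set as
  large as its range, hence onto, and every vertex has a number.\<close>

lemma dfs_numbering_final:
  assumes D: "dfs_numbering n A n ord num par" and sym: "\<And>x y. A x y \<Longrightarrow> A y x"
  shows "dfs_tree (n + 1) par (\<lambda>a b. 0 < a \<and> a \<le> n \<and> 0 < b \<and> b \<le> n \<and> A (ord a) (ord b))"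
    "bij_betw num {..<n} {1..n}" "\<And>x. x < n \<Longrightarrow> ord (num x) = x"
proof -
  note d = dfs_numberingD[OF D]
  note d1 = d(1,2) and d3 = d(5) and d4 = d(6) and d5 = d(7)
  have t: "ranked_tree (n + 1) par"
    by (rule ranked_tree.intro) (simp, rule d3, simp_all)
  show "dfs_tree (n + 1) par (\<lambda>a b. 0 < a \<and> a \<le> n \<and> 0 < b \<and> b \<le> n \<and> A (ord a) (ord b))"
  proof (rule dfs_tree.intro[OF t], unfold_locales)
    fix i assume i: "0 < i" "i < n + 1" "par i \<noteq> 0"
    then show "0 < par i \<and> par i \<le> n \<and> 0 < i \<and> i \<le> n \<and> A (ord (par i)) (ord i)"
      using d3[of i] d4[of i] by auto
  qed (use sym d5 in auto)
  have inj: "inj_on ord {1..n}" by (rule inj_on_inverseI[of _ num]) (use d1 in auto)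
  have sub: "ord ` {1..n} \<subseteq> {..<n}" by (rule image_subsetI) (use d1(1) in simp)
  have img: "ord ` {1..n} = {..<n}"
    by (rule card_subset_eq[OF _ sub]) (use card_image[OF inj] in simp_all)
  have s: "0 < num x \<and> num x \<le> n \<and> ord (num x) = x" if "x < n" for x
  proof -
    have "x \<in> ord ` {1..n}" using img that by simp
    then obtain k where k: "x = ord k" "0 < k" "k \<le> n" by auto
    then show ?thesis using d1(2)[of k] by simp
  qed
  then show "ord (num x) = x" if "x < n" for x using that by blast
  show "bij_betw num {..<n} {1..n}"
    by (rule bij_betw_byWitness[of _ ord]) (use s d1(1,2) in \<open>simp_all add: image_subset_iff Suc_le_eq\<close>)
qed

section \<open>A structured language for the word RAM\<close>

text \<open>Environments grow at the end, so a variable keeps its index when others are bound.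
  \<open>Fold b a e\<close> binds accumulator and counter; its length is the value of a variable and
  thus fixed when the loop starts.\<close>

datatype expr =
    Var nat
  | Num nat
  | Op binop expr expr
  | Ld expr
  | IfEq expr expr expr expr
  | IfLess expr expr expr expr
  | LetE expr expr
  | Fold nat expr expr

primrec ev :: "nat \<Rightarrow> (nat \<Rightarrow> nat) \<Rightarrow> nat list \<Rightarrow> expr \<Rightarrow> nat" where
  "ev w m \<rho> (Var i) = \<rho> ! i"
| "ev w m \<rho> (Num c) = c mod 2 ^ w"
| "ev w m \<rho> (Op f a b) = eval_binop w f (ev w m \<rho> a) (ev w m \<rho> b)"
| "ev w m \<rho> (Ld a) = m (ev w m \<rho> a)"
| "ev w m \<rho> (IfEq a b c d) = (if ev w m \<rho> a = ev w m \<rho> b then ev w m \<rho> c else ev w m \<rho> d)"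
| "ev w m \<rho> (IfLess a b c d) = (if ev w m \<rho> a < ev w m \<rho> b then ev w m \<rho> c else ev w m \<rho> d)"
| "ev w m \<rho> (LetE a e) = ev w m (\<rho> @ [ev w m \<rho> a]) e"
| "ev w m \<rho> (Fold b a e) = foldl (\<lambda>x i. ev w m (\<rho> @ [x, i]) e) (ev w m \<rho> a) [0..<\<rho> ! b]"

text \<open>Besides scoping, this bounds every loop by \<open>X\<close>, so that the running time
  depends on \<open>X\<close> and the program text alone. The quantification over bound values
  confines loop bounds to variables of the outer environment.\<close>

primrec okE :: "nat \<Rightarrow> nat list \<Rightarrow> expr \<Rightarrow> bool" where
  "okE X \<rho> (Var i) \<longleftrightarrow> i < length \<rho>"
| "okE X \<rho> (Num c) \<longleftrightarrow> True"
| "okE X \<rho> (Op f a b) \<longleftrightarrow> okE X \<rho> a \<and> okE X \<rho> b"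
| "okE X \<rho> (Ld a) \<longleftrightarrow> okE X \<rho> a"
| "okE X \<rho> (IfEq a b c d) \<longleftrightarrow> okE X \<rho> a \<and> okE X \<rho> b \<and> okE X \<rho> c \<and> okE X \<rho> d"
| "okE X \<rho> (IfLess a b c d) \<longleftrightarrow> okE X \<rho> a \<and> okE X \<rho> b \<and> okE X \<rho> c \<and> okE X \<rho> d"
| "okE X \<rho> (LetE a e) \<longleftrightarrow> okE X \<rho> a \<and> (\<forall>v. okE X (\<rho> @ [v]) e)"
| "okE X \<rho> (Fold b a e) \<longleftrightarrow>
     b < length \<rho> \<and> \<rho> ! b \<le> X \<and> okE X \<rho> a \<and> (\<forall>x i. okE X (\<rho> @ [x, i]) e)"

text \<open>Variables live in even registers, temporaries in odd ones. In particular, variable 0 is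
  register 0, where a program receives its argument.\<close>

definition var :: "nat \<Rightarrow> nat" where "var i = 2 * i"
definition tmp :: "nat \<Rightarrow> nat" where "tmp i = 2 * i + 1"

lemma var_tmp [simp]: "var i \<noteq> tmp j" "tmp j \<noteq> var i" "var i = var i' \<longleftrightarrow> i = i'"
  "tmp j = tmp j' \<longleftrightarrow> j = j'"
  unfolding var_def tmp_def by presburger+

primrec sizeE :: "expr \<Rightarrow> nat" where
  "sizeE (Var i) = 1"
| "sizeE (Num c) = 1"
| "sizeE (Op f a b) = sizeE a + sizeE b + 1"
| "sizeE (Ld a) = sizeE a + 1"
| "sizeE (IfEq a b c d) = sizeE a + sizeE b + sizeE c + sizeE d + 2"
| "sizeE (IfLess a b c d) = sizeE a + sizeE b + sizeE c + sizeE d + 2"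
| "sizeE (LetE a e) = sizeE a + sizeE e + 1"
| "sizeE (Fold b a e) = sizeE a + sizeE e + 9"

primrec timeE :: "nat \<Rightarrow> expr \<Rightarrow> nat" where
  "timeE X (Var i) = 1"
| "timeE X (Num c) = 1"
| "timeE X (Op f a b) = timeE X a + timeE X b + 1"
| "timeE X (Ld a) = timeE X a + 1"
| "timeE X (IfEq a b c d) = timeE X a + timeE X b + timeE X c + timeE X d + 2"
| "timeE X (IfLess a b c d) = timeE X a + timeE X b + timeE X c + timeE X d + 2"
| "timeE X (LetE a e) = timeE X a + timeE X e + 1"
| "timeE X (Fold b a e) = timeE X a + X * (timeE X e + 5) + 5"

text \<open>\<open>d\<close> variables are in use, the result goes to temporary \<open>t\<close>,
  smaller temporaries are preserved, and \<open>l\<close> is the address of the code, since jumps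
  are absolute. \<open>Bin Or\<close> with two equal operands serves as a move.\<close>

primrec compE :: "nat \<Rightarrow> nat \<Rightarrow> nat \<Rightarrow> expr \<Rightarrow> program" where
  "compE d t l (Var i) = [Bin Or (tmp t) (var i) (var i)]"
| "compE d t l (Num c) = [Const (tmp t) c]"
| "compE d t l (Op f a b) =
     compE d t l a @ compE d (t + 1) (l + sizeE a) b @ [Bin f (tmp t) (tmp t) (tmp (t + 1))]"
| "compE d t l (Ld a) = compE d t l a @ [Load (tmp t) (tmp t)]"
| "compE d t l (IfEq a b c e) =
     (let l1 = l + sizeE a; l2 = l1 + sizeE b; l3 = l2 + 1 + sizeE e in
      compE d t l a @ compE d (t + 1) l1 b @ [JumpEq (tmp t) (tmp (t + 1)) (l3 + 1)]
      @ compE d t (l2 + 1) e @ [Jump (l3 + 1 + sizeE c)] @ compE d t (l3 + 1) c)"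
| "compE d t l (IfLess a b c e) =
     (let l1 = l + sizeE a; l2 = l1 + sizeE b; l3 = l2 + 1 + sizeE e in
      compE d t l a @ compE d (t + 1) l1 b @ [JumpLess (tmp t) (tmp (t + 1)) (l3 + 1)]
      @ compE d t (l2 + 1) e @ [Jump (l3 + 1 + sizeE c)] @ compE d t (l3 + 1) c)"
| "compE d t l (LetE a e) =
     compE d t l a @ [Bin Or (var d) (tmp t) (tmp t)] @ compE (d + 1) t (l + sizeE a + 1) e"
| "compE d t l (Fold b a e) =
     (let l1 = l + sizeE a + 2 in
      compE d t l a
      @ [Bin Or (var d) (tmp t) (tmp t), Const (var (d + 1)) 0,
         JumpLess (var (d + 1)) (var b) (l1 + 2), Jump (l1 + sizeE e + 6)]
      @ compE (d + 2) t (l1 + 2) e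
      @ [Bin Or (var d) (tmp t) (tmp t), Const (tmp t) 1,
         Bin Add (var (d + 1)) (var (d + 1)) (tmp t), Jump l1, Bin Or (tmp t) (var d) (var d)])"

datatype com =
    St expr expr
  | LetC expr com
  | Seq com com
  | For nat com

primrec cv :: "nat \<Rightarrow> nat list \<Rightarrow> com \<Rightarrow> (nat \<Rightarrow> nat) \<Rightarrow> (nat \<Rightarrow> nat)" where
  "cv w \<rho> (St a e) m = m(ev w m \<rho> a := ev w m \<rho> e)"
| "cv w \<rho> (LetC a c) m = cv w (\<rho> @ [ev w m \<rho> a]) c m"
| "cv w \<rho> (Seq c c') m = cv w \<rho> c' (cv w \<rho> c m)"
| "cv w \<rho> (For b c) m = foldl (\<lambda>m i. cv w (\<rho> @ [i]) c m) m [0..<\<rho> ! b]"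

text \<open>\<open>LetC\<close> evaluates its expression, so a number read from memory may become a
  loop bound. Behind a \<open>Seq\<close> the memory is arbitrary, so such numbers have to be bound
  before.\<close>

primrec okC :: "nat \<Rightarrow> nat \<Rightarrow> nat list \<Rightarrow> com \<Rightarrow> (nat \<Rightarrow> nat) \<Rightarrow> bool" where
  "okC X w \<rho> (St a e) m \<longleftrightarrow> okE X \<rho> a \<and> okE X \<rho> e"
| "okC X w \<rho> (LetC a c) m \<longleftrightarrow> okE X \<rho> a \<and> okC X w (\<rho> @ [ev w m \<rho> a]) c m"
| "okC X w \<rho> (Seq c c') m \<longleftrightarrow> okC X w \<rho> c m \<and> (\<forall>m. okC X w \<rho> c' m)"
| "okC X w \<rho> (For b c) m \<longleftrightarrow> b < length \<rho> \<and> \<rho> ! b \<le> X \<and> (\<forall>i m. okC X w (\<rho> @ [i]) c m)"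

primrec sizeC :: "com \<Rightarrow> nat" where
  "sizeC (St a e) = sizeE a + sizeE e + 1"
| "sizeC (LetC a c) = sizeE a + sizeC c + 1"
| "sizeC (Seq c c') = sizeC c + sizeC c'"
| "sizeC (For b c) = sizeC c + 6"

primrec timeC :: "nat \<Rightarrow> com \<Rightarrow> nat" where
  "timeC X (St a e) = timeE X a + timeE X e + 1"
| "timeC X (LetC a c) = timeE X a + timeC X c + 1"
| "timeC X (Seq c c') = timeC X c + timeC X c'"
| "timeC X (For b c) = X * (timeC X c + 4) + 3"

primrec compC :: "nat \<Rightarrow> nat \<Rightarrow> com \<Rightarrow> program" where
  "compC d l (St a e) = compE d 0 l a @ compE d 1 (l + sizeE a) e @ [Store (tmp 0) (tmp 1)]"
| "compC d l (LetC a c) =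
     compE d 0 l a @ [Bin Or (var d) (tmp 0) (tmp 0)] @ compC (d + 1) (l + sizeE a + 1) c"
| "compC d l (Seq c c') = compC d l c @ compC d (l + sizeC c) c'"
| "compC d l (For b c) =
     [Const (var d) 0, JumpLess (var d) (var b) (l + 3), Jump (l + sizeC c + 6)]
     @ compC (d + 1) (l + 3) c
     @ [Const (tmp 0) 1, Bin Add (var d) (var d) (tmp 0), Jump (l + 1)]"

section \<open>Correctness and running time of compiled code\<close>

lemma length_compE [simp]: "length (compE d t l e) = sizeE e"
  by (induction e arbitrary: d t l) (auto simp: Let_def)

lemma length_compC [simp]: "length (compC d l c) = sizeC c"
  by (induction c arbitrary: d l) auto

definition code_at :: "program \<Rightarrow> nat \<Rightarrow> program \<Rightarrow> bool" where
  "code_at P l cs \<longleftrightarrow> (\<forall>i<length cs. l + i < length P \<and> P ! (l + i) = cs ! i)"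

lemma code_at_Nil [simp]: "code_at P l []"
  by (simp add: code_at_def)

lemma code_at_Cons [simp]:
  "code_at P l (i # cs) \<longleftrightarrow> l < length P \<and> P ! l = i \<and> code_at P (l + 1) cs"
  unfolding code_at_def length_Cons All_less_Suc2 by simp

lemma code_at_append [simp]: "code_at P l (a @ b) \<longleftrightarrow> code_at P l a \<and> code_at P (l + length a) b"
  by (induction a arbitrary: l) auto

abbreviation "conf l R m \<equiv> \<lparr>pc = l, regs = R, mem = m\<rparr>"

text \<open>In contrast to \<open>halts_within\<close>, the final state need not be halted and
  \<open>t\<close> is an upper bound, so that fragments of code compose by adding their
  times.\<close>

definition runs :: "nat \<Rightarrow> program \<Rightarrow> nat \<Rightarrow> state \<Rightarrow> state \<Rightarrow> bool" where
  "runs w P t s s' \<longleftrightarrow> (\<exists>t'\<le>t. (step w P ^^ t') s = s')"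

lemma runs_refl: "runs w P 0 s s"
  by (simp add: runs_def)

lemma runs_trans: "runs w P t s s' \<Longrightarrow> runs w P t' s' s'' \<Longrightarrow> runs w P (t + t') s s''"
proof -
  assume "runs w P t s s'" "runs w P t' s' s''"
  then obtain a b where "a \<le> t" "(step w P ^^ a) s = s'" "b \<le> t'" "(step w P ^^ b) s' = s''"
    by (auto simp: runs_def)
  then have "(step w P ^^ (b + a)) s = s''" "b + a \<le> t + t'" by (auto simp: funpow_add)
  then show ?thesis unfolding runs_def by blast
qed

lemma runs_mono: "runs w P t s s' \<Longrightarrow> t \<le> t' \<Longrightarrow> runs w P t' s s'"
  unfolding runs_def using le_trans by blast

lemma runs_trans_le:
  "runs w P t s s' \<Longrightarrow> runs w P t' s' s'' \<Longrightarrow> t + t' \<le> T \<Longrightarrow> runs w P T s s''"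
  using runs_trans runs_mono by blast

lemma runs_step: "l < length P \<Longrightarrow> runs w P t (exec_instr w (P ! l) (conf l R m)) s' \<Longrightarrow>
   runs w P (Suc t) (conf l R m) s'"
proof -
  assume l: "l < length P" and r: "runs w P t (exec_instr w (P ! l) (conf l R m)) s'"
  have "(step w P ^^ Suc 0) (conf l R m) = exec_instr w (P ! l) (conf l R m)"
    using l by (simp add: step_def halted_def)
  then have "runs w P (Suc 0) (conf l R m) (exec_instr w (P ! l) (conf l R m))"
    unfolding runs_def by blast
  from runs_trans[OF this r] show ?thesis by simp
qed

lemma runs_step1: "l < length P \<Longrightarrow> exec_instr w (P ! l) (conf l R m) = s' \<Longrightarrow> runs w P (Suc 0) (conf l R m) s'"
  using runs_step[of l P w 0 R m s'] by (simp add: runs_refl)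

text \<open>Moves by \<open>Or\<close> and increments reduce modulo \<open>2 ^ w\<close>, so they
  are exact on words only; hence this invariant.\<close>

definition words :: "nat \<Rightarrow> (nat \<Rightarrow> nat) \<Rightarrow> nat list \<Rightarrow> bool" where
  "words w m \<rho> \<longleftrightarrow> (\<forall>a. m a < 2 ^ w) \<and> (\<forall>i<length \<rho>. \<rho> ! i < 2 ^ w)"

lemma words_snoc: "words w m \<rho> \<Longrightarrow> x < 2 ^ w \<Longrightarrow> words w m (\<rho> @ [x])"
  by (auto simp: words_def nth_append less_Suc_eq)

lemma words_snoc2: "words w m \<rho> \<Longrightarrow> x < 2 ^ w \<Longrightarrow> y < 2 ^ w \<Longrightarrow> words w m (\<rho> @ [x, y])"
  using words_snoc[of w m \<rho> x] words_snoc[of w m "\<rho> @ [x]" y] by simp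

lemma eval_binop_less: "eval_binop w f x y < 2 ^ w"
  by (cases f) (auto simp: nat_less_iff)

lemma foldl_upt_inv:
  assumes "I 0 a" "\<And>i x. i < n \<Longrightarrow> I i x \<Longrightarrow> I (Suc i) (f x i)"
  shows "I n (foldl f a [0..<n])"
  using assms(2)
proof (induction n)
  case 0 then show ?case using assms(1) by simp
next
  case (Suc n)
  have "I n (foldl f a [0..<n])" by (rule Suc.IH) (rule Suc.prems, simp)
  from Suc.prems[OF _ this] show ?case by simp
qed

lemma ev_less: "words w m \<rho> \<Longrightarrow> okE X \<rho> e \<Longrightarrow> ev w m \<rho> e < 2 ^ w"
proof (induction e arbitrary: \<rho>)
  case (Var x)
  then show ?case by (simp add: words_def)
next
  case (Op f a b)
  then show ?case using eval_binop_less by simp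
next
  case (Ld e)
  then show ?case by (auto simp: words_def)
next
  case (LetE a e)
  then show ?case using words_snoc by force
next
  case (Fold b a e)
  have b: "\<rho> ! b < 2 ^ w" using Fold.prems by (auto simp: words_def)
  show ?case
    unfolding ev.simps
  proof (rule foldl_upt_inv[where I = "\<lambda>_ x. x < 2 ^ w"])
    show "ev w m \<rho> a < 2 ^ w" using Fold by simp
  next
    fix i x :: nat assume "i < \<rho> ! b" "x < 2 ^ w"
    with b have "words w m (\<rho> @ [x, i])" using Fold.prems words_snoc2 by simp
    then show "ev w m (\<rho> @ [x, i]) e < 2 ^ w" using Fold by simp
  qed
qed auto

definition agree :: "nat \<Rightarrow> nat \<Rightarrow> (nat \<Rightarrow> nat) \<Rightarrow> (nat \<Rightarrow> nat) \<Rightarrow> bool" where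
  "agree d t R R' \<longleftrightarrow> (\<forall>i<d. R' (var i) = R (var i)) \<and> (\<forall>j<t. R' (tmp j) = R (tmp j))"

lemma agree_refl [simp]: "agree d t R R"
  by (simp add: agree_def)

lemma agree_trans: "agree d t R R' \<Longrightarrow> agree d' t' R' R'' \<Longrightarrow> d \<le> d' \<Longrightarrow> t \<le> t' \<Longrightarrow> agree d t R R''"
  by (simp add: agree_def)

lemma agree_var [simp]: "d \<le> i \<Longrightarrow> agree d t R (R'(var i := x)) = agree d t R R'"
  by (auto simp: agree_def)

lemma agree_tmp [simp]: "t \<le> i \<Longrightarrow> agree d t R (R'(tmp i := x)) = agree d t R R'"
  by (auto simp: agree_def)

definition holds :: "nat list \<Rightarrow> (nat \<Rightarrow> nat) \<Rightarrow> bool" where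
  "holds \<rho> R \<longleftrightarrow> (\<forall>i<length \<rho>. R (var i) = \<rho> ! i)"

lemma holds_nth: "holds \<rho> R \<Longrightarrow> i < length \<rho> \<Longrightarrow> R (var i) = \<rho> ! i"
  by (simp add: holds_def)

lemma holds_agree: "holds \<rho> R \<Longrightarrow> agree d t R R' \<Longrightarrow> length \<rho> \<le> d \<Longrightarrow> holds \<rho> R'"
  by (simp add: agree_def holds_def)

lemma holds_tmp [simp]: "holds \<rho> (R(tmp i := x)) = holds \<rho> R"
  by (simp add: holds_def)

lemma holds_var [simp]: "length \<rho> \<le> i \<Longrightarrow> holds \<rho> (R(var i := x)) = holds \<rho> R"
  by (auto simp: holds_def)

lemma holds_snoc [simp]: "holds (\<rho> @ [x]) R \<longleftrightarrow> holds \<rho> R \<and> R (var (length \<rho>)) = x"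
  by (auto simp: holds_def nth_append less_Suc_eq)

lemma holds_snoc2 [simp]: "holds (\<rho> @ [x, y]) R \<longleftrightarrow>
    holds \<rho> R \<and> R (var (length \<rho>)) = x \<and> R (var (Suc (length \<rho>))) = y"
  using holds_snoc[of "\<rho> @ [x]" y R] by simp

lemma runs_loop:
  assumes body: "\<And>i s. i < n \<Longrightarrow> I i s \<Longrightarrow> \<exists>s'. runs w P t s s' \<and> I (Suc i) s'"
  assumes "I 0 s"
  shows "\<exists>s'. runs w P (n * t) s s' \<and> I n s'"
  using body
proof (induction n)
  case 0 then show ?case using assms(2) runs_refl by fastforce
next
  case (Suc n)
  have "\<exists>s'. runs w P (n * t) s s' \<and> I n s'" by (rule Suc.IH) (rule Suc.prems, simp)
  then obtain s' where s': "runs w P (n * t) s s'" "I n s'" by blast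
  then obtain s'' where "runs w P t s' s''" "I (Suc n) s''" using Suc.prems by blast
  with s' show ?case using runs_trans[of w P "n * t" s s' t s''] by (auto simp: add.commute)
qed

definition computes ::
  "nat \<Rightarrow> program \<Rightarrow> nat \<Rightarrow> nat \<Rightarrow> nat \<Rightarrow> nat \<Rightarrow> nat \<Rightarrow> (nat \<Rightarrow> nat) \<Rightarrow> (nat \<Rightarrow> nat) \<Rightarrow> nat \<Rightarrow> bool"
where
  "computes w P T d t l l' R m v \<longleftrightarrow>
     (\<exists>R'. runs w P T (conf l R m) (conf l' R' m) \<and> agree d t R R' \<and> R' (tmp t) = v)"

lemma compE_if:
  assumes a: "computes w P Ta d t l l1 R m va"
    and b: "\<And>R. holds \<rho> R \<Longrightarrow> computes w P Tb d (t + 1) l1 l2 R m vb"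
    and l2: "l2 < length P"
    and j: "\<And>R. R (tmp t) = va \<Longrightarrow> R (tmp (t + 1)) = vb \<Longrightarrow>
       exec_instr w (P ! l2) (conf l2 R m) = conf (if \<phi> then l3 + 1 else l2 + 1) R m"
    and e: "\<And>R. \<not> \<phi> \<Longrightarrow> holds \<rho> R \<Longrightarrow> computes w P Te d t (l2 + 1) l3 R m v"
    and l3: "l3 < length P" "P ! l3 = Jump l4"
    and c: "\<And>R. \<phi> \<Longrightarrow> holds \<rho> R \<Longrightarrow> computes w P Tc d t (l3 + 1) l4 R m v"
    and R: "holds \<rho> R" "length \<rho> \<le> d"
  shows "computes w P (Ta + Tb + Tc + Te + 2) d t l l4 R m v"
proof -
  obtain R1 where R1: "runs w P Ta (conf l R m) (conf l1 R1 m)" "agree d t R R1" "R1 (tmp t) = va"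
    using a by (auto simp: computes_def)
  have h1: "holds \<rho> R1" using holds_agree R R1 by blast
  obtain R2 where R2: "runs w P Tb (conf l1 R1 m) (conf l2 R2 m)" "agree d (t + 1) R1 R2"
    "R2 (tmp (t + 1)) = vb"
    using b[OF h1] by (auto simp: computes_def)
  have h2: "holds \<rho> R2" using holds_agree R h1 R2 by blast
  have va: "R2 (tmp t) = va" using R1 R2 by (simp add: agree_def)
  have a2: "agree d t R R2" using agree_trans R1 R2 by simp
  have r2: "runs w P (Ta + Tb + 1) (conf l R m) (conf (if \<phi> then l3 + 1 else l2 + 1) R2 m)"
    by (rule runs_trans_le[OF runs_trans[OF R1(1) R2(1)] runs_step1[OF l2 j[OF va R2(3)]]]) simp
  show ?thesis
  proof (cases \<phi>)
    case True
    obtain R3 where R3: "runs w P Tc (conf (l3 + 1) R2 m) (conf l4 R3 m)" "agree d t R2 R3"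
      "R3 (tmp t) = v" using c[OF True h2] by (auto simp: computes_def)
    have "runs w P (Ta + Tb + Tc + Te + 2) (conf l R m) (conf l4 R3 m)"
      using runs_trans[OF r2[unfolded if_P[OF True]] R3(1)] by (rule runs_mono) simp
    then show ?thesis using R3(2,3) a2 agree_trans[of d t R R2 d t R3] unfolding computes_def by blast
  next
    case False
    obtain R3 where R3: "runs w P Te (conf (l2 + 1) R2 m) (conf l3 R3 m)" "agree d t R2 R3"
      "R3 (tmp t) = v" using e[OF False h2] by (auto simp: computes_def)
    have "runs w P (Suc 0) (conf l3 R3 m) (conf l4 R3 m)"
      by (rule runs_step1[OF l3(1)]) (simp add: l3)
    from runs_trans[OF r2[unfolded if_not_P[OF False]] runs_trans[OF R3(1) this]]
    have "runs w P (Ta + Tb + Tc + Te + 2) (conf l R m) (conf l4 R3 m)" by (rule runs_mono) simp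
    then show ?thesis using R3(2,3) a2 agree_trans[of d t R R2 d t R3] unfolding computes_def by blast
  qed
qed

lemma compE_correct:
  assumes "code_at P l (compE d t l e)" "okE X \<rho> e" "words w m \<rho>" "holds \<rho> R" "d = length \<rho>"
  shows "computes w P (timeE X e) d t l (l + sizeE e) R m (ev w m \<rho> e)"
  using assms
proof (induction e arbitrary: d t l \<rho> R)
  case (Var i)
  then have "R (var i) = \<rho> ! i" "\<rho> ! i < 2 ^ w" by (auto simp: holds_def words_def)
  with Var show ?case unfolding computes_def
    by (intro exI[of _ "R(tmp t := \<rho> ! i)"])
       (auto intro!: runs_step1)
next
  case (Num c)
  then show ?case unfolding computes_def
    by (intro exI[of _ "R(tmp t := c mod 2 ^ w)"]) (auto intro!: runs_step1)
next
  case (Op f a b)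
  have c: "code_at P l (compE d t l a)" "code_at P (l + sizeE a) (compE d (t + 1) (l + sizeE a) b)"
    "code_at P (l + sizeE a + sizeE b) [Bin f (tmp t) (tmp t) (tmp (t + 1))]"
    using Op.prems(1) by (auto simp: add.assoc)
  obtain R1 where R1: "runs w P (timeE X a) (conf l R m) (conf (l + sizeE a) R1 m)"
    "agree d t R R1" "R1 (tmp t) = ev w m \<rho> a"
    using Op.IH(1)[OF c(1) _ Op.prems(3-5)] Op.prems(2) unfolding computes_def by auto
  have h1: "holds \<rho> R1" using Op.prems R1 holds_agree by blast
  obtain R2 where R2: "runs w P (timeE X b) (conf (l + sizeE a) R1 m) (conf (l + sizeE a + sizeE b) R2 m)"
    "agree d (t + 1) R1 R2" "R2 (tmp (t + 1)) = ev w m \<rho> b"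
    using Op.IH(2)[OF c(2) _ Op.prems(3) h1] Op.prems(2,5) unfolding computes_def by auto
  have "R2 (tmp t) = ev w m \<rho> a" using R1 R2 by (simp add: agree_def)
  with R2 have "runs w P (Suc 0) (conf (l + sizeE a + sizeE b) R2 m)
      (conf (l + sizeE (Op f a b)) (R2(tmp t := ev w m \<rho> (Op f a b))) m)"
    using c(3) by (auto intro!: runs_step1)
  then have "runs w P (timeE X (Op f a b)) (conf l R m)
      (conf (l + sizeE (Op f a b)) (R2(tmp t := ev w m \<rho> (Op f a b))) m)"
    by (rule runs_trans_le[OF runs_trans[OF R1(1) R2(1)]]) simp
  moreover have "agree d t R (R2(tmp t := x))" for x
    using agree_trans[OF R1(2) R2(2)] by simp
  ultimately show ?case unfolding computes_def
    by (intro exI[of _ "R2(tmp t := ev w m \<rho> (Op f a b))"]) simp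
next
  case (Ld a)
  have c: "code_at P l (compE d t l a)" "code_at P (l + sizeE a) [Load (tmp t) (tmp t)]"
    using Ld.prems(1) by auto
  obtain R1 where R1: "runs w P (timeE X a) (conf l R m) (conf (l + sizeE a) R1 m)"
    "agree d t R R1" "R1 (tmp t) = ev w m \<rho> a"
    using Ld.IH(1)[OF c(1) _ Ld.prems(3-5)] Ld.prems(2) unfolding computes_def by auto
  have "runs w P (Suc 0) (conf (l + sizeE a) R1 m) (conf (l + sizeE (Ld a)) (R1(tmp t := ev w m \<rho> (Ld a))) m)"
    using c(2) R1 by (auto intro!: runs_step1)
  then have "runs w P (timeE X (Ld a)) (conf l R m)
      (conf (l + sizeE (Ld a)) (R1(tmp t := ev w m \<rho> (Ld a))) m)"
    by (rule runs_trans_le[OF R1(1)]) simp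
  with R1 show ?case unfolding computes_def
    by (intro exI[of _ "R1(tmp t := ev w m \<rho> (Ld a))"]) simp
next
  case (IfEq a b c e)
  define l1 l2 l3 where "l1 = l + sizeE a" "l2 = l1 + sizeE b" "l3 = l2 + 1 + sizeE e"
  have c: "code_at P l (compE d t l a)" "code_at P l1 (compE d (t + 1) l1 b)"
    "l2 < length P" "P ! l2 = JumpEq (tmp t) (tmp (t + 1)) (l3 + 1)"
    "code_at P (l2 + 1) (compE d t (l2 + 1) e)" "l3 < length P" "P ! l3 = Jump (l3 + 1 + sizeE c)"
    "code_at P (l3 + 1) (compE d t (l3 + 1) c)"
    using IfEq.prems(1) by (simp_all add: Let_def l1_l2_l3_def add.assoc)
  have l4: "l + sizeE (IfEq a b c e) = l3 + 1 + sizeE c" by (simp add: l1_l2_l3_def)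
  show ?case unfolding l4 timeE.simps
  proof (rule compE_if[where \<phi> = "ev w m \<rho> a = ev w m \<rho> b"])
    show "computes w P (timeE X a) d t l l1 R m (ev w m \<rho> a)"
      using IfEq.IH(1)[OF c(1)] IfEq.prems by (simp add: l1_l2_l3_def)
    show "computes w P (timeE X b) d (t + 1) l1 l2 R m (ev w m \<rho> b)" if "holds \<rho> R" for R
      using IfEq.IH(2)[OF c(2)] IfEq.prems that by (simp add: l1_l2_l3_def)
    show "computes w P (timeE X e) d t (l2 + 1) l3 R m (ev w m \<rho> (IfEq a b c e))"
      if "ev w m \<rho> a \<noteq> ev w m \<rho> b" "holds \<rho> R" for R
      using IfEq.IH(4)[OF c(5)] IfEq.prems that by (simp add: l1_l2_l3_def)
    show "computes w P (timeE X c) d t (l3 + 1) (l3 + 1 + sizeE c) R m (ev w m \<rho> (IfEq a b c e))"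
      if "ev w m \<rho> a = ev w m \<rho> b" "holds \<rho> R" for R
      using IfEq.IH(3)[OF c(8)] IfEq.prems that by simp
  qed (use c IfEq.prems in auto)
next
  case (IfLess a b c e)
  define l1 l2 l3 where "l1 = l + sizeE a" "l2 = l1 + sizeE b" "l3 = l2 + 1 + sizeE e"
  have c: "code_at P l (compE d t l a)" "code_at P l1 (compE d (t + 1) l1 b)"
    "l2 < length P" "P ! l2 = JumpLess (tmp t) (tmp (t + 1)) (l3 + 1)"
    "code_at P (l2 + 1) (compE d t (l2 + 1) e)" "l3 < length P" "P ! l3 = Jump (l3 + 1 + sizeE c)"
    "code_at P (l3 + 1) (compE d t (l3 + 1) c)"
    using IfLess.prems(1) by (simp_all add: Let_def l1_l2_l3_def add.assoc)
  have l4: "l + sizeE (IfLess a b c e) = l3 + 1 + sizeE c" by (simp add: l1_l2_l3_def)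
  show ?case unfolding l4 timeE.simps
  proof (rule compE_if[where \<phi> = "ev w m \<rho> a < ev w m \<rho> b"])
    show "computes w P (timeE X a) d t l l1 R m (ev w m \<rho> a)"
      using IfLess.IH(1)[OF c(1)] IfLess.prems by (simp add: l1_l2_l3_def)
    show "computes w P (timeE X b) d (t + 1) l1 l2 R m (ev w m \<rho> b)" if "holds \<rho> R" for R
      using IfLess.IH(2)[OF c(2)] IfLess.prems that by (simp add: l1_l2_l3_def)
    show "computes w P (timeE X e) d t (l2 + 1) l3 R m (ev w m \<rho> (IfLess a b c e))"
      if "\<not> ev w m \<rho> a < ev w m \<rho> b" "holds \<rho> R" for R
      using IfLess.IH(4)[OF c(5)] IfLess.prems that by (simp add: l1_l2_l3_def)
    show "computes w P (timeE X c) d t (l3 + 1) (l3 + 1 + sizeE c) R m (ev w m \<rho> (IfLess a b c e))"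
      if "ev w m \<rho> a < ev w m \<rho> b" "holds \<rho> R" for R
      using IfLess.IH(3)[OF c(8)] IfLess.prems that by simp
  qed (use c IfLess.prems in auto)
next
  case (LetE a e)
  let ?l = "l + sizeE a" and ?va = "ev w m \<rho> a"
  have c: "code_at P l (compE d t l a)" "?l < length P" "P ! ?l = Bin Or (var d) (tmp t) (tmp t)"
    "code_at P (?l + 1) (compE (d + 1) t (?l + 1) e)"
    using LetE.prems(1) by (simp_all add: add.assoc)
  obtain R1 where R1: "runs w P (timeE X a) (conf l R m) (conf ?l R1 m)"
    "agree d t R R1" "R1 (tmp t) = ?va"
    using LetE.IH(1)[OF c(1) _ LetE.prems(3-5)] LetE.prems(2) unfolding computes_def by auto
  have va: "?va < 2 ^ w" using ev_less[OF LetE.prems(3), of X a] LetE.prems(2) by simp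
  let ?R2 = "R1(var d := ?va)"
  have r2: "runs w P (Suc 0) (conf ?l R1 m) (conf (?l + 1) ?R2 m)"
    by (rule runs_step1[OF c(2)]) (use c(3) R1(3) va in simp)
  have "holds \<rho> R1" using holds_agree[OF LetE.prems(4) R1(2)] LetE.prems(5) by simp
  then have h2: "holds (\<rho> @ [?va]) ?R2" using LetE.prems(5) by simp
  have r3: "computes w P (timeE X e) (d + 1) t (?l + 1) (?l + 1 + sizeE e) ?R2 m (ev w m (\<rho> @ [?va]) e)"
    by (rule LetE.IH(2)[OF c(4) _ words_snoc[OF LetE.prems(3) va] h2]) (use LetE.prems(2,5) in simp_all)
  obtain R3 where R3: "runs w P (timeE X e) (conf (?l + 1) ?R2 m) (conf (?l + 1 + sizeE e) R3 m)"
    "agree (d + 1) t ?R2 R3" "R3 (tmp t) = ev w m \<rho> (LetE a e)"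
    using r3 unfolding computes_def ev.simps by blast
  have "agree d t R ?R2" using R1 by simp
  then have a3: "agree d t R R3" by (rule agree_trans[OF _ R3(2)]) simp_all
  have "runs w P (timeE X (LetE a e)) (conf l R m) (conf (l + sizeE (LetE a e)) R3 m)"
    using runs_trans[OF runs_trans[OF R1(1) r2] R3(1)] by (simp add: add.assoc)
  with R3(3) a3 show ?case unfolding computes_def by blast
next
  case (Fold b a e)
  let ?n = "\<rho> ! b"
  define l0 l1 l2 l3 where "l0 = l + sizeE a" "l1 = l + sizeE a + 2" "l2 = l1 + 2" "l3 = l2 + sizeE e"
  have c: "code_at P l (compE d t l a)" "l0 < length P" "P ! l0 = Bin Or (var d) (tmp t) (tmp t)"
    "l0 + 1 < length P" "P ! (l0 + 1) = Const (var (d + 1)) 0"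
    "l1 < length P" "P ! l1 = JumpLess (var (d + 1)) (var b) l2"
    "l1 + 1 < length P" "P ! (l1 + 1) = Jump (Suc (Suc (Suc (Suc l3))))"
    "code_at P l2 (compE (d + 2) t l2 e)"
    "l3 < length P" "P ! l3 = Bin Or (var d) (tmp t) (tmp t)"
    "l3 + 1 < length P" "P ! (l3 + 1) = Const (tmp t) 1"
    "Suc (Suc l3) < length P" "P ! Suc (Suc l3) = Bin Add (var (d + 1)) (var (d + 1)) (tmp t)"
    "Suc (Suc (Suc l3)) < length P" "P ! Suc (Suc (Suc l3)) = Jump l1"
    "Suc (Suc (Suc (Suc l3))) < length P" "P ! Suc (Suc (Suc (Suc l3))) = Bin Or (tmp t) (var d) (var d)"
    using Fold.prems(1) unfolding compE.simps Let_def
    by (simp_all add: l0_l1_l2_l3_def add.assoc)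
  have bl: "b < length \<rho>" using Fold.prems(2) by simp
  have b: "?n < 2 ^ w" "?n \<le> X" using Fold.prems(2,3) by (auto simp: words_def)
  have ld: "length \<rho> \<le> d" using Fold.prems(5) by simp
  obtain R1 where R1: "runs w P (timeE X a) (conf l R m) (conf l0 R1 m)"
    "agree d t R R1" "R1 (tmp t) = ev w m \<rho> a"
    using Fold.IH(1)[OF c(1) _ Fold.prems(3-5)] Fold.prems(2) unfolding computes_def l0_l1_l2_l3_def(1) by auto
  have va: "ev w m \<rho> a < 2 ^ w" using ev_less[OF Fold.prems(3), of X a] Fold.prems(2) by simp
  let ?f = "\<lambda>x i. ev w m (\<rho> @ [x, i]) e"
  let ?acc = "\<lambda>i. foldl ?f (ev w m \<rho> a) [0..<i]"
  have acc: "i \<le> ?n \<Longrightarrow> ?acc i < 2 ^ w" for i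
  proof (rule foldl_upt_inv[where I = "\<lambda>_ x. x < 2 ^ w"])
    fix x j :: nat assume "i \<le> ?n" "j < i" "x < 2 ^ w"
    then have "words w m (\<rho> @ [x, j])" using words_snoc2[OF Fold.prems(3)] b by simp
    from ev_less[OF this, of X e] show "ev w m (\<rho> @ [x, j]) e < 2 ^ w" using Fold.prems(2) by simp
  qed (use va in simp)
  define R2 where "R2 = R1(var d := ev w m \<rho> a, var (d + 1) := 0)"
  have a1: "runs w P (Suc 0) (conf l0 R1 m) (conf (l0 + 1) (R1(var d := ev w m \<rho> a)) m)"
    by (rule runs_step1[OF c(2)]) (use c(3) R1(3) va in simp)
  have l1: "l1 = Suc (l0 + 1)" by (simp add: l0_l1_l2_l3_def)
  have a2: "runs w P (Suc 0) (conf (l0 + 1) (R1(var d := ev w m \<rho> a)) m) (conf l1 R2 m)"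
    by (rule runs_step1[OF c(4)]) (use c(5) l1 in \<open>simp add: R2_def\<close>)
  have r2: "runs w P (timeE X a + 2) (conf l R m) (conf l1 R2 m)"
    by (rule runs_trans_le[OF R1(1) runs_trans[OF a1 a2]]) simp
  let ?I = "\<lambda>i s. \<exists>R'. s = conf l1 R' m \<and> agree d t R R' \<and> R' (var d) = ?acc i \<and> R' (var (d + 1)) = i"
  have "\<exists>s'. runs w P (?n * (timeE X e + 5)) (conf l1 R2 m) s' \<and> ?I ?n s'"
  proof (rule runs_loop[where I = ?I])
    have "agree d t R R2" "R2 (var d) = ?acc 0" "R2 (var (d + 1)) = 0"
      using R1(2) by (simp_all add: R2_def)
    then show "?I 0 (conf l1 R2 m)" by (intro exI[of _ R2] conjI refl)
  next
    fix i s assume i: "i < ?n" and "?I i s"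
    then obtain R' where R': "s = conf l1 R' m" "agree d t R R'" "R' (var d) = ?acc i" "R' (var (d + 1)) = i"
      by (elim exE conjE) (rule that; assumption)
    have h: "holds \<rho> R'" by (rule holds_agree[OF Fold.prems(4) R'(2) ld])
    have hb: "R' (var b) = ?n" by (rule holds_nth[OF h bl])
    have j: "runs w P (Suc 0) s (conf l2 R' m)"
      unfolding R' by (rule runs_step1[OF c(6)]) (use c(7) hb i R'(4) in simp)
    have h': "holds (\<rho> @ [?acc i, i]) R'" using h R'(3,4) Fold.prems(5) by simp
    have w': "words w m (\<rho> @ [?acc i, i])"
      by (rule words_snoc2[OF Fold.prems(3)]) (use b i acc[of i] in auto)
    have "computes w P (timeE X e) (d + 2) t l2 (l2 + sizeE e) R' m (ev w m (\<rho> @ [?acc i, i]) e)"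
      by (rule Fold.IH(2)[OF c(10) _ w' h']) (use Fold.prems(2,5) in simp_all)
    then have r3: "computes w P (timeE X e) (d + 2) t l2 l3 R' m (?acc (Suc i))"
      by (simp add: l0_l1_l2_l3_def)
    obtain R3 where R3: "runs w P (timeE X e) (conf l2 R' m) (conf l3 R3 m)"
      "agree (d + 2) t R' R3" "R3 (tmp t) = ?acc (Suc i)"
      using r3 unfolding computes_def by auto
    have R3i: "R3 (var (d + 1)) = i" using R3 R' by (simp add: agree_def)
    let ?R4 = "R3(var d := ?acc (Suc i), tmp t := 1, var (d + 1) := Suc i)"
    \<comment> \<open>The counter never exceeds the loop bound, which is itself a word, so the
      increment does not wrap around.\<close>
    have w: "Suc i < 2 ^ w" using i b(1) by linarith
    then have "(1::nat) < 2 ^ w" by linarith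
    note w1 = mod_less[OF w] mod_less[OF this]
    have a: "?acc (Suc i) < 2 ^ w" by (rule acc) (use i in simp)
    have q1: "runs w P (Suc 0) (conf l3 R3 m) (conf (l3 + 1) (R3(var d := ?acc (Suc i))) m)"
      by (rule runs_step1[OF c(11)]) (use c(12) R3(3) a in simp)
    have q2: "runs w P (Suc 0) (conf (l3 + 1) (R3(var d := ?acc (Suc i))) m)
        (conf (Suc (Suc l3)) (R3(var d := ?acc (Suc i), tmp t := 1)) m)"
      by (rule runs_step1[OF c(13)]) (use c(14) w1 in simp)
    have q3: "runs w P (Suc 0) (conf (Suc (Suc l3)) (R3(var d := ?acc (Suc i), tmp t := 1)) m)
        (conf (Suc (Suc (Suc l3))) ?R4 m)"
      by (rule runs_step1[OF c(15)]) (use c(16) w1 R3i in simp)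
    have q4: "runs w P (Suc 0) (conf (Suc (Suc (Suc l3))) ?R4 m) (conf l1 ?R4 m)"
      by (rule runs_step1[OF c(17)]) (simp add: c(18))
    have "runs w P 4 (conf l3 R3 m) (conf l1 ?R4 m)"
      using runs_trans[OF q1 runs_trans[OF q2 runs_trans[OF q3 q4]]] by (simp add: numeral_eq_Suc)
    note runs_trans[OF runs_trans[OF j R3(1)] this]
    then have "runs w P (timeE X e + 5) s (conf l1 ?R4 m)"
      by (rule runs_mono) simp
    moreover have "agree d t R R3" by (rule agree_trans[OF R'(2) R3(2)]) simp_all
    then have "agree d t R ?R4" by simp
    moreover have "?R4 (var d) = ?acc (Suc i)" "?R4 (var (d + 1)) = Suc i" by simp_all
    ultimately show "\<exists>s'. runs w P (timeE X e + 5) s s' \<and> ?I (Suc i) s'"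
      by (intro exI[of _ "conf l1 ?R4 m"] exI[of _ ?R4] conjI refl)
  qed
  then obtain s5 R5 where s5: "runs w P (?n * (timeE X e + 5)) (conf l1 R2 m) s5" "s5 = conf l1 R5 m"
    and R5': "agree d t R R5" "R5 (var d) = ?acc ?n" "R5 (var (d + 1)) = ?n"
    by (elim exE conjE) (rule that; assumption)
  note R5 = s5(1)[unfolded s5(2)] R5'
  have "holds \<rho> R5" by (rule holds_agree[OF Fold.prems(4) R5(2) ld])
  from holds_nth[OF this bl] have "R5 (var b) = ?n" .
  then have q1: "runs w P (Suc 0) (conf l1 R5 m) (conf (l1 + 1) R5 m)"
    by (intro runs_step1[OF c(6)]) (use c(7) R5(4) in simp)
  have q2: "runs w P (Suc 0) (conf (l1 + 1) R5 m) (conf (Suc (Suc (Suc (Suc l3)))) R5 m)"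
    by (rule runs_step1[OF c(8)]) (use c(9) in simp)
  have q3: "runs w P (Suc 0) (conf (Suc (Suc (Suc (Suc l3)))) R5 m) (conf (l3 + 5) (R5(tmp t := ?acc ?n)) m)"
    by (rule runs_step1[OF c(19)]) (use c(20) R5(3) acc[of ?n] in simp)
  have "runs w P 3 (conf l1 R5 m) (conf (l3 + 5) (R5(tmp t := ?acc ?n)) m)"
    using runs_trans[OF q1 runs_trans[OF q2 q3]] by (simp add: numeral_eq_Suc)
  note runs_trans[OF runs_trans[OF r2 R5(1)] this]
  moreover have "?n * (timeE X e + 5) \<le> X * (timeE X e + 5)" using b by simp
  ultimately have "runs w P (timeE X (Fold b a e)) (conf l R m) (conf (l3 + 5) (R5(tmp t := ?acc ?n)) m)"
    by (elim runs_mono) simp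
  moreover have "l3 + 5 = l + sizeE (Fold b a e)" by (simp add: l0_l1_l2_l3_def)
  ultimately show ?case unfolding computes_def
    using R5(2) by (intro exI[of _ "R5(tmp t := ?acc ?n)"]) simp
qed

lemma foldl_cv_words:
  assumes "\<And>i m. i < n \<Longrightarrow> words w m \<rho> \<Longrightarrow> words w (f m i) \<rho>" "words w m \<rho>" "i \<le> n"
  shows "words w (foldl f m [0..<i]) \<rho>"
  by (rule foldl_upt_inv[where I = "\<lambda>_ m. words w m \<rho>"]) (use assms in auto)

lemma words_butlast: "words w m (\<rho> @ [x]) \<Longrightarrow> words w m \<rho>"
  unfolding words_def by (metis length_append_singleton less_Suc_eq nth_append)

lemma cv_words: "words w m \<rho> \<Longrightarrow> okC X w \<rho> c m \<Longrightarrow> words w (cv w \<rho> c m) \<rho>"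
proof (induction c arbitrary: \<rho> m)
  case (St a e)
  then show ?case using ev_less[of w m \<rho> X e] by (auto simp: words_def)
next
  case (LetC a c)
  then show ?case using words_butlast words_snoc ev_less by (metis cv.simps(2) okC.simps(2))
next
  case (Seq c c')
  then show ?case by simp
next
  case (For b c)
  have b: "\<rho> ! b < 2 ^ w" using For.prems by (simp add: words_def)
  have "words w (cv w (\<rho> @ [i]) c m) \<rho>" if "i < \<rho> ! b" "words w m \<rho>" for i m
  proof -
    have "words w m (\<rho> @ [i])" by (rule words_snoc) (use that b in simp_all)
    then have "words w (cv w (\<rho> @ [i]) c m) (\<rho> @ [i])" by (rule For.IH) (use For.prems in simp)
    then show ?thesis by (rule words_butlast)
  qed
  from foldl_cv_words[OF this For.prems(1)] show ?case by simp
qed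

lemma compC_correct:
  assumes "code_at P l (compC d l c)" "okC X w \<rho> c m" "words w m \<rho>" "holds \<rho> R" "d = length \<rho>"
  shows "\<exists>R'. runs w P (timeC X c) (conf l R m) (conf (l + sizeC c) R' (cv w \<rho> c m)) \<and> agree d 0 R R'"
  using assms
proof (induction c arbitrary: d l \<rho> R m)
  case (St a e)
  let ?l1 = "l + sizeE a" and ?l2 = "l + sizeE a + sizeE e"
  have c: "code_at P l (compE d 0 l a)" "code_at P ?l1 (compE d 1 ?l1 e)" "?l2 < length P"
    "P ! ?l2 = Store (tmp 0) (tmp 1)"
    using St.prems(1) by (simp_all add: add.assoc)
  have ld: "length \<rho> \<le> d" using St.prems(5) by simp
  have "computes w P (timeE X a) d 0 l ?l1 R m (ev w m \<rho> a)"
    by (rule compE_correct[OF c(1) _ St.prems(3-5)]) (use St.prems(2) in simp)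
  then obtain R1 where R1: "runs w P (timeE X a) (conf l R m) (conf ?l1 R1 m)"
    "agree d 0 R R1" "R1 (tmp 0) = ev w m \<rho> a" unfolding computes_def by blast
  have h1: "holds \<rho> R1" by (rule holds_agree[OF St.prems(4) R1(2) ld])
  have "computes w P (timeE X e) d 1 ?l1 ?l2 R1 m (ev w m \<rho> e)"
    by (rule compE_correct[OF c(2) _ St.prems(3) h1 St.prems(5)]) (use St.prems(2) in simp)
  then obtain R2 where R2: "runs w P (timeE X e) (conf ?l1 R1 m) (conf ?l2 R2 m)"
    "agree d 1 R1 R2" "R2 (tmp 1) = ev w m \<rho> e" unfolding computes_def by blast
  have R2t: "R2 (tmp 0) = ev w m \<rho> a" using R1(3) R2(2) by (simp add: agree_def)
  have q: "runs w P (Suc 0) (conf ?l2 R2 m) (conf (?l2 + 1) R2 (cv w \<rho> (St a e) m))"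
    by (rule runs_step1[OF c(3)]) (use c(4) R2t R2(3) in simp)
  have "runs w P (timeC X (St a e)) (conf l R m) (conf (l + sizeC (St a e)) R2 (cv w \<rho> (St a e) m))"
    using runs_trans[OF runs_trans[OF R1(1) R2(1)] q] by (simp add: add.assoc)
  moreover have "agree d 0 R R2" by (rule agree_trans[OF R1(2) R2(2)]) simp_all
  ultimately show ?case by blast
next
  case (LetC a c)
  let ?l = "l + sizeE a" and ?va = "ev w m \<rho> a"
  have c: "code_at P l (compE d 0 l a)" "?l < length P" "P ! ?l = Bin Or (var d) (tmp 0) (tmp 0)"
    "code_at P (?l + 1) (compC (d + 1) (?l + 1) c)"
    using LetC.prems(1) by (simp_all add: add.assoc)
  have ld: "length \<rho> \<le> d" using LetC.prems(5) by simp
  have ok: "okE X \<rho> a" "okC X w (\<rho> @ [?va]) c m" using LetC.prems(2) by simp_all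
  have "computes w P (timeE X a) d 0 l ?l R m ?va"
    by (rule compE_correct[OF c(1) ok(1) LetC.prems(3-5)])
  then obtain R1 where R1: "runs w P (timeE X a) (conf l R m) (conf ?l R1 m)"
    "agree d 0 R R1" "R1 (tmp 0) = ?va" unfolding computes_def by blast
  have va: "?va < 2 ^ w" by (rule ev_less[OF LetC.prems(3) ok(1)])
  let ?R2 = "R1(var d := ?va)"
  have r2: "runs w P (Suc 0) (conf ?l R1 m) (conf (?l + 1) ?R2 m)"
    by (rule runs_step1[OF c(2)]) (use c(3) R1(3) va in simp)
  have "holds \<rho> R1" by (rule holds_agree[OF LetC.prems(4) R1(2) ld])
  then have h2: "holds (\<rho> @ [?va]) ?R2" using LetC.prems(5) by simp
  have "d + 1 = length (\<rho> @ [?va])" using LetC.prems(5) by simp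
  from LetC.IH[OF c(4) ok(2) words_snoc[OF LetC.prems(3) va] h2 this]
  obtain R3 where R3: "runs w P (timeC X c) (conf (?l + 1) ?R2 m)
      (conf (?l + 1 + sizeC c) R3 (cv w (\<rho> @ [?va]) c m))" "agree (d + 1) 0 ?R2 R3"
    by blast
  have "agree d 0 R ?R2" using R1(2) by simp
  then have a3: "agree d 0 R R3" by (rule agree_trans[OF _ R3(2)]) simp_all
  have "runs w P (timeC X (LetC a c)) (conf l R m) (conf (l + sizeC (LetC a c)) R3 (cv w \<rho> (LetC a c) m))"
    using runs_trans[OF runs_trans[OF R1(1) r2] R3(1)] by (simp add: add.assoc)
  with a3 show ?case by blast
next
  case (Seq c c')
  let ?l = "l + sizeC c"
  have c: "code_at P l (compC d l c)" "code_at P ?l (compC d ?l c')"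
    using Seq.prems(1) by simp_all
  have ld: "length \<rho> \<le> d" using Seq.prems(5) by simp
  have ok: "okC X w \<rho> c m" "okC X w \<rho> c' (cv w \<rho> c m)" using Seq.prems(2) by simp_all
  obtain R1 where R1: "runs w P (timeC X c) (conf l R m) (conf ?l R1 (cv w \<rho> c m))" "agree d 0 R R1"
    using Seq.IH(1)[OF c(1) ok(1) Seq.prems(3-5)] by blast
  have h1: "holds \<rho> R1" by (rule holds_agree[OF Seq.prems(4) R1(2) ld])
  obtain R2 where R2: "runs w P (timeC X c') (conf ?l R1 (cv w \<rho> c m))
      (conf (?l + sizeC c') R2 (cv w \<rho> c' (cv w \<rho> c m)))" "agree d 0 R1 R2"
    using Seq.IH(2)[OF c(2) ok(2) cv_words[OF Seq.prems(3) ok(1)] h1 Seq.prems(5)] by blast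
  have "runs w P (timeC X (Seq c c')) (conf l R m) (conf (l + sizeC (Seq c c')) R2 (cv w \<rho> (Seq c c') m))"
    using runs_trans[OF R1(1) R2(1)] by (simp add: add.assoc)
  moreover have "agree d 0 R R2" by (rule agree_trans[OF R1(2) R2(2)]) simp_all
  ultimately show ?case by blast
next
  case (For b c)
  let ?n = "\<rho> ! b" and ?l1 = "l + 1" and ?l2 = "l + 3" and ?l3 = "l + 3 + sizeC c"
  have c: "l < length P" "P ! l = Const (var d) 0"
    "?l1 < length P" "P ! ?l1 = JumpLess (var d) (var b) ?l2"
    "?l1 + 1 < length P" "P ! (?l1 + 1) = Jump (?l3 + 3)"
    "code_at P ?l2 (compC (d + 1) ?l2 c)"
    "?l3 < length P" "P ! ?l3 = Const (tmp 0) 1"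
    "?l3 + 1 < length P" "P ! (?l3 + 1) = Bin Add (var d) (var d) (tmp 0)"
    "?l3 + 1 + 1 < length P" "P ! (?l3 + 1 + 1) = Jump ?l1"
    using For.prems(1) by (simp_all add: add.assoc eval_nat_numeral)
  have bl: "b < length \<rho>" using For.prems(2) by simp
  have b: "?n < 2 ^ w" "?n \<le> X" using For.prems(2,3) by (auto simp: words_def)
  have ld: "length \<rho> \<le> d" using For.prems(5) by simp
  let ?f = "\<lambda>m i. cv w (\<rho> @ [i]) c m"
  let ?mem = "\<lambda>i. foldl ?f m [0..<i]"
  have wd: "words w (?mem i) \<rho>" if "i \<le> ?n" for i
  proof (rule foldl_cv_words[OF _ For.prems(3) that])
    fix i m assume "i < ?n" "words w m \<rho>"
    then have "words w m (\<rho> @ [i])" using words_snoc[of w m \<rho> i] b(1) by simp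
    then have "words w (cv w (\<rho> @ [i]) c m) (\<rho> @ [i])"
      by (rule cv_words[of _ _ _ X]) (use For.prems(2) in simp)
    then show "words w (cv w (\<rho> @ [i]) c m) \<rho>" by (rule words_butlast)
  qed
  have q0: "runs w P (Suc 0) (conf l R m) (conf ?l1 (R(var d := 0)) m)"
    by (rule runs_step1[OF c(1)]) (simp add: c(2))
  let ?I = "\<lambda>i s. \<exists>R'. s = conf ?l1 R' (?mem i) \<and> agree d 0 R R' \<and> R' (var d) = i"
  have "\<exists>s'. runs w P (?n * (timeC X c + 4)) (conf ?l1 (R(var d := 0)) m) s' \<and> ?I ?n s'"
  proof (rule runs_loop[where I = ?I])
    show "?I 0 (conf ?l1 (R(var d := 0)) m)"
      by (intro exI[of _ "R(var d := 0)"]) simp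
  next
    fix i s assume i: "i < ?n" and "?I i s"
    then obtain R' where R': "s = conf ?l1 R' (?mem i)" "agree d 0 R R'" "R' (var d) = i"
      by (elim exE conjE) (rule that; assumption)
    have h: "holds \<rho> R'" by (rule holds_agree[OF For.prems(4) R'(2) ld])
    have hb: "R' (var b) = ?n" by (rule holds_nth[OF h bl])
    have j: "runs w P (Suc 0) s (conf ?l2 R' (?mem i))"
      unfolding R'(1) by (rule runs_step1[OF c(3)]) (use c(4) hb i R'(3) in simp)
    have h': "holds (\<rho> @ [i]) R'" using h R'(3) For.prems(5) by simp
    have w': "words w (?mem i) (\<rho> @ [i])"
      by (rule words_snoc[OF wd]) (use b(1) i in simp_all)
    have ok: "okC X w (\<rho> @ [i]) c (?mem i)" using For.prems(2) by simp
    have d1: "d + 1 = length (\<rho> @ [i])" using For.prems(5) by simp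
    obtain R3 where R3: "runs w P (timeC X c) (conf ?l2 R' (?mem i)) (conf ?l3 R3 (?mem (Suc i)))"
      "agree (d + 1) 0 R' R3"
      using For.IH[OF c(7) ok w' h' d1] by auto
    have R3i: "R3 (var d) = i" using R3(2) R'(3) by (simp add: agree_def)
    let ?R4 = "R3(tmp 0 := 1, var d := Suc i)"
    have w: "Suc i < 2 ^ w" using i b(1) by linarith
    then have "(1::nat) < 2 ^ w" by linarith
    note w1 = mod_less[OF w] mod_less[OF this]
    have q1: "runs w P (Suc 0) (conf ?l3 R3 (?mem (Suc i))) (conf (?l3 + 1) (R3(tmp 0 := 1)) (?mem (Suc i)))"
      by (rule runs_step1[OF c(8)]) (use c(9) w1 in simp)
    have q2: "runs w P (Suc 0) (conf (?l3 + 1) (R3(tmp 0 := 1)) (?mem (Suc i)))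
        (conf (?l3 + 1 + 1) ?R4 (?mem (Suc i)))"
      by (rule runs_step1[OF c(10)]) (use c(11) w1 R3i in simp)
    have q3: "runs w P (Suc 0) (conf (?l3 + 1 + 1) ?R4 (?mem (Suc i))) (conf ?l1 ?R4 (?mem (Suc i)))"
      by (rule runs_step1[OF c(12)]) (use c(13) in simp)
    have "runs w P (timeC X c + 4) s (conf ?l1 ?R4 (?mem (Suc i)))"
      by (rule runs_mono[OF runs_trans[OF runs_trans[OF j R3(1)] runs_trans[OF q1 runs_trans[OF q2 q3]]]]) simp
    moreover have "agree d 0 R R3" by (rule agree_trans[OF R'(2) R3(2)]) simp_all
    then have "agree d 0 R ?R4" by simp
    moreover have "?R4 (var d) = Suc i" by simp
    ultimately show "\<exists>s'. runs w P (timeC X c + 4) s s' \<and> ?I (Suc i) s'"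
      by (intro exI[of _ "conf ?l1 ?R4 (?mem (Suc i))"] exI[of _ ?R4] conjI refl)
  qed
  then obtain s5 R5 where s5: "runs w P (?n * (timeC X c + 4)) (conf ?l1 (R(var d := 0)) m) s5"
      "s5 = conf ?l1 R5 (?mem ?n)" and R5: "agree d 0 R R5" "R5 (var d) = ?n"
    by (elim exE conjE) (rule that; assumption)
  have "holds \<rho> R5" by (rule holds_agree[OF For.prems(4) R5(1) ld])
  from holds_nth[OF this bl] have "R5 (var b) = ?n" .
  then have q1: "runs w P (Suc 0) (conf ?l1 R5 (?mem ?n)) (conf (?l1 + 1) R5 (?mem ?n))"
    by (intro runs_step1[OF c(3)]) (use c(4) R5(2) in simp)
  have q2: "runs w P (Suc 0) (conf (?l1 + 1) R5 (?mem ?n)) (conf (?l3 + 3) R5 (?mem ?n))"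
    by (rule runs_step1[OF c(5)]) (use c(6) in simp)
  have "?n * (timeC X c + 4) \<le> X * (timeC X c + 4)" using b(2) by (rule mult_le_mono1)
  then have "runs w P (timeC X (For b c)) (conf l R m) (conf (?l3 + 3) R5 (?mem ?n))"
    using runs_trans[OF runs_trans[OF q0 s5(1)[unfolded s5(2)]] runs_trans[OF q1 q2]]
    by (elim runs_mono) simp
  moreover have "?l3 + 3 = l + sizeC (For b c)" by simp
  ultimately show ?case using R5(1) by (intro exI[of _ R5]) simp
qed

text \<open>Commands return results in memory; the two final instructions move cell \<open>r\<close>
  to register 0, where \<open>constructs\<close> and \<open>answers\<close> expect the
  result.\<close>

definition program_of :: "com \<Rightarrow> nat \<Rightarrow> program" where
  "program_of c r = compC 1 0 c @ [Const 0 r, Load 0 0]"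

lemma program_of_correct:
  assumes "okC X w [x] c m" "words w m [x]" "r < 2 ^ w"
  shows "\<exists>t\<le>timeC X c + 2. \<exists>s. halts_within w (program_of c r) t (conf 0 ((\<lambda>_. 0)(0 := x)) m) s \<and>
    regs s 0 = cv w [x] c m r \<and> mem s = cv w [x] c m"
proof -
  let ?P = "program_of c r" and ?m = "cv w [x] c m" and ?l = "sizeC c"
  have c: "code_at ?P 0 (compC 1 0 c)" "?l < length ?P" "?P ! ?l = Const 0 r" "?l + 1 < length ?P"
    "?P ! (?l + 1) = Load 0 0" "length ?P = ?l + 2"
    by (auto simp: program_of_def nth_append code_at_def)
  have "holds [x] ((\<lambda>_. 0)(0 := x))" by (simp add: holds_def var_def)
  from compC_correct[OF c(1) assms(1,2) this]
  obtain R1 where R1: "runs w ?P (timeC X c) (conf 0 ((\<lambda>_. 0)(0 := x)) m) (conf ?l R1 ?m)"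
    by auto
  have q1: "runs w ?P (Suc 0) (conf ?l R1 ?m) (conf (?l + 1) (R1(0 := r)) ?m)"
    by (rule runs_step1[OF c(2)]) (use c(3) assms(3) in simp)
  have q2: "runs w ?P (Suc 0) (conf (?l + 1) (R1(0 := r)) ?m) (conf (?l + 2) (R1(0 := ?m r)) ?m)"
    by (rule runs_step1[OF c(4)]) (use c(5) in simp)
  have "runs w ?P (timeC X c + 2) (conf 0 ((\<lambda>_. 0)(0 := x)) m) (conf (?l + 2) (R1(0 := ?m r)) ?m)"
    by (rule runs_mono[OF runs_trans[OF R1 runs_trans[OF q1 q2]]]) simp
  then obtain t where "t \<le> timeC X c + 2"
    "(step w ?P ^^ t) (conf 0 ((\<lambda>_. 0)(0 := x)) m) = conf (?l + 2) (R1(0 := ?m r)) ?m"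
    unfolding runs_def by blast
  moreover have "halted ?P (conf (?l + 2) (R1(0 := ?m r)) ?m)" by (simp add: halted_def c(6))
  ultimately show ?thesis unfolding halts_within_def
    by (intro exI[of _ t] exI[of _ "conf (?l + 2) (R1(0 := ?m r)) ?m"] conjI) simp_all
qed

section \<open>Polynomial bounds on running times\<close>

definition poly_bounded :: "(nat \<Rightarrow> nat) \<Rightarrow> bool" where
  "poly_bounded f \<longleftrightarrow> (\<exists>C d. \<forall>X. f X \<le> C * (X + 1) ^ d)"

lemma poly_bounded_const: "poly_bounded (\<lambda>_. c)"
  unfolding poly_bounded_def by (rule exI[of _ c], rule exI[of _ 0]) simp

lemma poly_bounded_id: "poly_bounded (\<lambda>X. X)"
  unfolding poly_bounded_def by (rule exI[of _ 1], rule exI[of _ 1]) simp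

lemma poly_bounded_add:
  assumes "poly_bounded f" "poly_bounded g"
  shows "poly_bounded (\<lambda>X. f X + g X)"
proof -
  obtain C d C' d' where f: "\<And>X. f X \<le> C * (X + 1) ^ d" and g: "\<And>X. g X \<le> C' * (X + 1) ^ d'"
    using assms unfolding poly_bounded_def by blast
  have "f X + g X \<le> (C + C') * (X + 1) ^ (d + d')" for X
  proof -
    have "(X + 1) ^ d \<le> (X + 1) ^ (d + d')" by (rule power_increasing; simp)
    from mult_le_mono2[OF this, of C]
    have *: "C * (X + 1) ^ d \<le> C * (X + 1) ^ (d + d')" .
    have "(X + 1) ^ d' \<le> (X + 1) ^ (d + d')" by (rule power_increasing; simp)
    from mult_le_mono2[OF this, of C'] *
      f[of X] g[of X] show ?thesis unfolding add_mult_distrib by linarith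
  qed
  then show ?thesis unfolding poly_bounded_def by blast
qed

lemma poly_bounded_mult:
  assumes "poly_bounded f" "poly_bounded g"
  shows "poly_bounded (\<lambda>X. f X * g X)"
proof -
  obtain C d C' d' where f: "\<And>X. f X \<le> C * (X + 1) ^ d" and g: "\<And>X. g X \<le> C' * (X + 1) ^ d'"
    using assms unfolding poly_bounded_def by blast
  have "f X * g X \<le> (C * C') * (X + 1) ^ (d + d')" for X
    using mult_le_mono[OF f[of X] g[of X]] by (simp add: power_add ac_simps)
  then show ?thesis unfolding poly_bounded_def by blast
qed

lemmas poly_bounded_intros = poly_bounded_const poly_bounded_id poly_bounded_add poly_bounded_mult

text \<open>For a fixed expression, \<open>timeE\<close> is built from \<open>X\<close> and
  constants by sums and products, one factor \<open>X\<close> per nested loop.\<close>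

lemma poly_bounded_timeE: "poly_bounded (\<lambda>X. timeE X e)"
  by (induction e) (simp_all only: timeE.simps, (intro poly_bounded_intros; assumption)+)

lemma poly_bounded_timeC: "poly_bounded (\<lambda>X. timeC X c)"
  by (induction c) (simp_all only: timeC.simps, (intro poly_bounded_intros poly_bounded_timeE; assumption)+)

section \<open>Tables in memory\<close>

definition tab :: "nat \<Rightarrow> nat \<Rightarrow> nat \<Rightarrow> nat \<Rightarrow> nat" where
  "tab N t i j = (t * N + i) * N + j"

lemma mult_add_inject:
  fixes N :: nat
  assumes "a * N + i = b * N + j" "i < N" "j < N"
  shows "a = b \<and> i = j"
proof -
  have "(a * N + i) div N = a" "(b * N + j) div N = b" using assms(2,3) by simp_all
  then have "a = b" using assms(1) by simp
  then show ?thesis using assms(1) by simp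
qed

lemma tab_inject:
  assumes "i < N" "j < N" "i' < N" "j' < N"
  shows "tab N t i j = tab N t' i' j' \<longleftrightarrow> t = t' \<and> i = i' \<and> j = j'"
proof
  assume "tab N t i j = tab N t' i' j'"
  then have "t * N + i = t' * N + i' \<and> j = j'"
    unfolding tab_def by (rule mult_add_inject) (use assms in simp_all)
  with mult_add_inject[of t N i t' i'] show "t = t' \<and> i = i' \<and> j = j'" using assms by simp
qed simp

lemma tab_less_mult:
  assumes "t \<le> t'" "i < N" "j < N" shows "tab N t i j < (t' + 1) * N * N"
proof -
  have "t * N \<le> t' * N" by (rule mult_le_mono1[OF assms(1)])
  with assms(2) have "t * N + i + 1 \<le> (t' + 1) * N" unfolding add_mult_distrib by linarith
  from mult_le_mono1[OF this, of N] have "(t * N + i) * N + N \<le> (t' + 1) * N * N" by (simp only: add_mult_distrib mult_1)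
  then show ?thesis using assms(3) unfolding tab_def by linarith
qed

definition in_tab :: "nat \<Rightarrow> nat \<Rightarrow> nat \<Rightarrow> bool" where
  "in_tab N t a \<longleftrightarrow> (\<exists>i<N. \<exists>j<N. a = tab N t i j)"

lemma in_tab_tab: "i < N \<Longrightarrow> j < N \<Longrightarrow> in_tab N t' (tab N t i j) \<longleftrightarrow> t = t'"
  unfolding in_tab_def using tab_inject[of i N j] by auto

definition same_but :: "(nat \<Rightarrow> bool) \<Rightarrow> (nat \<Rightarrow> nat) \<Rightarrow> (nat \<Rightarrow> nat) \<Rightarrow> bool" where
  "same_but X m m' \<longleftrightarrow> (\<forall>a. \<not> X a \<longrightarrow> m' a = m a)"

lemma same_but_refl: "same_but X m m"
  by (simp add: same_but_def)

lemma same_but_tab: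
  "same_but (in_tab N t') m m' \<Longrightarrow> t \<noteq> t' \<Longrightarrow> i < N \<Longrightarrow> j < N \<Longrightarrow> m' (tab N t i j) = m (tab N t i j)"
  by (simp add: same_but_def in_tab_tab)

text \<open>The loop body has to add correctly only while the partial sum stays within
  \<open>U\<close>; this is how modular addition is shown to be exact.\<close>

lemma foldl_sum:
  fixes f :: "nat \<Rightarrow> nat"
  assumes "\<And>i x. i < n \<Longrightarrow> x + f i \<le> U \<Longrightarrow> g x i = x + f i" "a + sum f {..<n} \<le> U"
  shows "foldl g a [0..<n] = a + sum f {..<n}"
  using assms
proof (induction n)
  case (Suc n)
  have "foldl g a [0..<n] = a + sum f {..<n}"
    by (rule Suc.IH) (use Suc.prems in auto)
  then show ?case using Suc.prems(1)[of n "a + sum f {..<n}"] Suc.prems(2) by simp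
qed simp

text \<open>A loop that overwrites its result at every hit ends with the largest hit. Searches and
  existence tests in the programs all have this form.\<close>

lemma foldl_last:
  assumes "\<And>i x. i < n \<Longrightarrow> g x i = (if Q i then h i else x)"
  shows "foldl g a [0..<n] = (if \<exists>i<n. Q i then h (Max {i. i < n \<and> Q i}) else a)"
  using assms
proof (induction n)
  case (Suc n)
  have IH: "foldl g a [0..<n] = (if \<exists>i<n. Q i then h (Max {i. i < n \<and> Q i}) else a)"
    by (rule Suc.IH) (use Suc.prems in auto)
  show ?case
  proof (cases "Q n")
    case True
    have "Max {i. i < Suc n \<and> Q i} = n" by (rule Max_eqI) (use True in auto)
    then show ?thesis using IH Suc.prems[of n] True by auto
  next
    case False
    then have 1: "{i. i < Suc n \<and> Q i} = {i. i < n \<and> Q i}" and 2: "(\<exists>i<Suc n. Q i) \<longleftrightarrow> (\<exists>i<n. Q i)"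
      by (auto simp: less_Suc_eq)
    have "foldl g a [0..<Suc n] = foldl g a [0..<n]" using Suc.prems[of n] False by simp
    then show ?thesis unfolding 1 2 IH .
  qed
qed simp

text \<open>Variable 3 holds \<open>N\<close> in the environments of both programs, so construction
  and query share these access expressions.\<close>

definition addr :: "expr \<Rightarrow> expr \<Rightarrow> expr \<Rightarrow> expr" where
  "addr t i j = Op Add (Op Mul (Op Add (Op Mul t (Var 3)) i) (Var 3)) j"

definition rd :: "expr \<Rightarrow> expr \<Rightarrow> expr \<Rightarrow> expr" where
  "rd t i j = Ld (addr t i j)"

lemma ev_addr:
  assumes "tab (\<rho> ! 3) (ev w m \<rho> t) (ev w m \<rho> i) (ev w m \<rho> j) < 2 ^ w"
  shows "ev w m \<rho> (addr t i j) = tab (\<rho> ! 3) (ev w m \<rho> t) (ev w m \<rho> i) (ev w m \<rho> j)"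
proof -
  have "ev w m \<rho> (addr t i j) = tab (\<rho> ! 3) (ev w m \<rho> t) (ev w m \<rho> i) (ev w m \<rho> j) mod 2 ^ w"
    by (simp add: addr_def tab_def mod_simps)
  then show ?thesis using assms by simp
qed

definition fill :: "nat \<Rightarrow> nat \<Rightarrow> nat \<Rightarrow> expr \<Rightarrow> expr \<Rightarrow> com" where
  "fill d b b' t e = For b (For b' (St (addr t (Var d) (Var (d + 1))) e))"

text \<open>Entries are computed while the table is partly filled, so \<open>e\<close> must be right
  in every memory that differs from \<open>m\<close> in table \<open>t\<close> only. The
  specification is a predicate \<open>V\<close> because predecessors are not unique.\<close>

lemma fill_correct:
  assumes d: "length \<rho> = d" "3 < d" "b < d" "b' < d" "\<rho> ! 3 = N" "\<rho> ! b \<le> N" "\<rho> ! b' \<le> N"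
    and big: "(t + 1) * N * N \<le> 2 ^ w"
    and t: "\<And>i j m'. ev w m' (\<rho> @ [i, j]) te = t"
    and e: "\<And>i j m'. i < \<rho> ! b \<Longrightarrow> j < \<rho> ! b' \<Longrightarrow> same_but (in_tab N t) m m' \<Longrightarrow>
      V i j (ev w m' (\<rho> @ [i, j]) e)"
  shows "same_but (in_tab N t) m (cv w \<rho> (fill d b b' te e) m)"
    "\<And>i j. i < \<rho> ! b \<Longrightarrow> j < \<rho> ! b' \<Longrightarrow> V i j (cv w \<rho> (fill d b b' te e) m (tab N t i j))"
proof -
  let ?n = "\<rho> ! b" and ?n' = "\<rho> ! b'"
  define st where "st i m j = cv w (\<rho> @ [i, j]) (St (addr te (Var d) (Var (d + 1))) e) m" for i m j
  let ?I = "\<lambda>i m'. same_but (in_tab N t) m m' \<and> (\<forall>i'<i. \<forall>j<?n'. V i' j (m' (tab N t i' j)))"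
  let ?J = "\<lambda>i j m'. ?I i m' \<and> (\<forall>j'<j. V i j' (m' (tab N t i j')))"
  have st: "?J i (Suc j) (st i m' j)" if i: "i < ?n" and j: "j < ?n'" and J: "?J i j m'" for i j m'
  proof -
    have ij: "i < N" "j < N" using i j d by auto
    have l: "tab N t i j < 2 ^ w" by (rule less_le_trans[OF tab_less_mult[OF le_refl ij] big])
    have a: "ev w m' (\<rho> @ [i, j]) (addr te (Var d) (Var (d + 1))) = tab N t i j"
      using ev_addr[of "\<rho> @ [i, j]" w m' te "Var d" "Var (d + 1)"] d l t by (simp add: nth_append)
    define x where "x = ev w m' (\<rho> @ [i, j]) e"
    have x: "V i j x" unfolding x_def by (rule e[OF i j]) (use J in blast)
    have "st i m' j = m'(tab N t i j := x)" using a by (simp add: st_def x_def)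
    moreover have "?J i (Suc j) (m'(tab N t i j := x))"
    proof (intro conjI allI impI)
      show "same_but (in_tab N t) m (m'(tab N t i j := x))"
        using J ij unfolding same_but_def by (auto simp: in_tab_tab)
      show "V i' j' ((m'(tab N t i j := x)) (tab N t i' j'))" if "i' < i" "j' < ?n'" for i' j'
      proof -
        have "i' < N" "j' < N" using that d i by auto
        then show ?thesis using tab_inject[of i' N j' i j t t] ij that J by simp
      qed
      show "V i j' ((m'(tab N t i j := x)) (tab N t i j'))" if "j' < Suc j" for j'
      proof -
        have "j' < N" using that ij by simp
        then show ?thesis using tab_inject[of i N j' i j t t] ij that J x by (cases "j' = j") auto
      qed
    qed
    ultimately show ?thesis by simp
  qed
  have row: "?I (Suc i) (foldl (st i) m' [0..<?n'])" if i: "i < ?n" and I: "?I i m'" for i m'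
  proof -
    have "?J i ?n' (foldl (st i) m' [0..<?n'])"
      by (rule foldl_upt_inv[where I = "?J i"]) (use I in simp, rule st[OF i])
    then show ?thesis by (auto simp: less_Suc_eq)
  qed
  have "?I ?n (foldl (\<lambda>m i. foldl (st i) m [0..<?n']) m [0..<?n])"
    by (rule foldl_upt_inv[where I = ?I]) (simp add: same_but_refl, rule row)
  moreover have "cv w \<rho> (fill d b b' te e) m = foldl (\<lambda>m i. foldl (st i) m [0..<?n']) m [0..<?n]"
    using d by (simp add: fill_def nth_append st_def[abs_def])
  ultimately show "same_but (in_tab N t) m (cv w \<rho> (fill d b b' te e) m)"
    "\<And>i j. i < \<rho> ! b \<Longrightarrow> j < \<rho> ! b' \<Longrightarrow> V i j (cv w \<rho> (fill d b b' te e) m (tab N t i j))"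
    by auto
qed

section \<open>Computing the tables\<close>

text \<open>In the construction, variables 1 to 4 hold \<open>n\<close>, \<open>k\<close>,
  \<open>N\<close> and \<open>T\<close>. Row and column of the entry being filled follow, preceded
  by the level \<open>j\<close> for the tables of the levels; later variables belong to enclosing
  folds.\<close>

definition "t_adj = Var 4"
definition "t_ord = Op Add (Var 4) (Num 1)"
definition "t_par = Op Add (Var 4) (Num 2)"

definition t_level :: "nat \<Rightarrow> expr \<Rightarrow> expr" where
  "t_level c j = Op Add (Num c) (Op Mul (Num 3) j)"

definition anc_expr :: "expr \<Rightarrow> expr \<Rightarrow> expr" where
  "anc_expr a b = IfEq a b (Num 1) (IfEq (rd (Num 1) a b) (Num 0) (Num 0) (Num 1))"

definition par_expr :: "expr \<Rightarrow> expr" where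
  "par_expr a = rd t_par (Num 0) a"

definition adj_expr :: "expr \<Rightarrow> expr \<Rightarrow> expr" where
  "adj_expr p q = IfEq p (Num 0) (Num 0) (IfEq q (Num 0) (Num 0)
     (rd t_adj (rd t_ord (Num 0) p) (rd t_ord (Num 0) q)))"

text \<open>Climbs from \<open>b\<close> until the parent is \<open>a\<close>. From then on, or once
  0 is reached, the value is stable, so \<open>N\<close> rounds are enough.\<close>

definition child_expr :: expr where
  "child_expr = Fold 3 (Var 6) (IfEq (Var 7) (Num 0) (Num 0)
     (IfEq (par_expr (Var 7)) (Var 5) (Var 7) (par_expr (Var 7))))"

definition edges_expr :: expr where
  "edges_expr = Fold 3 (Num 0) (Fold 3 (Var 7) (Op Add (Var 9)
     (Op Mul (Op Mul (anc_expr (Var 5) (Var 8)) (anc_expr (Var 6) (Var 10))) (adj_expr (Var 8) (Var 10)))))"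

definition nbr_expr :: expr where
  "nbr_expr = IfEq (rd (Num 1) (Var 6) (Var 5)) (Num 0) (Num 0)
     (Fold 3 (Num 0) (IfEq (Op Mul (anc_expr (Var 5) (Var 8)) (adj_expr (Var 8) (Var 6))) (Num 0) (Var 7) (Num 1)))"

definition low_expr :: expr where
  "low_expr = Fold 3 (Var 3) (IfEq (rd (Num 3) (Var 6) (Var 9)) (Num 1)
     (IfEq (Fold 3 (Num 0) (IfLess (Var 11) (Var 9) (Op Add (Var 10) (rd (Num 3) (Var 6) (Var 11))) (Var 10)))
       (Var 5) (Var 9) (Var 8)) (Var 8))"

definition low_at :: "expr \<Rightarrow> expr" where
  "low_at c = rd (t_level 4 (Var 5)) c (Num 0)"

definition pred_expr :: expr where
  "pred_expr = Fold 3 (Num 0) (IfEq (Var 9) (Num 0) (Var 8)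
     (IfEq (par_expr (Var 9)) (Var 6)
       (IfLess (Var 7) (low_at (Var 9)) (Var 8)
         (IfEq (Var 8) (Num 0) (Var 9) (IfLess (low_at (Var 8)) (low_at (Var 9)) (Var 9) (Var 8))))
       (Var 8)))"

definition prefix_expr :: expr where
  "prefix_expr = IfEq (Var 6) (Num 0) (Num 0)
     (Fold 3 (Num 0) (IfEq (Var 9) (Num 0) (Var 8)
       (IfEq (par_expr (Var 9)) (par_expr (Var 6))
         (IfLess (low_at (Var 6)) (low_at (Var 9)) (Var 8) (Op Add (Var 8) (rd (Num 2) (Var 9) (Var 7))))
         (Var 8))))"

definition fill_levels :: "nat \<Rightarrow> expr \<Rightarrow> com" where
  "fill_levels c e = For 2 (fill 6 3 3 (t_level c (Var 5)) e)"

text \<open>During the construction there are \<open>T + 3\<close> tables; \<open>big\<close> makes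
  all their addresses words. Prefix sums add at most \<open>N\<close> counts of at most
  \<open>N * N\<close> each and fit into a word by \<open>big3\<close>.\<close>

locale layout =
  fixes w n k N T :: nat
  assumes N_def: "N = n + 1" and T_def: "T = 4 + 3 * k" and big: "(T + 3) * N * N \<le> 2 ^ w"
    and big3: "N * N * N < 2 ^ w"
begin

lemma T3: "(T + 3) * N \<le> 2 ^ w" "T + 3 \<le> 2 ^ w" "N * N < 2 ^ w" "7 \<le> (2::nat) ^ w"
proof -
  have 1: "1 \<le> N" by (simp add: N_def)
  have "(T + 3) * N * 1 \<le> (T + 3) * N * N" by (rule mult_le_mono2[OF 1])
  from order_trans[OF this big] show a: "(T + 3) * N \<le> 2 ^ w" by (simp only: mult_1_right)
  have "(T + 3) * 1 \<le> (T + 3) * N" by (rule mult_le_mono2[OF 1])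
  from order_trans[OF this a] show b: "T + 3 \<le> 2 ^ w" by (simp only: mult_1_right)
  have "7 \<le> T + 3" by (simp add: T_def)
  from order_trans[OF this b] show "7 \<le> (2::nat) ^ w" .
  have "2 * (N * N) \<le> (T + 3) * (N * N)" by (rule mult_le_mono1) simp
  from order_trans[OF this big[unfolded mult.assoc]] have "2 * (N * N) \<le> 2 ^ w" .
  moreover have "0 < N * N" using 1 by simp
  ultimately show "N * N < 2 ^ w" by linarith
qed

lemma N_less: "N < 2 ^ w"
  by (rule le_less_trans[OF le_square T3(3)])

lemma T4: "4 \<le> T"
  by (simp add: T_def)

lemma w_pos [simp]: "0 < w"
  using T3(4) by (cases w) auto

lemma small_mod [simp]: "c < 7 \<Longrightarrow> c mod 2 ^ w = (c::nat)"
  using T3(4) by simp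

definition env :: "nat list \<Rightarrow> bool" where
  "env \<rho> \<longleftrightarrow> 5 \<le> length \<rho> \<and> \<rho> ! 1 = n \<and> \<rho> ! 2 = k \<and> \<rho> ! 3 = N \<and> \<rho> ! 4 = T"

lemma env_base [simp]: "env (z # n # k # N # T # \<sigma>)"
  by (simp add: env_def)

lemma tab_less:
  assumes "t \<le> Suc (Suc T)" "i < N" "j < N" shows "tab N t i j < 2 ^ w"
proof -
  have "Suc (Suc T) + 1 = T + 3" by simp
  with tab_less_mult[OF assms] big show ?thesis by (metis less_le_trans)
qed

lemma ev_rd_N:
  assumes 3: "\<rho> ! 3 = N" and "ev w m \<rho> t \<le> Suc (Suc T)" "ev w m \<rho> i < N" "ev w m \<rho> j < N"
  shows "ev w m \<rho> (addr t i j) = tab N (ev w m \<rho> t) (ev w m \<rho> i) (ev w m \<rho> j)"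
    "ev w m \<rho> (rd t i j) = m (tab N (ev w m \<rho> t) (ev w m \<rho> i) (ev w m \<rho> j))"
proof -
  have "tab (\<rho> ! 3) (ev w m \<rho> t) (ev w m \<rho> i) (ev w m \<rho> j) < 2 ^ w"
    unfolding 3 by (rule tab_less[OF assms(2-4)])
  from ev_addr[OF this] show "ev w m \<rho> (addr t i j) = tab N (ev w m \<rho> t) (ev w m \<rho> i) (ev w m \<rho> j)"
    by (simp add: 3)
  then show "ev w m \<rho> (rd t i j) = m (tab N (ev w m \<rho> t) (ev w m \<rho> i) (ev w m \<rho> j))"
    by (simp add: rd_def)
qed

lemma ev_rd:
  assumes "env \<rho>" "ev w m \<rho> t \<le> Suc (Suc T)" "ev w m \<rho> i < N" "ev w m \<rho> j < N"
  shows "ev w m \<rho> (rd t i j) = m (tab N (ev w m \<rho> t) (ev w m \<rho> i) (ev w m \<rho> j))"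
  by (rule ev_rd_N(2)[OF _ assms(2-4)]) (use assms(1) in \<open>simp add: env_def\<close>)

lemma ev_tables:
  assumes "env \<rho>"
  shows "ev w m \<rho> t_adj = T" "ev w m \<rho> t_ord = Suc T" "ev w m \<rho> t_par = Suc (Suc T)"
  using assms T3(2) by (simp_all add: t_adj_def t_ord_def t_par_def env_def)

lemma ev_level:
  assumes "ev w m \<rho> j < k" "c < 7"
  shows "ev w m \<rho> (t_level c j) = c + 3 * ev w m \<rho> j"
proof -
  have "c + 3 * ev w m \<rho> j < 2 ^ w" using assms T3(2) by (simp add: T_def)
  then show ?thesis using assms(2) by (simp add: t_level_def)
qed

lemma N_pos: "0 < N"
  by (simp add: N_def)

lemma ev_par_expr:
  assumes "env \<rho>" "ev w m \<rho> a < N"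
  shows "ev w m \<rho> (par_expr a) = m (tab N (Suc (Suc T)) 0 (ev w m \<rho> a))"
  using ev_rd[of \<rho> m t_par "Num 0" a] ev_tables[OF assms(1)] assms N_pos by (simp add: par_expr_def)

definition in_levels :: "nat \<Rightarrow> nat \<Rightarrow> bool" where
  "in_levels c a \<longleftrightarrow> (\<exists>j<k. in_tab N (c + 3 * j) a)"

text \<open>Tables of one kind lie at distance 3, so filling them for all levels leaves the other
  kinds and the tables below 4 alone; for \<open>j < k\<close> they also stay below the work
  tables.\<close>

lemma fill_levels_correct:
  fixes z
  defines "\<rho> \<equiv> [z, n, k, N, T]"
  assumes c: "4 \<le> c" "c < 7"
    and e: "\<And>j i i' m'. j < k \<Longrightarrow> i < N \<Longrightarrow> i' < N \<Longrightarrow> same_but (in_levels c) m m' \<Longrightarrow>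
      V j i i' (ev w m' (\<rho> @ [j, i, i']) e)"
  shows "same_but (in_levels c) m (cv w \<rho> (fill_levels c e) m)"
    "\<And>j i i'. j < k \<Longrightarrow> i < N \<Longrightarrow> i' < N \<Longrightarrow> V j i i' (cv w \<rho> (fill_levels c e) m (tab N (c + 3 * j) i i'))"
proof -
  define st where "st m j = cv w (\<rho> @ [j]) (fill 6 3 3 (t_level c (Var 5)) e) m" for m j
  let ?I = "\<lambda>j m'. same_but (in_levels c) m m' \<and>
    (\<forall>j'<j. \<forall>i<N. \<forall>i'<N. V j' i i' (m' (tab N (c + 3 * j') i i')))"
  have st: "?I (Suc j) (st m' j)" if j: "j < k" and I: "?I j m'" for j m'
  proof -
    have lv: "same_but (in_levels c) m m''" if "same_but (in_tab N (c + 3 * j)) m' m''" for m''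
      using I that j unfolding same_but_def in_levels_def by metis
    have "(c + 3 * j + 1) * N * N \<le> (T + 3) * N * N"
      by (intro mult_le_mono1) (use j c in \<open>simp add: T_def\<close>)
    then have le: "(c + 3 * j + 1) * N * N \<le> 2 ^ w" using big by linarith
    have 1: "same_but (in_tab N (c + 3 * j)) m' (st m' j)"
      unfolding st_def
      by (rule fill_correct(1)[where V = "V j"]) (use le e j lv ev_level c in \<open>simp_all add: \<rho>_def\<close>)
    have 2: "V j i i' (st m' j (tab N (c + 3 * j) i i'))" if "i < N" "i' < N" for i i'
      unfolding st_def
      by (rule fill_correct(2)[where V = "V j"]) (use le e j lv ev_level c that in \<open>simp_all add: \<rho>_def\<close>)
    show ?thesis
    proof (intro conjI allI impI)
      show "same_but (in_levels c) m (st m' j)" by (rule lv[OF 1])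
      fix j' i i' assume "j' < Suc j" "i < N" "i' < N"
      then show "V j' i i' (st m' j (tab N (c + 3 * j') i i'))"
        using 2 I same_but_tab[OF 1, of "c + 3 * j'" i i'] by (cases "j' = j") auto
    qed
  qed
  have "?I k (foldl st m [0..<k])"
    by (rule foldl_upt_inv[where I = ?I]) (simp add: same_but_refl, rule st)
  moreover have "cv w \<rho> (fill_levels c e) m = foldl st m [0..<k]"
    by (simp add: fill_levels_def st_def[abs_def] \<rho>_def)
  ultimately show "same_but (in_levels c) m (cv w \<rho> (fill_levels c e) m)"
    "\<And>j i i'. j < k \<Longrightarrow> i < N \<Longrightarrow> i' < N \<Longrightarrow> V j i i' (cv w \<rho> (fill_levels c e) m (tab N (c + 3 * j) i i'))"
    by auto
qed

end

locale tree_layout = layout + dfs_tree N par adj for par adj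
begin

definition par_mem :: "(nat \<Rightarrow> nat) \<Rightarrow> bool" where
  "par_mem m \<longleftrightarrow> (\<forall>b<N. m (tab N (Suc (Suc T)) 0 b) = par b)"

text \<open>The matrix is indexed by original vertices and reached through \<open>ord\<close>; the
  bound on the stored value of \<open>ord\<close> makes the nested access a legal table
  index.\<close>

definition adj_mem :: "(nat \<Rightarrow> nat) \<Rightarrow> bool" where
  "adj_mem m \<longleftrightarrow> (\<forall>p q. 0 < p \<longrightarrow> p < N \<longrightarrow> 0 < q \<longrightarrow> q < N \<longrightarrow> m (tab N (Suc T) 0 p) < N \<and>
     m (tab N T (m (tab N (Suc T) 0 p)) (m (tab N (Suc T) 0 q))) = (if adj p q then 1 else 0))"

definition child_mem :: "(nat \<Rightarrow> nat) \<Rightarrow> bool" where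
  "child_mem m \<longleftrightarrow> (\<forall>a<N. \<forall>b<N. m (tab N 1 a b) = child a b)"

definition edges_mem :: "(nat \<Rightarrow> nat) \<Rightarrow> bool" where
  "edges_mem m \<longleftrightarrow> (\<forall>a<N. \<forall>b<N. m (tab N 2 a b) = subtree_edges a b)"

definition nbr_mem :: "(nat \<Rightarrow> nat) \<Rightarrow> bool" where
  "nbr_mem m \<longleftrightarrow> (\<forall>c<N. \<forall>p<N. m (tab N 3 c p) = (if nbr c p then 1 else 0))"

definition low_mem :: "(nat \<Rightarrow> nat) \<Rightarrow> bool" where
  "low_mem m \<longleftrightarrow> (\<forall>j<k. \<forall>c<N. \<forall>y<N. m (tab N (4 + 3 * j) c y) = low j c)"

definition pred_mem :: "(nat \<Rightarrow> nat) \<Rightarrow> bool" where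
  "pred_mem m \<longleftrightarrow> (\<forall>j<k. \<forall>f<N. \<forall>x<N. is_pred j f x (m (tab N (5 + 3 * j) f x)))"

definition prefix_mem :: "(nat \<Rightarrow> nat) \<Rightarrow> bool" where
  "prefix_mem m \<longleftrightarrow> (\<forall>j<k. \<forall>c<N. \<forall>y<N. m (tab N (6 + 3 * j) c y) = low_prefix j c y)"

lemma ev_anc_expr_N:
  assumes "\<rho> ! 3 = N" "child_mem m" "ev w m \<rho> a < N" "ev w m \<rho> b < N"
  shows "ev w m \<rho> (anc_expr a b) = (if anc (ev w m \<rho> a) (ev w m \<rho> b) then 1 else 0)"
proof -
  have "ev w m \<rho> (rd (Num 1) a b) = child (ev w m \<rho> a) (ev w m \<rho> b)"
    using ev_rd_N(2)[of \<rho> m "Num 1" a b] assms by (simp add: child_mem_def)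
  then show ?thesis
    using child_pos_iff[of "ev w m \<rho> a" "ev w m \<rho> b"] anc_refl[OF assms(3)] by (auto simp: anc_expr_def)
qed

lemma ev_anc_expr:
  assumes "env \<rho>" "child_mem m" "ev w m \<rho> a < N" "ev w m \<rho> b < N"
  shows "ev w m \<rho> (anc_expr a b) = (if anc (ev w m \<rho> a) (ev w m \<rho> b) then 1 else 0)"
  by (rule ev_anc_expr_N[OF _ assms(2-4)]) (use assms(1) in \<open>simp add: env_def\<close>)

lemma ev_adj_expr:
  assumes "env \<rho>" "adj_mem m" "ev w m \<rho> p < N" "ev w m \<rho> q < N"
  shows "ev w m \<rho> (adj_expr p q) = (if adj (ev w m \<rho> p) (ev w m \<rho> q) then 1 else 0)"
proof (cases "ev w m \<rho> p = 0 \<or> ev w m \<rho> q = 0")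
  case True
  then have "\<not> adj (ev w m \<rho> p) (ev w m \<rho> q)" using adj_range adj_sym by (metis less_irrefl)
  then show ?thesis using True by (auto simp: adj_expr_def)
next
  case False
  note t = ev_tables[OF assms(1)]
  have ord: "ev w m \<rho> (rd t_ord (Num 0) e) = m (tab N (Suc T) 0 (ev w m \<rho> e))"
    if "ev w m \<rho> e < N" for e
    using ev_rd[of \<rho> m t_ord "Num 0" e] assms(1) that t N_pos by simp
  have pq: "0 < ev w m \<rho> p" "0 < ev w m \<rho> q" using False by auto
  note a = assms(2)[unfolded adj_mem_def, rule_format, OF pq(1) assms(3) pq(2) assms(4)]
    assms(2)[unfolded adj_mem_def, rule_format, OF pq(2) assms(4) pq(1) assms(3)]
  have "ev w m \<rho> (rd t_adj (rd t_ord (Num 0) p) (rd t_ord (Num 0) q))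
      = (if adj (ev w m \<rho> p) (ev w m \<rho> q) then 1 else 0)"
    using ev_rd[of \<rho> m t_adj "rd t_ord (Num 0) p" "rd t_ord (Num 0) q"] assms(1) t a
      ord[OF assms(3)] ord[OF assms(4)] by simp
  then show ?thesis using False by (simp add: adj_expr_def)
qed

text \<open>Strong induction on \<open>b\<close>: one round either stays at \<open>b\<close> for
  good or moves to \<open>par b\<close>, which is smaller, so enough rounds remain.\<close>

lemma child_fold:
  assumes "par_mem m" "b < N" "b \<le> i"
  shows "foldl (\<lambda>x i. if x = 0 then 0 else if m (tab N (Suc (Suc T)) 0 x) = a then x else m (tab N (Suc (Suc T)) 0 x)) b [0..<i]
    = child a b"
proof -
  let ?g = "\<lambda>x. if x = 0 then 0 else if m (tab N (Suc (Suc T)) 0 x) = a then x else m (tab N (Suc (Suc T)) 0 x)"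
  have it: "foldl (\<lambda>x i. ?g x) b [0..<i] = (?g ^^ i) b" for b i by (induction i) auto
  have "(?g ^^ i) b = child a b" using assms(2,3)
  proof (induction b arbitrary: i rule: less_induct)
    case (less b)
    show ?case
    proof (cases "b = 0")
      case True
      have "(?g ^^ i) 0 = 0" by (induction i) auto
      then show ?thesis using True child_0 by simp
    next
      case False
      have g: "?g b = (if par b = a then b else par b)" using False less.prems assms(1) by (simp add: par_mem_def)
      show ?thesis
      proof (cases "par b = a")
        case True
        then have "(?g ^^ i) b = b" using g by (induction i) auto
        then show ?thesis using True child_par False less.prems by auto
      next
        case nt: False
        obtain i' where i: "i = Suc i'" using less.prems False by (cases i) auto
        have "par b < b" using par_less False less.prems by simp
        then have "(?g ^^ i') (par b) = child a (par b)" using less.prems i by (intro less.IH) auto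
        moreover have "?g b = par b" using g nt by (simp only: if_False)
        then have "(?g ^^ i) b = (?g ^^ i') (par b)" by (simp only: i funpow_Suc_right o_apply)
        ultimately show ?thesis using nt child_step[of b a] False less.prems by simp
      qed
    qed
  qed
  then show ?thesis using it by simp
qed

lemma foldl_cong_inv:
  assumes "P a" "\<And>i x. P x \<Longrightarrow> g x i = h x i \<and> P (h x i)"
  shows "foldl g a xs = foldl h a xs"
proof -
  have "foldl g a xs = foldl h a xs \<and> P (foldl h a xs)"
    by (induction xs rule: rev_induct) (use assms in auto)
  then show ?thesis ..
qed

lemma ev_child_expr:
  assumes m: "par_mem m" and ab: "a < N" "b < N"
  shows "ev w m [z, n, k, N, T, a, b] child_expr = child a b"
proof -
  let ?h = "\<lambda>x i. if x = 0 then 0 else if m (tab N (Suc (Suc T)) 0 x) = a then x else m (tab N (Suc (Suc T)) 0 x)"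
  let ?e = "IfEq (Var 7) (Num 0) (Num 0) (IfEq (par_expr (Var 7)) (Var 5) (Var 7) (par_expr (Var 7)))"
  have "foldl (\<lambda>x i. ev w m [z, n, k, N, T, a, b, x, i] ?e) b [0..<N] = foldl ?h b [0..<N]"
  proof (rule foldl_cong_inv[where P = "\<lambda>x. x < N"])
    fix i x assume x: "x < N"
    have "ev w m [z, n, k, N, T, a, b, x, i] (par_expr (Var 7)) = m (tab N (Suc (Suc T)) 0 x)"
      by (subst ev_par_expr) (use x in simp_all)
    moreover have "m (tab N (Suc (Suc T)) 0 x) = par x" using m x by (simp add: par_mem_def)
    moreover have "x \<noteq> 0 \<Longrightarrow> par x < N" using par_less_N x by simp
    ultimately show "ev w m [z, n, k, N, T, a, b, x, i] ?e = ?h x i \<and> ?h x i < N"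
      using x N_pos by simp
  qed (rule ab)
  then show ?thesis using child_fold[OF m ab(2), of N a] ab by (simp add: child_expr_def)
qed

lemma subtree_edges_le: "subtree_edges a b \<le> N * N"
proof -
  have "subtree_edges a b \<le> (\<Sum>p<N. \<Sum>q<N. 1)"
    unfolding subtree_edges_def by (intro sum_mono) auto
  then show ?thesis by simp
qed

lemma ev_edges_expr:
  assumes m: "child_mem m" "adj_mem m" and ab: "a < N" "b < N"
  shows "ev w m [z, n, k, N, T, a, b] edges_expr = subtree_edges a b"
proof -
  let ?f = "\<lambda>p q. if anc a p \<and> anc b q \<and> adj p q then 1 else (0::nat)"
  let ?e = "Op Add (Var 9)
     (Op Mul (Op Mul (anc_expr (Var 5) (Var 8)) (anc_expr (Var 6) (Var 10))) (adj_expr (Var 8) (Var 10)))"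
  have inner: "foldl (\<lambda>y q. ev w m [z, n, k, N, T, a, b, x, p, y, q] ?e) x [0..<N] = x + (\<Sum>q<N. ?f p q)"
    if p: "p < N" and x: "x + (\<Sum>q<N. ?f p q) \<le> N * N" for x p
  proof (rule foldl_sum[OF _ x])
    fix q y assume q: "q < N" and y: "y + ?f p q \<le> N * N"
    let ?\<rho> = "[z, n, k, N, T, a, b, x, p, y, q]"
    have "ev w m ?\<rho> (anc_expr (Var 5) (Var 8)) = (if anc a p then 1 else 0)"
      "ev w m ?\<rho> (anc_expr (Var 6) (Var 10)) = (if anc b q then 1 else 0)"
      by (subst ev_anc_expr; use m ab p q in simp)+
    moreover have "ev w m ?\<rho> (adj_expr (Var 8) (Var 10)) = (if adj p q then 1 else 0)"
      by (subst ev_adj_expr) (use m p q in simp_all)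
    ultimately have "ev w m ?\<rho> ?e = (y + ?f p q) mod 2 ^ w" by simp
    then show "ev w m ?\<rho> ?e = y + ?f p q" using y T3(3) by simp
  qed
  have "foldl (\<lambda>x p. ev w m [z, n, k, N, T, a, b, x, p] (Fold 3 (Var 7) ?e)) 0 [0..<N]
      = 0 + (\<Sum>p<N. \<Sum>q<N. ?f p q)"
  proof (rule foldl_sum)
    show "0 + (\<Sum>p<N. \<Sum>q<N. ?f p q) \<le> N * N" using subtree_edges_le[of a b] by (simp add: subtree_edges_def)
    fix p x assume "p < N" "x + (\<Sum>q<N. ?f p q) \<le> N * N"
    from inner[OF this] show "ev w m [z, n, k, N, T, a, b, x, p] (Fold 3 (Var 7) ?e) = x + (\<Sum>q<N. ?f p q)"
      by simp
  qed
  then show ?thesis by (simp add: edges_expr_def subtree_edges_def)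
qed

lemma ev_nbr_expr:
  assumes m: "child_mem m" "adj_mem m" and cp: "c < N" "p < N"
  shows "ev w m [z, n, k, N, T, c, p] nbr_expr = (if nbr c p then 1 else 0)"
proof -
  let ?e = "IfEq (Op Mul (anc_expr (Var 5) (Var 8)) (adj_expr (Var 8) (Var 6))) (Num 0) (Var 7) (Num 1)"
  have "foldl (\<lambda>x q. ev w m [z, n, k, N, T, c, p, x, q] ?e) 0 [0..<N]
      = (if \<exists>q<N. anc c q \<and> adj q p then (\<lambda>_. 1) (Max {q. q < N \<and> anc c q \<and> adj q p}) else 0)"
  proof (rule foldl_last)
    fix q x assume q: "q < N"
    let ?\<rho> = "[z, n, k, N, T, c, p, x, q]"
    have "ev w m ?\<rho> (anc_expr (Var 5) (Var 8)) = (if anc c q then 1 else 0)"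
      by (subst ev_anc_expr) (use m cp q in simp_all)
    moreover have "ev w m ?\<rho> (adj_expr (Var 8) (Var 6)) = (if adj q p then 1 else 0)"
      by (subst ev_adj_expr) (use m cp q in simp_all)
    ultimately show "ev w m ?\<rho> ?e = (if anc c q \<and> adj q p then 1 else x)" by simp
  qed
  moreover have "(\<exists>q<N. anc c q \<and> adj q p) \<longleftrightarrow> (\<exists>q. anc c q \<and> adj q p)" using anc_N by blast
  moreover have "ev w m [z, n, k, N, T, c, p] (rd (Num 1) (Var 6) (Var 5)) = child p c"
    by (subst ev_rd) (use m(1) cp in \<open>simp_all add: child_mem_def\<close>)
  ultimately show ?thesis
    using child_pos_iff[of p c] by (auto simp: nbr_expr_def nbr_def)
qed

lemma ev_low_expr:
  assumes m: "nbr_mem m" and j: "j < k" and c: "c < N"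
  shows "ev w m [z, n, k, N, T, j, c, y] low_expr = low j c"
proof -
  let ?r = "IfLess (Var 11) (Var 9) (Op Add (Var 10) (rd (Num 3) (Var 6) (Var 11))) (Var 10)"
  let ?e = "IfEq (rd (Num 3) (Var 6) (Var 9)) (Num 1)
     (IfEq (Fold 3 (Num 0) ?r) (Var 5) (Var 9) (Var 8)) (Var 8)"
  have rank: "foldl (\<lambda>u q. ev w m [z, n, k, N, T, j, c, y, x, p, u, q] ?r) 0 [0..<N] = nbr_rank c p"
    if p: "p < N" for p x
  proof -
    let ?f = "\<lambda>q. if q < p \<and> nbr c q then 1 else (0::nat)"
    have s: "sum ?f {..<N} = nbr_rank c p"
    proof -
      have "{..<N} \<inter> {q. q < p \<and> nbr c q} = {q. q < p \<and> nbr c q}" using p by auto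
      then show ?thesis by (simp add: nbr_rank_def sum.If_cases)
    qed
    have "nbr_rank c p \<le> N" unfolding nbr_rank_def
      using card_mono[of "{..<N}" "{q. q < p \<and> nbr c q}"] p by fastforce
    then have "0 + sum ?f {..<N} \<le> N" using s by simp
    then have "foldl (\<lambda>u q. ev w m [z, n, k, N, T, j, c, y, x, p, u, q] ?r) 0 [0..<N] = 0 + sum ?f {..<N}"
    proof (rule foldl_sum[rotated])
      fix q u assume q: "q < N" and u: "u + ?f q \<le> N"
      let ?\<rho> = "[z, n, k, N, T, j, c, y, x, p, u, q]"
      have "ev w m ?\<rho> (rd (Num 3) (Var 6) (Var 11)) = (if nbr c q then 1 else 0)"
        by (subst ev_rd) (use m c q T4 in \<open>simp_all add: nbr_mem_def\<close>)
      moreover have "u + ?f q < 2 ^ w" using u N_less by linarith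
      ultimately show "ev w m ?\<rho> ?r = u + ?f q" by (auto split: if_splits)
    qed
    then show ?thesis using s by simp
  qed
  have "foldl (\<lambda>x p. ev w m [z, n, k, N, T, j, c, y, x, p] ?e) N [0..<N]
      = (if \<exists>p<N. nbr c p \<and> nbr_rank c p = j then (\<lambda>p. p) (Max {p. p < N \<and> nbr c p \<and> nbr_rank c p = j}) else N)"
  proof (rule foldl_last)
    fix p x assume p: "p < N"
    let ?\<rho> = "[z, n, k, N, T, j, c, y, x, p]"
    have "ev w m ?\<rho> (rd (Num 3) (Var 6) (Var 9)) = (if nbr c p then 1 else 0)"
      by (subst ev_rd) (use m c p T4 in \<open>simp_all add: nbr_mem_def\<close>)
    then show "ev w m ?\<rho> ?e = (if nbr c p \<and> nbr_rank c p = j then p else x)"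
      using rank[OF p, of x] by simp
  qed
  then show ?thesis by (simp add: low_expr_def low_def)
qed

lemma ev_low_at:
  assumes "env \<rho>" "low_mem m" "\<rho> ! 5 = j" "j < k" "ev w m \<rho> c < N"
  shows "ev w m \<rho> (low_at c) = low j (ev w m \<rho> c)"
proof -
  have "ev w m \<rho> (t_level 4 (Var 5)) = 4 + 3 * j" using ev_level[of m \<rho> "Var 5" 4] assms by simp
  moreover have "4 + 3 * j \<le> Suc (Suc T)" using assms(4) by (simp add: T_def)
  ultimately show ?thesis unfolding low_at_def
    using ev_rd[OF assms(1), of m "t_level 4 (Var 5)" c "Num 0"] assms N_pos by (simp add: low_mem_def)
qed

lemma ev_pred_expr:
  assumes m: "par_mem m" "low_mem m" and j: "j < k" and fx: "f < N" "x < N"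
  shows "is_pred j f x (ev w m [z, n, k, N, T, j, f, x] pred_expr)"
proof -
  let ?e = "IfEq (Var 9) (Num 0) (Var 8)
     (IfEq (par_expr (Var 9)) (Var 6)
       (IfLess (Var 7) (low_at (Var 9)) (Var 8)
         (IfEq (Var 8) (Num 0) (Var 9) (IfLess (low_at (Var 8)) (low_at (Var 9)) (Var 9) (Var 8))))
       (Var 8))"
  define ok where "ok c \<longleftrightarrow> c \<in> children f \<and> low j c \<le> x" for c
  let ?I = "\<lambda>i u. u < N \<and> (if \<forall>c<i. \<not> ok c then u = 0 else ok u \<and> (\<forall>c<i. ok c \<longrightarrow> low j c \<le> low j u))"
  have ok0: "ok c \<Longrightarrow> 0 < c" for c by (simp add: ok_def children_def)
  have A: "?I N (foldl (\<lambda>u c. ev w m [z, n, k, N, T, j, f, x, u, c] ?e) 0 [0..<N])"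
  proof (rule foldl_upt_inv[where I = ?I])
    fix c u assume c: "c < N" and u: "?I c u"
    let ?\<rho> = "[z, n, k, N, T, j, f, x, u, c]"
    have p: "ev w m ?\<rho> (par_expr (Var 9)) = par c"
      by (subst ev_par_expr) (use m c in \<open>simp_all add: par_mem_def\<close>)
    have l: "ev w m ?\<rho> (low_at (Var 9)) = low j c" "ev w m ?\<rho> (low_at (Var 8)) = low j u"
      using ev_low_at[of ?\<rho> m j] m j c u by simp_all
    have okc: "ok c \<longleftrightarrow> c \<noteq> 0 \<and> par c = f \<and> \<not> x < low j c"
      using c by (auto simp: ok_def children_def)
    have e: "ev w m ?\<rho> ?e = (if ok c then if u = 0 then c else if low j u < low j c then c else u else u)"
      using p l okc by simp
    show "?I (Suc c) (ev w m ?\<rho> ?e)"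
    proof (cases "ok c")
      case False
      then have v: "ev w m ?\<rho> ?e = u" using e by simp
      have 1: "(\<forall>c'<Suc c. \<not> ok c') \<longleftrightarrow> (\<forall>c'<c. \<not> ok c')"
        and 2: "(\<forall>c'<Suc c. ok c' \<longrightarrow> low j c' \<le> low j u) \<longleftrightarrow> (\<forall>c'<c. ok c' \<longrightarrow> low j c' \<le> low j u)"
        using False less_Suc_eq by auto
      show ?thesis unfolding v 1 2 by (rule u)
    next
      case True
      show ?thesis
      proof (cases "\<forall>c'<c. \<not> ok c'")
        case nt: True
        then have "u = 0" using u by simp
        then have v: "ev w m ?\<rho> ?e = c" using e True by simp
        have "low j c' \<le> low j c" if "c' < Suc c" "ok c'" for c'
          using nt that by (cases "c' = c") auto
        then show ?thesis unfolding v using True c by auto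
      next
        case nf: False
        then have u': "ok u" "\<And>c'. c' < c \<Longrightarrow> ok c' \<Longrightarrow> low j c' \<le> low j u" using u by auto
        have ex: "\<not> (\<forall>c'<Suc c. \<not> ok c')" using True by blast
        let ?v = "if low j u < low j c then c else u"
        have v: "ev w m ?\<rho> ?e = ?v" using e True ok0[OF u'(1)] by simp
        have "ok ?v" using True u' by simp
        moreover have "low j c' \<le> low j ?v" if "c' < Suc c" "ok c'" for c'
          using u'(2)[of c'] that by (cases "c' = c") auto
        moreover have "?v < N" using c u by simp
        ultimately show ?thesis unfolding v if_not_P[OF ex] by blast
      qed
    qed
  qed (use N_pos in simp)
  define r where "r = ev w m [z, n, k, N, T, j, f, x] pred_expr"
  have r: "r = foldl (\<lambda>u c. ev w m [z, n, k, N, T, j, f, x, u, c] ?e) 0 [0..<N]"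
    by (simp add: r_def pred_expr_def)
  have I: "?I N r" unfolding r by (rule A)
  have "(\<forall>c<N. \<not> ok c) \<longleftrightarrow> (\<forall>c\<in>children f. x < low j c)"
    by (auto simp: ok_def children_def)
  note B = this
  show ?thesis unfolding is_pred_def r_def[symmetric]
  proof (cases "\<forall>c\<in>children f. x < low j c")
    case True
    with I B show "r < N \<and> (if \<forall>c'\<in>children f. x < low j c' then r = 0
      else r \<in> children f \<and> low j r \<le> x \<and> (\<forall>c'\<in>children f. low j c' \<le> x \<longrightarrow> low j c' \<le> low j r))" by simp
  next
    case False
    with I B have r: "ok r" "\<And>c. c < N \<Longrightarrow> ok c \<Longrightarrow> low j c \<le> low j r" by auto
    have "low j c \<le> low j r" if "c \<in> children f" "low j c \<le> x" for c
      by (rule r(2)) (use that in \<open>auto simp: ok_def children_def\<close>)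
    moreover have "r < N" using I by blast
    ultimately show "r < N \<and> (if \<forall>c'\<in>children f. x < low j c' then r = 0
      else r \<in> children f \<and> low j r \<le> x \<and> (\<forall>c'\<in>children f. low j c' \<le> x \<longrightarrow> low j c' \<le> low j r))"
      unfolding if_not_P[OF False] using r(1) by (simp add: ok_def)
  qed
qed

lemma ev_prefix_expr:
  assumes m: "par_mem m" "low_mem m" "edges_mem m" and j: "j < k" and cy: "c < N" "y < N"
  shows "ev w m [z, n, k, N, T, j, c, y] prefix_expr = low_prefix j c y"
proof (cases "c = 0")
  case True
  then show ?thesis by (simp add: prefix_expr_def low_prefix_def)
next
  case False
  let ?e = "IfEq (Var 9) (Num 0) (Var 8)
       (IfEq (par_expr (Var 9)) (par_expr (Var 6))
         (IfLess (low_at (Var 6)) (low_at (Var 9)) (Var 8) (Op Add (Var 8) (rd (Num 2) (Var 9) (Var 7))))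
         (Var 8))"
  let ?A = "{c' \<in> children (par c). low j c' \<le> low j c}"
  let ?f = "\<lambda>c'. if c' \<in> ?A then subtree_edges c' y else 0"
  have s: "sum ?f {..<N} = low_prefix j c y"
  proof -
    have "{..<N} \<inter> ?A = ?A" by (auto simp: children_def)
    then show ?thesis using False by (simp add: low_prefix_def sum.If_cases)
  qed
  have "sum ?f {..<N} \<le> (\<Sum>c'<N. N * N)"
    by (intro sum_mono) (use subtree_edges_le in auto)
  then have "0 + sum ?f {..<N} \<le> N * N * N" by simp
  then have "foldl (\<lambda>u c'. ev w m [z, n, k, N, T, j, c, y, u, c'] ?e) 0 [0..<N] = 0 + sum ?f {..<N}"
  proof (rule foldl_sum[rotated])
    fix c' u assume c': "c' < N" and u: "u + ?f c' \<le> N * N * N"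
    let ?\<rho> = "[z, n, k, N, T, j, c, y, u, c']"
    have p: "ev w m ?\<rho> (par_expr (Var 9)) = par c'" "ev w m ?\<rho> (par_expr (Var 6)) = par c"
      by (subst ev_par_expr; use m c' cy in \<open>simp add: par_mem_def\<close>)+
    have l: "ev w m ?\<rho> (low_at (Var 9)) = low j c'" "ev w m ?\<rho> (low_at (Var 6)) = low j c"
      using ev_low_at[of ?\<rho> m j] m j c' cy by simp_all
    have r: "ev w m ?\<rho> (rd (Num 2) (Var 9) (Var 7)) = subtree_edges c' y"
      by (subst ev_rd) (use m c' cy T4 in \<open>simp_all add: edges_mem_def\<close>)
    have A: "c' \<in> ?A \<longleftrightarrow> c' \<noteq> 0 \<and> par c' = par c \<and> \<not> low j c < low j c'"
      using c' by (auto simp: children_def)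
    have lt: "u + ?f c' < 2 ^ w" using u big3 by linarith
    show "ev w m ?\<rho> ?e = u + ?f c'"
    proof (cases "c' \<in> ?A")
      case True
      then have "c' \<noteq> 0" "par c' = par c" "\<not> low j c < low j c'" using A by blast+
      moreover have "u + subtree_edges c' y < 2 ^ w" using lt True by (simp only: if_True)
      ultimately show ?thesis using p l r if_P[OF True, of "subtree_edges c' y" 0] by simp
    next
      case False
      then have "c' = 0 \<or> par c' \<noteq> par c \<or> low j c < low j c'" using A by blast
      then show ?thesis using p l if_not_P[OF False, of "subtree_edges c' y" 0] by auto
    qed
  qed
  then show ?thesis using s False by (simp add: prefix_expr_def)
qed

end

section \<open>Depth-first search on the word RAM\<close>

text \<open>The parent \<open>j\<close> and the new vertex \<open>x\<close> are returned as the one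
  number \<open>j * N + x\<close>. As the scan keeps its last hit, \<open>j\<close> is the largest
  candidate; \<open>j = 0\<close> accepts every unnumbered vertex, so there always is a hit.\<close>

definition next_expr :: expr where
  "next_expr = Fold 3 (Num 0) (Fold 1 (Var 6)
     (IfEq (rd (Num 0) (Num 1) (Var 9)) (Num 0)
       (IfLess (Var 5) (Var 7) (Var 8)
         (IfEq (Var 7) (Num 0) (Op Add (Op Mul (Var 7) (Var 3)) (Var 9))
           (IfEq (rd t_adj (rd t_ord (Num 0) (Var 7)) (Var 9)) (Num 1)
             (Op Add (Op Mul (Var 7) (Var 3)) (Var 9)) (Var 8))))
       (Var 8)))"

text \<open>The matrix is moved from the input into table \<open>T\<close>, because the tables reuse
  the addresses of the input; already \<open>clear_com\<close>, which prepares row 1 of table 0, may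
  overwrite a part of it.\<close>

definition copy_com :: com where
  "copy_com = fill 5 1 1 (Var 4) (Ld (Op Add (Num 2) (Op Add (Op Mul (Var 5) (Var 1)) (Var 6))))"

definition clear_com :: com where
  "clear_com = For 1 (St (addr (Num 0) (Num 1) (Var 5)) (Num 0))"

definition dfs_step_com :: com where
  "dfs_step_com = LetC next_expr (Seq
     (St (addr t_ord (Num 0) (Op Add (Var 5) (Num 1))) (Op Mod (Var 6) (Var 3))) (Seq
     (St (addr t_par (Num 0) (Op Add (Var 5) (Num 1))) (Op Div (Var 6) (Var 3)))
     (St (addr (Num 0) (Num 1) (Op Mod (Var 6) (Var 3))) (Op Add (Var 5) (Num 1)))))"

definition dfs_com :: com where
  "dfs_com = For 1 dfs_step_com"

context layout
begin

lemma ev_addr_env: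
  assumes "env \<rho>" "ev w m \<rho> t \<le> Suc (Suc T)" "ev w m \<rho> i < N" "ev w m \<rho> j < N"
  shows "ev w m \<rho> (addr t i j) = tab N (ev w m \<rho> t) (ev w m \<rho> i) (ev w m \<rho> j)"
  by (rule ev_rd_N(1)[OF _ assms(2-4)]) (use assms(1) in \<open>simp add: env_def\<close>)

definition dfs_inv :: "(nat \<Rightarrow> nat \<Rightarrow> bool) \<Rightarrow> nat \<Rightarrow> (nat \<Rightarrow> nat) \<Rightarrow> bool" where
  "dfs_inv A i m \<longleftrightarrow>
     (\<forall>x<n. \<forall>y<n. m (tab N T x y) = (if A x y then 1 else 0)) \<and>
     (\<exists>ord num par. dfs_numbering n A i ord num par \<and>
        (\<forall>a. 0 < a \<longrightarrow> a \<le> i \<longrightarrow> m (tab N (Suc T) 0 a) = ord a) \<and>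
        (\<forall>a\<le>i. m (tab N (Suc (Suc T)) 0 a) = par a) \<and>
        (\<forall>x<n. m (tab N 0 1 x) = num x))"

definition next_vertex where
  "next_vertex A i ord num j x \<longleftrightarrow> x < n \<and> num x = (0::nat) \<and> j \<le> i \<and> (j = 0 \<or> A (ord j) x) \<and>
    (\<forall>j' x'. j' \<le> i \<longrightarrow> x' < n \<longrightarrow> num x' = 0 \<longrightarrow> A (ord j') x' \<longrightarrow> 0 < j' \<longrightarrow> j' \<le> j)"

lemma ev_next_expr:
  assumes n: "0 < n" and i: "i < n" and D: "dfs_numbering n A i ord num par"
    and m: "\<And>x y. x < n \<Longrightarrow> y < n \<Longrightarrow> m (tab N T x y) = (if A x y then 1 else 0)"
      "\<And>a. 0 < a \<Longrightarrow> a \<le> i \<Longrightarrow> m (tab N (Suc T) 0 a) = ord a" "\<And>x. x < n \<Longrightarrow> m (tab N 0 1 x) = num x"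
  shows "\<exists>j x. ev w m [z, n, k, N, T, i] next_expr = j * N + x \<and> next_vertex A i ord num j x"
proof -
  let ?e = "IfEq (rd (Num 0) (Num 1) (Var 9)) (Num 0)
       (IfLess (Var 5) (Var 7) (Var 8)
         (IfEq (Var 7) (Num 0) (Op Add (Op Mul (Var 7) (Var 3)) (Var 9))
           (IfEq (rd t_adj (rd t_ord (Num 0) (Var 7)) (Var 9)) (Num 1)
             (Op Add (Op Mul (Var 7) (Var 3)) (Var 9)) (Var 8))))
       (Var 8)"
  define Q where "Q j x \<longleftrightarrow> num x = 0 \<and> j \<le> i \<and> (j = 0 \<or> A (ord j) x)" for j x
  have e: "ev w m [z, n, k, N, T, i, u, j, v, x] ?e = (if Q j x then j * N + x else v)"
    if j: "j < N" and x: "x < n" for j x u v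
  proof -
    let ?\<rho> = "[z, n, k, N, T, i, u, j, v, x]"
    have xN: "x < N" "1 < N" using x n by (simp_all add: N_def)
    have num: "ev w m ?\<rho> (rd (Num 0) (Num 1) (Var 9)) = num x"
      by (subst ev_rd) (use xN m(3)[OF x] in simp_all)
    have "j * N + x < N * N"
      using mult_le_mono1[of "j + 1" N N] j xN(1) by (simp only: add_mult_distrib) linarith
    then have lt: "j * N + x < 2 ^ w" using T3(3) by linarith
    have v: "ev w m ?\<rho> (Op Add (Op Mul (Var 7) (Var 3)) (Var 9)) = j * N + x"
      using lt by (simp add: mod_simps)
    show ?thesis
    proof (cases "num x = 0 \<and> j \<le> i \<and> j \<noteq> 0")
      case True
      then have ji: "0 < j" "j \<le> i" by auto
      have oj: "m (tab N (Suc T) 0 j) = ord j" "ord j < n"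
        using m(2)[OF ji] dfs_numberingD(1)[OF D ji] by auto
      have oN: "ord j < N" using oj(2) by (simp add: N_def)
      have o: "ev w m ?\<rho> (rd t_ord (Num 0) (Var 7)) = ord j"
        by (subst ev_rd) (use ev_tables[of ?\<rho> m, OF env_base] j N_pos oj in simp_all)
      have "ev w m ?\<rho> (rd t_adj (rd t_ord (Num 0) (Var 7)) (Var 9)) = (if A (ord j) x then 1 else 0)"
        by (subst ev_rd)
           (use ev_tables[of ?\<rho> m, OF env_base] o oN m(1)[OF oj(2) x] xN in simp_all)
      then show ?thesis using num v True ji by (simp add: Q_def)
    next
      case False
      then show ?thesis using num v by (auto simp: Q_def)
    qed
  qed
  define R where "R j \<longleftrightarrow> (\<exists>x<n. Q j x)" for j
  have inner: "foldl (\<lambda>v x. ev w m [z, n, k, N, T, i, u, j, v, x] ?e) u [0..<n]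
      = (if R j then j * N + Max {x. x < n \<and> Q j x} else u)" if "j < N" for u j
    unfolding R_def
    by (rule foldl_last[where h = "\<lambda>x. j * N + x"]) (rule e[OF that])
  have outer: "foldl (\<lambda>u j. ev w m [z, n, k, N, T, i, u, j] (Fold 1 (Var 6) ?e)) 0 [0..<N]
      = (if \<exists>j<N. R j then (\<lambda>j. j * N + Max {x. x < n \<and> Q j x}) (Max {j. j < N \<and> R j}) else 0)"
    by (rule foldl_last) (use inner in simp)
  define J where "J = Max {j. j < N \<and> R j}"
  define X where "X = Max {x. x < n \<and> Q J x}"
  obtain x0 where "x0 < n" "num x0 = 0" using dfs_numbering_unnumbered[OF D i] by blast
  then have "R 0" unfolding R_def Q_def by auto
  then have ex: "\<exists>j<N. R j" using N_pos by blast
  then have "J \<in> {j. j < N \<and> R j}" unfolding J_def by (intro Max_in) auto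
  then have J: "J < N" "R J" by auto
  have Jmax: "j \<le> J" if "j < N" "R j" for j unfolding J_def by (rule Max_ge) (use that in auto)
  have "X \<in> {x. x < n \<and> Q J x}" unfolding X_def by (rule Max_in) (use J in \<open>auto simp: R_def\<close>)
  then have X: "X < n" "Q J X" by auto
  have ev: "ev w m [z, n, k, N, T, i] next_expr
      = foldl (\<lambda>u j. ev w m [z, n, k, N, T, i, u, j] (Fold 1 (Var 6) ?e)) 0 [0..<N]"
    by (simp add: next_expr_def)
  have "ev w m [z, n, k, N, T, i] next_expr = J * N + X"
    unfolding ev outer if_P[OF ex] J_def[symmetric] X_def[symmetric] ..
  moreover have "j' \<le> J" if "j' \<le> i" "x' < n" "num x' = 0" "A (ord j') x'" for j' x'
    by (rule Jmax) (use that i in \<open>auto simp: N_def R_def Q_def\<close>)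
  ultimately show ?thesis using X unfolding Q_def next_vertex_def by blast
qed

lemma dfs_step_com_correct:
  assumes n: "0 < n" and i: "i < n" and sym: "\<And>x y. A x y \<Longrightarrow> A y x" and I: "dfs_inv A i m"
  shows "dfs_inv A (Suc i) (cv w [z, n, k, N, T, i] dfs_step_com m)"
proof -
  obtain ord num par where D: "dfs_numbering n A i ord num par"
    and O: "\<forall>a. 0 < a \<longrightarrow> a \<le> i \<longrightarrow> m (tab N (Suc T) 0 a) = ord a"
      "\<forall>a\<le>i. m (tab N (Suc (Suc T)) 0 a) = par a" "\<forall>x<n. m (tab N 0 1 x) = num x"
    using I unfolding dfs_inv_def by (elim conjE exE) (rule that; assumption)
  have m1: "m (tab N T x y) = (if A x y then 1 else 0)" if "x < n" "y < n" for x y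
    using conjunct1[OF I[unfolded dfs_inv_def]] that by simp
  have m2: "m (tab N (Suc T) 0 a) = ord a" if "0 < a" "a \<le> i" for a using O(1) that by simp
  have m3: "m (tab N (Suc (Suc T)) 0 a) = par a" if "a \<le> i" for a using O(2) that by simp
  have m4: "m (tab N 0 1 x) = num x" if "x < n" for x using O(3) that by simp
  have "\<exists>j x. ev w m [z, n, k, N, T, i] next_expr = j * N + x \<and> next_vertex A i ord num j x"
    by (rule ev_next_expr[OF n i D]; (rule m1 | rule m2 | rule m4); assumption)
  then obtain j x where ev: "ev w m [z, n, k, N, T, i] next_expr = j * N + x"
    and jx: "next_vertex A i ord num j x" by blast
  from jx have x: "x < n" "num x = 0" and j: "j \<le> i" "j = 0 \<or> A (ord j) x"
    unfolding next_vertex_def by simp_all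
  have last: "j' \<le> j" if "j' \<le> i" "x' < n" "num x' = 0" "A (ord j') x'" "0 < j'" for j' x'
    using jx that unfolding next_vertex_def by blast
  let ?v = "j * N + x"
  let ?\<rho> = "[z, n, k, N, T, i, ?v]"
  have xN: "x < N" "Suc i < N" "1 < N" "0 < N" using x i n by (simp_all add: N_def)
  have dm: "?v div N = j" "?v mod N = x" using xN by simp_all
  have lt: "j < 2 ^ w" "x < 2 ^ w" "Suc i < 2 ^ w" using j i x N_less by (simp_all add: N_def)
  have ev1: "ev w m' ?\<rho> (Op Mod (Var 6) (Var 3)) = x" "ev w m' ?\<rho> (Op Div (Var 6) (Var 3)) = j"
    "ev w m' ?\<rho> (Op Add (Var 5) (Num 1)) = Suc i" for m'
    using dm lt by simp_all
  have a: "ev w m' ?\<rho> (addr t_ord (Num 0) (Op Add (Var 5) (Num 1))) = tab N (Suc T) 0 (Suc i)"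
    "ev w m' ?\<rho> (addr t_par (Num 0) (Op Add (Var 5) (Num 1))) = tab N (Suc (Suc T)) 0 (Suc i)"
    "ev w m' ?\<rho> (addr (Num 0) (Num 1) (Op Mod (Var 6) (Var 3))) = tab N 0 1 x" for m'
    using ev_addr_env[of ?\<rho> m' t_ord "Num 0" "Op Add (Var 5) (Num 1)"]
      ev_addr_env[of ?\<rho> m' t_par "Num 0" "Op Add (Var 5) (Num 1)"]
      ev_addr_env[of ?\<rho> m' "Num 0" "Num 1" "Op Mod (Var 6) (Var 3)"]
      ev_tables[of ?\<rho> m', OF env_base] ev1[of m'] xN by simp_all
  let ?m = "m(tab N (Suc T) 0 (Suc i) := x, tab N (Suc (Suc T)) 0 (Suc i) := j, tab N 0 1 x := Suc i)"
  have cv: "cv w [z, n, k, N, T, i] dfs_step_com m = ?m"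
    unfolding dfs_step_com_def cv.simps ev by (simp only: append_Cons append_Nil a ev1)
  have rd: "?m (tab N t a b) = (if t = 0 \<and> a = 1 \<and> b = x then Suc i
      else if t = Suc (Suc T) \<and> a = 0 \<and> b = Suc i then j
      else if t = Suc T \<and> a = 0 \<and> b = Suc i then x else m (tab N t a b))"
    if "a < N" "b < N" for t a b
    using tab_inject[OF that xN(3,1), of t 0] tab_inject[OF that xN(4,2), of t "Suc T"]
      tab_inject[OF that xN(4,2), of t "Suc (Suc T)"] by auto
  have "dfs_inv A (Suc i) ?m"
    unfolding dfs_inv_def
  proof (intro conjI exI allI impI)
    show "dfs_numbering n A (Suc i) (ord(Suc i := x)) (num(x := Suc i)) (par(Suc i := j))"
      by (rule dfs_numbering_step[OF D sym x j last])
    show "?m (tab N T x' y) = (if A x' y then 1 else 0)" if "x' < n" "y < n" for x' y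
    proof -
      have "?m (tab N T x' y) = m (tab N T x' y)"
        using rd[of x' y T] that T4 by (simp add: N_def)
      then show ?thesis using m1[OF that] by simp
    qed
    show "?m (tab N (Suc T) 0 a) = (ord(Suc i := x)) a" if "0 < a" "a \<le> Suc i" for a
      using rd[of 0 a "Suc T"] that xN m2[of a] by (cases "a = Suc i") simp_all
    show "?m (tab N (Suc (Suc T)) 0 a) = (par(Suc i := j)) a" if "a \<le> Suc i" for a
      using rd[of 0 a "Suc (Suc T)"] that xN m3[of a] by (cases "a = Suc i") simp_all
    show "?m (tab N 0 1 y) = (num(x := Suc i)) y" if "y < n" for y
      using rd[of 1 y 0] that xN m4[of y] by (cases "y = x") (simp_all add: N_def)
  qed
  then show ?thesis unfolding cv .
qed

lemma dfs_com_correct: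
  assumes n: "0 < n" and sym: "\<And>x y. A x y \<Longrightarrow> A y x"
    and inp: "\<And>x y. x < n \<Longrightarrow> y < n \<Longrightarrow> m (2 + x * n + y) = (if A x y then 1 else 0)"
  shows "dfs_inv A n (cv w [z, n, k, N, T] (Seq copy_com (Seq clear_com dfs_com)) m)"
proof -
  let ?\<rho> = "[z, n, k, N, T]"
  have nN: "n \<le> N" "1 < N" "n < N" using n by (simp_all add: N_def)
  have le: "(T + 1) * N * N \<le> 2 ^ w"
    using big by (rule order_trans[rotated]) (intro mult_le_mono1, simp)
  define m1 where "m1 = cv w ?\<rho> copy_com m"
  have copy: "m1 (tab N T x y) = (if A x y then 1 else 0)" if xy: "x < n" "y < n" for x y
    unfolding m1_def copy_com_def
  proof (rule fill_correct(2)[where V = "\<lambda>x y v. v = (if A x y then 1 else 0)"])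
    fix x y m' assume "x < ?\<rho> ! 1" "y < ?\<rho> ! 1" and m': "same_but (in_tab N T) m m'"
    then have xy: "x < n" "y < n" by simp_all
    have "(x + 1) * n \<le> n * n" by (rule mult_le_mono1) (use xy in simp)
    then have "x * n + y < n * n" using xy(2) unfolding add_mult_distrib mult_1 by linarith
    then have 1: "2 + x * n + y < N * N + 2" by (simp add: N_def)
    \<comment> \<open>The input ends before table \<open>T\<close> begins, so copying does not
      overwrite what is still to be read.\<close>
    have 2: "N * N + 2 \<le> T * N * N"
    proof -
      have "4 * (N * N) \<le> T * (N * N)" by (rule mult_le_mono1[OF T4])
      moreover have "1 * 1 \<le> N * N" by (rule mult_le_mono) (use nN in simp_all)
      ultimately show ?thesis unfolding mult.assoc by linarith
    qed
    have "T * N * N \<le> (T + 1) * N * N" by (intro mult_le_mono1) simp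
    then have "2 + x * n + y < 2 ^ w" using 1 2 le by linarith
    then have "ev w m' (?\<rho> @ [x, y]) (Ld (Op Add (Num 2) (Op Add (Op Mul (Var 5) (Var 1)) (Var 6)))) = m' (2 + x * n + y)"
      by (simp add: mod_simps add.assoc)
    moreover have "\<not> in_tab N T (2 + x * n + y)"
    proof
      assume "in_tab N T (2 + x * n + y)"
      then obtain a b where "2 + x * n + y = tab N T a b" by (auto simp: in_tab_def)
      then have "T * N * N \<le> 2 + x * n + y" by (simp add: tab_def add_mult_distrib)
      then show False using 1 2 by linarith
    qed
    ultimately show "ev w m' (?\<rho> @ [x, y]) (Ld (Op Add (Num 2) (Op Add (Op Mul (Var 5) (Var 1)) (Var 6))))
      = (if A x y then 1 else 0)"
      using m' inp[OF xy] by (simp add: same_but_def)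
  qed (use nN le xy in simp_all)
  define m2 where "m2 = cv w ?\<rho> clear_com m1"
  let ?I = "\<lambda>i m'. (\<forall>x<n. \<forall>y<n. m' (tab N T x y) = (if A x y then 1 else 0)) \<and> (\<forall>x<i. m' (tab N 0 1 x) = 0)"
  have "?I n (foldl (\<lambda>m i. cv w (?\<rho> @ [i]) (St (addr (Num 0) (Num 1) (Var 5)) (Num 0)) m) m1 [0..<n])"
  proof (rule foldl_upt_inv[where I = ?I])
    show "?I 0 m1" using copy by simp
    fix i and m' :: "nat \<Rightarrow> nat" assume i: "i < n" and I: "?I i m'"
    have a: "ev w m' (?\<rho> @ [i]) (addr (Num 0) (Num 1) (Var 5)) = tab N 0 1 i"
      by (subst ev_addr_env) (use i nN in simp_all)
    have "tab N T x y \<noteq> tab N 0 1 i" if "x < n" "y < n" for x y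
      using tab_inject[of x N y 1 i T 0] that i nN T4 by simp
    moreover have "tab N 0 1 x = tab N 0 1 i \<longleftrightarrow> x = i" if "x < n" for x
      using tab_inject[of 1 N x 1 i 0 0] that i nN by simp
    ultimately show "?I (Suc i) (cv w (?\<rho> @ [i]) (St (addr (Num 0) (Num 1) (Var 5)) (Num 0)) m')"
      using I i a by (auto simp: less_Suc_eq)
  qed
  then have I2: "?I n m2" by (simp add: m2_def clear_com_def)
  have "dfs_inv A 0 m2"
    unfolding dfs_inv_def
  proof (intro conjI exI allI impI)
    \<comment> \<open>With no vertex numbered, \<open>ord\<close> and \<open>par\<close> are
      unconstrained, so whatever the memory holds is taken for them.\<close>
    show "dfs_numbering n A 0 (\<lambda>a. m2 (tab N (Suc T) 0 a)) (\<lambda>x. m2 (tab N 0 1 x)) (\<lambda>a. m2 (tab N (Suc (Suc T)) 0 a))"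
      by (rule dfs_numbering_0) (use I2 in blast)
  qed (use I2 in blast)+
  then have "dfs_inv A n (foldl (\<lambda>m i. cv w (?\<rho> @ [i]) dfs_step_com m) m2 [0..<n])"
    by (intro foldl_upt_inv[where I = "dfs_inv A"]) (simp_all add: dfs_step_com_correct[OF n _ sym])
  then show ?thesis by (simp add: dfs_com_def m2_def m1_def)
qed

end

section \<open>The construction as a whole\<close>

definition number_com :: com where
  "number_com = Seq copy_com (Seq clear_com dfs_com)"

text \<open>Cell 0 passes \<open>N\<close> on to the queries. Cell 1 is the size to be returned,
  which covers the tables before \<open>T\<close> and leaves out the work tables. A graph without
  vertices gets size 0.\<close>

definition header_com :: com where
  "header_com = Seq (St (Num 0) (Var 3))
     (St (Num 1) (IfEq (Var 1) (Num 0) (Num 0) (Op Mul (Op Mul (Var 4) (Var 3)) (Var 3))))"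

definition tables_com :: com where
  "tables_com =
     Seq (fill 5 3 3 (Num 1) child_expr)
    (Seq (fill 5 3 3 (Num 2) edges_expr)
    (Seq (fill 5 3 3 (Num 3) nbr_expr)
    (Seq (fill_levels 4 low_expr)
    (Seq (fill_levels 5 pred_expr)
    (Seq (fill_levels 6 prefix_expr)
         header_com)))))"

definition build_com :: com where
  "build_com = LetC (Ld (Num 0)) (LetC (Ld (Num 1)) (LetC (Op Add (Var 1) (Num 1))
     (LetC (Op Add (Num 4) (Op Mul (Num 3) (Var 2))) (Seq number_com tables_com))))"

context layout
begin

text \<open>Speaks of a single table, in contrast to \<open>same_but\<close>: exactly what a fact
  about that table needs in order to persist.\<close>

definition stable :: "nat \<Rightarrow> (nat \<Rightarrow> nat) \<Rightarrow> (nat \<Rightarrow> nat) \<Rightarrow> bool" where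
  "stable t m m' \<longleftrightarrow> (\<forall>i<N. \<forall>j<N. m' (tab N t i j) = m (tab N t i j))"

lemma stableD: "stable t m m' \<Longrightarrow> i < N \<Longrightarrow> j < N \<Longrightarrow> m' (tab N t i j) = m (tab N t i j)"
  by (simp add: stable_def)

lemma stable_tab: "same_but (in_tab N t') m m' \<Longrightarrow> t \<noteq> t' \<Longrightarrow> stable t m m'"
  using same_but_tab by (simp add: stable_def)

lemma stable_levels: "same_but (in_levels c) m m' \<Longrightarrow> (\<And>j. j < k \<Longrightarrow> t \<noteq> c + 3 * j) \<Longrightarrow> stable t m m'"
  unfolding stable_def same_but_def in_levels_def using in_tab_tab by (metis)

lemma header_correct:
  assumes "0 < n"
  shows "cv w [z, n, k, N, T] header_com m 0 = N" "cv w [z, n, k, N, T] header_com m 1 = T * N * N"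
    "t \<noteq> 0 \<Longrightarrow> stable t m (cv w [z, n, k, N, T] header_com m)"
    "x < N \<Longrightarrow> cv w [z, n, k, N, T] header_com m (tab N 0 1 x) = m (tab N 0 1 x)"
proof -
  have N: "1 < N" "0 < N" using assms by (simp_all add: N_def)
  have "T * N * N < (T + 3) * N * N" using N by simp
  then have "T * N * N < 2 ^ w" using big by linarith
  then have v: "(T * N mod 2 ^ w * N) mod 2 ^ w = T * N * N" by (simp add: mod_simps)
  have cv: "cv w [z, n, k, N, T] header_com m = m(0 := N, 1 := T * N * N)"
    using assms v by (simp add: header_com_def)
  then show "cv w [z, n, k, N, T] header_com m 0 = N" "cv w [z, n, k, N, T] header_com m 1 = T * N * N"
    by simp_all
  have t0: "tab N 0 0 0 = 0" "tab N 0 0 1 = 1" by (simp_all add: tab_def)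
  have ne: "tab N t i j \<noteq> 0" "tab N t i j \<noteq> 1" if "i < N" "j < N" "t \<noteq> 0 \<or> i \<noteq> 0" for t i j
    using tab_inject[OF that(1,2) N(2) N(2), of t 0] tab_inject[OF that(1,2) N(2) N(1), of t 0] that(3)
    unfolding t0 by auto
  show "stable t m (cv w [z, n, k, N, T] header_com m)" if "t \<noteq> 0"
    unfolding cv stable_def
  proof (intro allI impI)
    fix i j assume "i < N" "j < N"
    from ne[OF this disjI1[OF that]] show "(m(0 := N, 1 := T * N * N)) (tab N t i j) = m (tab N t i j)"
      by simp
  qed
  show "cv w [z, n, k, N, T] header_com m (tab N 0 1 x) = m (tab N 0 1 x)" if "x < N"
    unfolding cv using ne[of 1 x 0] that N by simp
qed

end

context tree_layout
begin

lemma fill_table: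
  assumes "t \<le> 3" "\<And>a b m'. a < N \<Longrightarrow> b < N \<Longrightarrow> same_but (in_tab N t) m m' \<Longrightarrow>
    V a b (ev w m' [z, n, k, N, T, a, b] e)"
  shows "same_but (in_tab N t) m (cv w [z, n, k, N, T] (fill 5 3 3 (Num t) e) m)"
    "\<And>a b. a < N \<Longrightarrow> b < N \<Longrightarrow> V a b (cv w [z, n, k, N, T] (fill 5 3 3 (Num t) e) m (tab N t a b))"
proof -
  have "(t + 1) * N * N \<le> (T + 3) * N * N" by (intro mult_le_mono1) (use assms(1) T4 in simp)
  then have le: "(t + 1) * N * N \<le> 2 ^ w" using big by linarith
  show "same_but (in_tab N t) m (cv w [z, n, k, N, T] (fill 5 3 3 (Num t) e) m)"
    by (rule fill_correct(1)[where V = V]) (use le assms in simp_all)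
  show "V a b (cv w [z, n, k, N, T] (fill 5 3 3 (Num t) e) m (tab N t a b))" if "a < N" "b < N" for a b
    by (rule fill_correct(2)[where V = V]) (use le assms that in simp_all)
qed

lemma par_mem_stable: "par_mem m \<Longrightarrow> stable (Suc (Suc T)) m m' \<Longrightarrow> par_mem m'"
  using N_pos by (simp add: par_mem_def stable_def)

lemma adj_mem_stable: 
  assumes "adj_mem m" "stable (Suc T) m m'" "stable T m m'" shows "adj_mem m'"
  unfolding adj_mem_def
proof (intro allI impI)
  fix p q assume pq: "0 < p" "p < N" "0 < q" "q < N"
  note a = assms(1)[unfolded adj_mem_def, rule_format, OF pq(1,2) pq(3,4)]
    assms(1)[unfolded adj_mem_def, rule_format, OF pq(3,4) pq(1,2)]
  have "m' (tab N (Suc T) 0 p) = m (tab N (Suc T) 0 p)" "m' (tab N (Suc T) 0 q) = m (tab N (Suc T) 0 q)"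
    using stableD[OF assms(2)] N_pos pq by simp_all
  then show "m' (tab N (Suc T) 0 p) < N \<and>
     m' (tab N T (m' (tab N (Suc T) 0 p)) (m' (tab N (Suc T) 0 q))) = (if adj p q then 1 else 0)"
    using a stableD[OF assms(3)] by simp
qed

lemma child_mem_stable: "child_mem m \<Longrightarrow> stable 1 m m' \<Longrightarrow> child_mem m'"
  by (simp add: child_mem_def stable_def)

lemma edges_mem_stable: "edges_mem m \<Longrightarrow> stable 2 m m' \<Longrightarrow> edges_mem m'"
  by (simp add: edges_mem_def stable_def)

lemma nbr_mem_stable: "nbr_mem m \<Longrightarrow> stable 3 m m' \<Longrightarrow> nbr_mem m'"
  by (simp add: nbr_mem_def stable_def)

lemma low_mem_stable: "low_mem m \<Longrightarrow> (\<And>j. j < k \<Longrightarrow> stable (4 + 3 * j) m m') \<Longrightarrow> low_mem m'"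
  by (simp add: low_mem_def stable_def)

lemma pred_mem_stable: "pred_mem m \<Longrightarrow> (\<And>j. j < k \<Longrightarrow> stable (5 + 3 * j) m m') \<Longrightarrow> pred_mem m'"
  by (simp add: pred_mem_def stable_def)

lemma prefix_mem_stable: "prefix_mem m \<Longrightarrow> (\<And>j. j < k \<Longrightarrow> stable (6 + 3 * j) m m') \<Longrightarrow> prefix_mem m'"
  by (simp add: prefix_mem_def stable_def)

text \<open>Each kind of table depends on finished ones only: \<open>child\<close> on
  \<open>par\<close>; edge counts and \<open>nbr\<close> on \<open>child\<close> and adjacency;
  \<open>low\<close> on \<open>nbr\<close>; predecessors on \<open>low\<close> and
  \<open>par\<close>; prefix sums on \<open>low\<close>, \<open>par\<close> and the edge
  counts.\<close>

lemma tables_com_correct: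
  assumes n: "0 < n" and par: "par_mem m" and adj: "adj_mem m"
    and m': "m' = cv w [z, n, k, N, T] tables_com m"
  shows "m' 0 = N" "m' 1 = T * N * N" "\<And>x. x < N \<Longrightarrow> m' (tab N 0 1 x) = m (tab N 0 1 x)"
    "child_mem m'" "edges_mem m'" "low_mem m'" "pred_mem m'" "prefix_mem m'"
proof -
  let ?\<rho> = "[z, n, k, N, T]"
  have N: "1 < N" using n by (simp add: N_def)
  define m1 where "m1 = cv w ?\<rho> (fill 5 3 3 (Num 1) child_expr) m"
  have e1: "ev w m' [z, n, k, N, T, a, b] child_expr = child a b"
    if "a < N" "b < N" "same_but (in_tab N 1) m m'" for a b m'
    by (rule ev_child_expr[OF par_mem_stable[OF par stable_tab[OF that(3)]] that(1,2)]) (use T4 in simp)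
  note f1 = fill_table[where V = "\<lambda>a b x. x = child a b", of 1 m z child_expr, OF _ e1, folded m1_def]
  have s1: "stable t m m1" if "t \<noteq> 1" for t by (rule stable_tab[OF f1(1) that]) simp_all
  have c1: "child_mem m1" using f1(2) by (simp add: child_mem_def)
  have p1: "par_mem m1" by (rule par_mem_stable[OF par s1]) (use T4 in simp)
  have a1: "adj_mem m1" by (rule adj_mem_stable[OF adj s1 s1]) (use T4 in simp_all)
  define m2 where "m2 = cv w ?\<rho> (fill 5 3 3 (Num 2) edges_expr) m1"
  have e2: "ev w m' [z, n, k, N, T, a, b] edges_expr = subtree_edges a b"
    if "a < N" "b < N" "same_but (in_tab N 2) m1 m'" for a b m'
    by (rule ev_edges_expr[OF child_mem_stable[OF c1 stable_tab[OF that(3)]]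
          adj_mem_stable[OF a1 stable_tab[OF that(3)] stable_tab[OF that(3)]] that(1,2)]) (use T4 in simp_all)
  note f2 = fill_table[where V = "\<lambda>a b x. x = subtree_edges a b", of 2 m1 z edges_expr, OF _ e2, folded m2_def]
  have s2: "stable t m1 m2" if "t \<noteq> 2" for t by (rule stable_tab[OF f2(1) that]) simp_all
  have c2: "child_mem m2" by (rule child_mem_stable[OF c1 s2]) simp
  have p2: "par_mem m2" by (rule par_mem_stable[OF p1 s2]) (use T4 in simp)
  have a2: "adj_mem m2" by (rule adj_mem_stable[OF a1 s2 s2]) (use T4 in simp_all)
  have d2: "edges_mem m2" using f2(2) by (simp add: edges_mem_def)
  define m3 where "m3 = cv w ?\<rho> (fill 5 3 3 (Num 3) nbr_expr) m2"
  have e3: "ev w m' [z, n, k, N, T, a, b] nbr_expr = (if nbr a b then 1 else 0)"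
    if "a < N" "b < N" "same_but (in_tab N 3) m2 m'" for a b m'
    by (rule ev_nbr_expr[OF child_mem_stable[OF c2 stable_tab[OF that(3)]]
          adj_mem_stable[OF a2 stable_tab[OF that(3)] stable_tab[OF that(3)]] that(1,2)]) (use T4 in simp_all)
  note f3 = fill_table[where V = "\<lambda>a b x. x = (if nbr a b then 1 else 0)", of 3 m2 z nbr_expr, OF _ e3, folded m3_def]
  have s3: "stable t m2 m3" if "t \<noteq> 3" for t by (rule stable_tab[OF f3(1) that]) simp_all
  have c3: "child_mem m3" by (rule child_mem_stable[OF c2 s3]) simp
  have p3: "par_mem m3" by (rule par_mem_stable[OF p2 s3]) (use T4 in simp)
  have d3: "edges_mem m3" by (rule edges_mem_stable[OF d2 s3]) simp
  have n3: "nbr_mem m3" using f3(2) by (simp add: nbr_mem_def)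
  define m4 where "m4 = cv w ?\<rho> (fill_levels 4 low_expr) m3"
  have e4: "ev w m' (?\<rho> @ [j, a, b]) low_expr = low j a"
    if "j < k" "a < N" "b < N" "same_but (in_levels 4) m3 m'" for j a b m'
    using ev_low_expr[OF nbr_mem_stable[OF n3 stable_levels[OF that(4)]] that(1,2), of z b] by simp
  note f4 = fill_levels_correct[where V = "\<lambda>j a b x. x = low j a" and c = 4 and z = z and m = m3 and e = low_expr, OF _ _ e4, folded m4_def]
  have s4: "stable t m3 m4" if "\<And>j. j < k \<Longrightarrow> t \<noteq> 4 + 3 * j" for t
    by (rule stable_levels[OF f4(1) that]) simp_all
  have c4: "child_mem m4" by (rule child_mem_stable[OF c3 s4]) simp
  have p4: "par_mem m4" by (rule par_mem_stable[OF p3 s4]) (simp add: T_def)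
  have d4: "edges_mem m4" by (rule edges_mem_stable[OF d3 s4]) simp
  have l4: "low_mem m4" using f4(2) by (simp add: low_mem_def)
  define m5 where "m5 = cv w ?\<rho> (fill_levels 5 pred_expr) m4"
  have e5: "is_pred j a b (ev w m' (?\<rho> @ [j, a, b]) pred_expr)"
    if jab: "j < k" "a < N" "b < N" and sb: "same_but (in_levels 5) m4 m'" for j a b m'
  proof -
    have st: "stable t m4 m'" if "\<And>j. j < k \<Longrightarrow> t \<noteq> 5 + 3 * j" for t
      by (rule stable_levels[OF sb that])
    have "par_mem m'" by (rule par_mem_stable[OF p4 st]) (simp add: T_def)
    moreover have "low_mem m'" by (rule low_mem_stable[OF l4 st]) presburger
    ultimately show ?thesis using ev_pred_expr[OF _ _ jab, of m' z] by simp
  qed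
  note f5 = fill_levels_correct[where V = is_pred and c = 5 and z = z and m = m4 and e = pred_expr, OF _ _ e5, folded m5_def]
  have s5: "stable t m4 m5" if "\<And>j. j < k \<Longrightarrow> t \<noteq> 5 + 3 * j" for t
    by (rule stable_levels[OF f5(1) that]) simp_all
  have c5: "child_mem m5" by (rule child_mem_stable[OF c4 s5]) simp
  have p5: "par_mem m5" by (rule par_mem_stable[OF p4 s5]) (simp add: T_def)
  have d5: "edges_mem m5" by (rule edges_mem_stable[OF d4 s5]) simp
  have l5: "low_mem m5" by (rule low_mem_stable[OF l4 s5]) presburger
  have q5: "pred_mem m5" using f5(2) by (simp add: pred_mem_def)
  define m6 where "m6 = cv w ?\<rho> (fill_levels 6 prefix_expr) m5"
  have e6: "ev w m' (?\<rho> @ [j, a, b]) prefix_expr = low_prefix j a b"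
    if jab: "j < k" "a < N" "b < N" and sb: "same_but (in_levels 6) m5 m'" for j a b m'
  proof -
    have st: "stable t m5 m'" if "\<And>j. j < k \<Longrightarrow> t \<noteq> 6 + 3 * j" for t
      by (rule stable_levels[OF sb that])
    have "par_mem m'" by (rule par_mem_stable[OF p5 st]) (simp add: T_def)
    moreover have "low_mem m'" by (rule low_mem_stable[OF l5 st]) presburger
    moreover have "edges_mem m'" by (rule edges_mem_stable[OF d5 st]) simp
    ultimately show ?thesis using ev_prefix_expr[OF _ _ _ jab, of m' z] by simp
  qed
  note f6 = fill_levels_correct[where V = "\<lambda>j a b x. x = low_prefix j a b" and c = 6 and z = z and m = m5 and e = prefix_expr, OF _ _ e6, folded m6_def]
  have s6: "stable t m5 m6" if "\<And>j. j < k \<Longrightarrow> t \<noteq> 6 + 3 * j" for t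
    by (rule stable_levels[OF f6(1) that]) simp_all
  have c6: "child_mem m6" by (rule child_mem_stable[OF c5 s6]) simp
  have d6: "edges_mem m6" by (rule edges_mem_stable[OF d5 s6]) simp
  have l6: "low_mem m6" by (rule low_mem_stable[OF l5 s6]) presburger
  have q6: "pred_mem m6" by (rule pred_mem_stable[OF q5 s6]) presburger
  have b6: "prefix_mem m6" using f6(2) by (simp add: prefix_mem_def)
  have m'eq: "m' = cv w ?\<rho> header_com m6"
    unfolding m' tables_com_def cv.simps m1_def[symmetric] m2_def[symmetric] m3_def[symmetric]
      m4_def[symmetric] m5_def[symmetric] m6_def[symmetric] ..
  note h = header_correct[OF n, where z = z and m = m6, folded m'eq]
  show "m' 0 = N" "m' 1 = T * N * N" by (rule h(1), rule h(2))
  show "child_mem m'" by (rule child_mem_stable[OF c6 h(3)]) simp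
  show "edges_mem m'" by (rule edges_mem_stable[OF d6 h(3)]) simp
  show "low_mem m'" by (rule low_mem_stable[OF l6 h(3)]) simp
  show "pred_mem m'" by (rule pred_mem_stable[OF q6 h(3)]) simp
  show "prefix_mem m'" by (rule prefix_mem_stable[OF b6 h(3)]) simp
  show "m' (tab N 0 1 x) = m (tab N 0 1 x)" if x: "x < N" for x
  proof -
    have st: "stable 0 m m6" unfolding stable_def
      using stableD[OF s1[of 0]] stableD[OF s2[of 0]] stableD[OF s3[of 0]] stableD[OF s4[of 0]]
        stableD[OF s5[of 0]] stableD[OF s6[of 0]] by simp
    show ?thesis using h(4)[OF x] stableD[OF st N x] by simp
  qed
qed

end

context layout
begin

lemma build_com_cv:
  assumes "m 0 = n" "m 1 = k"
  shows "cv w [0] build_com m = cv w [0, n, k, N, T] tables_com (cv w [0, n, k, N, T] number_com m)"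
proof -
  have "(n + 1) mod 2 ^ w = N" using N_less by (simp add: N_def)
  moreover have "(4 + 3 * k) mod 2 ^ w = T" using T3(2) by (simp add: T_def)
  then have "(4 + 3 * k mod 2 ^ w) mod 2 ^ w = T" by (simp add: mod_simps)
  ultimately show ?thesis using assms by (simp add: build_com_def)
qed

theorem build_com_correct:
  assumes n: "0 < n" and sym: "\<And>x y. A x y \<Longrightarrow> A y x" and m: "m 0 = n" "m 1 = k"
    and inp: "\<And>x y. x < n \<Longrightarrow> y < n \<Longrightarrow> m (2 + x * n + y) = (if A x y then 1 else 0)"
    and m': "m' = cv w [0] build_com m"
  shows "\<exists>par adj num. tree_layout w n k N T par adj \<and> bij_betw num {..<n} {1..n} \<and>
    (\<forall>x<n. \<forall>y<n. adj (num x) (num y) \<longleftrightarrow> A x y) \<and> m' 0 = N \<and> m' 1 = T * N * N \<and>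
    (\<forall>x<n. m' (tab N 0 1 x) = num x) \<and>
    tree_layout.child_mem N par m' \<and> tree_layout.edges_mem N par adj m' \<and>
    tree_layout.low_mem k N par adj m' \<and> tree_layout.pred_mem k N par adj m' \<and>
    tree_layout.prefix_mem k N par adj m'"
proof -
  define m1 where "m1 = cv w [0, n, k, N, T] number_com m"
  have I: "dfs_inv A n m1"
    unfolding m1_def number_com_def by (rule dfs_com_correct[of A, OF n sym inp])
  then obtain ord num par where D: "dfs_numbering n A n ord num par"
    and O: "\<forall>a. 0 < a \<longrightarrow> a \<le> n \<longrightarrow> m1 (tab N (Suc T) 0 a) = ord a"
      "\<forall>a\<le>n. m1 (tab N (Suc (Suc T)) 0 a) = par a" "\<forall>x<n. m1 (tab N 0 1 x) = num x"
    unfolding dfs_inv_def by (elim conjE exE) (rule that; assumption)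
  let ?adj = "\<lambda>a b. 0 < a \<and> a \<le> n \<and> 0 < b \<and> b \<le> n \<and> A (ord a) (ord b)"
  note fin = dfs_numbering_final[OF D sym]
  have "dfs_tree N par ?adj" using fin(1) by (simp add: N_def)
  then interpret t: tree_layout w n k N T par ?adj
    by (intro tree_layout.intro) (rule layout_axioms)
  have par: "t.par_mem m1" using O(2) unfolding t.par_mem_def by (simp add: N_def)
  have adj: "t.adj_mem m1" unfolding t.adj_mem_def
  proof (intro allI impI)
    fix p q assume pq: "0 < p" "p < N" "0 < q" "q < N"
    then have pqn: "p \<le> n" "q \<le> n" by (simp_all add: N_def)
    have o: "ord p < n" "ord q < n" using dfs_numberingD(1)[OF D] pq pqn by simp_all
    have "m1 (tab N T (ord p) (ord q)) = (if A (ord p) (ord q) then 1 else 0)"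
      using conjunct1[OF I[unfolded dfs_inv_def]] o by simp
    then show "m1 (tab N (Suc T) 0 p) < N \<and>
       m1 (tab N T (m1 (tab N (Suc T) 0 p)) (m1 (tab N (Suc T) 0 q))) = (if ?adj p q then 1 else 0)"
      using O(1) pq pqn o by (simp add: N_def)
  qed
  have "m' = cv w [0, n, k, N, T] tables_com m1" unfolding m' build_com_cv[OF m] m1_def ..
  note r = t.tables_com_correct[OF n par adj this]
  have num: "0 < num x \<and> num x \<le> n" if "x < n" for x
    using bij_betw_apply[OF fin(2), of x] that by (simp add: Suc_le_eq)
  have "?adj (num x) (num y) \<longleftrightarrow> A x y" if "x < n" "y < n" for x y
    using num[OF that(1)] num[OF that(2)] fin(3) that by simp
  moreover have "m' (tab N 0 1 x) = num x" if "x < n" for x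
    using r(3)[of x] O(3) that by (simp add: N_def)
  ultimately show ?thesis
    using t.tree_layout_axioms fin(2) r(1,2,4-8)
    by (intro exI[of _ par] exI[of _ ?adj] exI[of _ num] conjI allI impI) simp_all
qed

end

section \<open>Queries\<close>

text \<open>Subtractions in a query may wrap around, so intermediate words are only congruent to the
  intended integers. The operations respect congruence, and \<open>cg_eq_0_iff\<close> regains
  exactness at the end.\<close>

definition cg :: "nat \<Rightarrow> nat \<Rightarrow> int \<Rightarrow> bool" where
  "cg w a v \<longleftrightarrow> int a mod 2 ^ w = v mod 2 ^ w"

lemma cg_int: "cg w a (int a)"
  by (simp add: cg_def)

lemma cg_Add: "cg w a x \<Longrightarrow> cg w b y \<Longrightarrow> cg w (eval_binop w Add a b) (x + y)"
  unfolding cg_def by (simp add: zmod_int) (metis mod_add_cong)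

lemma cg_Sub: "cg w a x \<Longrightarrow> cg w b y \<Longrightarrow> cg w (eval_binop w Sub a b) (x - y)"
  unfolding cg_def by (simp) (metis mod_diff_cong)

lemma cg_fold:
  assumes "cg w a v" "\<And>i x v. i < n \<Longrightarrow> cg w x v \<Longrightarrow> cg w (g x i) (v + f i)"
  shows "cg w (foldl g a [0..<n]) (v + sum f {..<n})"
proof -
  have "cg w (foldl g a [0..<n]) (v + sum f {..<n})"
    by (rule foldl_upt_inv[where I = "\<lambda>i x. cg w x (v + sum f {..<i})"])
       (use assms in \<open>simp_all add: add.assoc[symmetric]\<close>)
  then show ?thesis .
qed

lemma cg_eq_0_iff:
  assumes "cg w a v" "a < 2 ^ w" "0 \<le> v" "v < 2 ^ w" shows "a = 0 \<longleftrightarrow> v = 0"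
proof -
  have "int a < 2 ^ w" using assms(2) by (metis of_nat_less_iff of_nat_numeral of_nat_power)
  then have "int a = v" using assms by (simp add: cg_def)
  then show ?thesis by auto
qed

text \<open>The four arrays over the items, whose addresses are in variables 4 to 7: numbers, tops,
  guards and labels.\<close>

definition "it e = Ld (Op Add (Var 4) e)"
definition "rt e = Ld (Op Add (Var 5) e)"
definition "gd e = Ld (Op Add (Var 6) e)"
definition "lb e = Ld (Op Add (Var 7) e)"

text \<open>Evaluates \<open>comp_sum\<close> for the piece of item \<open>y\<close> on a table row:
  the entry at the top minus the entries at the failed vertices with that top. The address of the
  row is computed once and bound to variable \<open>d\<close>.\<close>

definition dot :: "nat \<Rightarrow> expr \<Rightarrow> nat \<Rightarrow> expr" where
  "dot d row y = LetE row (Op Sub (Ld (Op Add (Var d) (rt (Var y))))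
     (Fold 1 (Num 0) (Op Add (Var (d + 1))
       (IfEq (rt (Var (d + 2))) (rt (Var y)) (Ld (Op Add (Var d) (it (Var (d + 2))))) (Num 0)))))"

definition edge_row :: "expr \<Rightarrow> expr" where
  "edge_row a = addr (Num 2) a (Num 0)"

definition prefix_row :: "expr \<Rightarrow> expr \<Rightarrow> expr \<Rightarrow> expr" where
  "prefix_row j f x = addr (t_level 6 j) (rd (t_level 5 j) f x) (Num 0)"

definition link1_expr :: expr where
  "link1_expr = Op Sub (dot 10 (edge_row (rt (Var 8))) 9)
     (Fold 1 (Num 0) (Op Add (Var 10)
       (IfEq (rt (Var 11)) (rt (Var 8)) (dot 12 (edge_row (it (Var 11))) 9) (Num 0))))"

text \<open>Several failed vertices may share a top, but a child with failures is to be subtracted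
  once. Only the first failed item with a given top counts, and for it the value is 0.\<close>

definition first_expr :: expr where
  "first_expr = Fold 1 (Num 0)
     (IfLess (Var 17) (Var 15) (IfEq (rt (Var 17)) (rt (Var 15)) (Num 1) (Var 16)) (Var 16))"

definition blocked_expr :: expr where
  "blocked_expr = Fold 1 (Num 0) (Op Add (Var 14)
     (IfEq (gd (Var 15)) (it (Var 11))
       (IfEq first_expr (Num 0)
         (IfLess (gd (Var 8)) (rd (t_level 4 (Var 13)) (rt (Var 15)) (Num 0))
           (IfLess (rd (t_level 4 (Var 13)) (rt (Var 15)) (Num 0)) (it (Var 8))
             (dot 16 (edge_row (rt (Var 15))) 9) (Num 0)) (Num 0)) (Num 0)) (Num 0)))"

definition link2_expr :: expr where
  "link2_expr = Op Sub (Op Sub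
     (dot 14 (prefix_row (Var 13) (it (Var 11)) (Op Sub (it (Var 8)) (Num 1))) 9)
     (dot 14 (prefix_row (Var 13) (it (Var 11)) (gd (Var 8))) 9)) blocked_expr"

definition link_expr :: expr where
  "link_expr = Op Add link1_expr (Fold 1 (Num 0) (Op Add (Var 10)
     (IfEq (anc_expr (it (Var 8)) (it (Var 11))) (Num 1)
       (Fold 1 (Num 0) (Op Add (Var 12) link2_expr)) (Num 0))))"

lemma sum_first_occurrences:
  fixes h :: "nat \<Rightarrow> 'b" and F :: "'b \<Rightarrow> int"
  shows "(\<Sum>g<s. if Q (h g) \<and> (\<forall>g'<g. h g' \<noteq> h g) then F (h g) else 0) = (\<Sum>c\<in>{c \<in> h ` {..<s}. Q c}. F c)"
proof (induction s)
  case (Suc s)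
  have 1: "h ` {..<Suc s} = insert (h s) (h ` {..<s})" by (auto simp: lessThan_Suc)
  show ?case
  proof (cases "Q (h s) \<and> (\<forall>g'<s. h g' \<noteq> h s)")
    case True
    then have 2: "{c \<in> h ` {..<Suc s}. Q c} = insert (h s) {c \<in> h ` {..<s}. Q c}" unfolding 1 by auto
    have "h s \<notin> {c \<in> h ` {..<s}. Q c}" using True by auto
    then show ?thesis unfolding 2 using Suc True by simp
  next
    case False
    then have "\<not> Q (h s) \<or> h s \<in> h ` {..<s}" by (metis imageI lessThan_iff)
    then have 2: "{c \<in> h ` {..<Suc s}. Q c} = {c \<in> h ` {..<s}. Q c}" unfolding 1 by blast
    show ?thesis unfolding 2 sum.lessThan_Suc if_not_P[OF False] using Suc by simp
  qed
qed simp

text \<open>The \<open>M = s + 2\<close> items are the failed vertices followed by \<open>u\<close>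
  and \<open>v\<close>, so loops of length \<open>s\<close> see the failures only. The query
  occupies \<open>3 + s\<close> cells at \<open>A\<close>, directly behind the data, and is followed
  by four arrays of length \<open>M\<close>. By \<open>inj_zs\<close>, sums over \<open>S\<close>
  are sums over indices.\<close>

locale query_layout = tree_layout w n k N T par adj + failures N par adj S
  for w n k N T par adj S +
  fixes s :: nat and zs :: "nat \<Rightarrow> nat" and A M Z R U Y :: nat
  assumes S_zs: "S = zs ` {..<s}" and inj_zs: "inj_on zs {..<s}" and s_le: "s \<le> k"
    and M_def: "M = s + 2" and zs_range: "\<And>i. i < M \<Longrightarrow> 0 < zs i \<and> zs i < N"
    and A_def: "A = T * N * N" and Z_def: "Z = A + 3 + s" and R_def: "R = Z + M" and U_def: "U = R + M"
    and Y_def: "Y = U + M" and Y_less: "Y + M \<le> 2 ^ w"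
    and link_less: "N * N + s * (s * (N * (N * N))) < 2 ^ w"
begin

definition data_mem :: "(nat \<Rightarrow> nat) \<Rightarrow> bool" where
  "data_mem m \<longleftrightarrow> child_mem m \<and> edges_mem m \<and> low_mem m \<and> pred_mem m \<and> prefix_mem m"

definition arr :: "nat \<Rightarrow> (nat \<Rightarrow> nat) \<Rightarrow> (nat \<Rightarrow> nat) \<Rightarrow> bool" where
  "arr b f m \<longleftrightarrow> (\<forall>i<M. m (b + i) = f i)"

definition qmem :: "(nat \<Rightarrow> nat) \<Rightarrow> bool" where
  "qmem m \<longleftrightarrow> data_mem m \<and> arr Z zs m \<and> arr R (\<lambda>i. root (zs i)) m \<and> arr U (\<lambda>i. guard (zs i)) m"

definition qenv :: "nat list \<Rightarrow> bool" where
  "qenv \<rho> \<longleftrightarrow> 8 \<le> length \<rho> \<and> \<rho> ! 1 = s \<and> \<rho> ! 3 = N \<and> \<rho> ! 4 = Z \<and> \<rho> ! 5 = R \<and> \<rho> ! 6 = U \<and> \<rho> ! 7 = Y"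

lemma card_S: "card S = s"
  using card_image[OF inj_zs] S_zs by simp

lemma qenv_base [simp]: "qenv (a # s # b # N # Z # R # U # Y # \<sigma>)"
  by (simp add: qenv_def)

lemma qenv_append: "qenv \<rho> \<Longrightarrow> qenv (\<rho> @ \<sigma>)"
  by (auto simp: qenv_def nth_append)

lemma zs_root: "i < M \<Longrightarrow> 0 < root (zs i) \<and> root (zs i) < N"
  using root_props(1,4)[of "zs i"] zs_range[of i] by simp

lemma zs_guard: "i < M \<Longrightarrow> guard (zs i) < zs i"
  using root_props(7)[of "zs i"] zs_range[of i] by simp

lemma arr_less: "i < M \<Longrightarrow> Z + i < 2 ^ w" "i < M \<Longrightarrow> R + i < 2 ^ w" "i < M \<Longrightarrow> U + i < 2 ^ w" "i < M \<Longrightarrow> Y + i < 2 ^ w"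
  using Y_less by (simp_all add: R_def U_def Y_def)

lemma ev_arr:
  assumes "qenv \<rho>" "qmem m" "ev w m \<rho> e < M"
  shows "ev w m \<rho> (it e) = zs (ev w m \<rho> e)" "ev w m \<rho> (rt e) = root (zs (ev w m \<rho> e))"
    "ev w m \<rho> (gd e) = guard (zs (ev w m \<rho> e))"
  using assms arr_less[OF assms(3)]
  by (simp_all add: it_def rt_def gd_def qenv_def qmem_def arr_def)

lemma sum_S: "(\<Sum>g\<in>{g \<in> S. P g}. F g) = (\<Sum>i<s. if P (zs i) then F (zs i) else 0)"
proof -
  have "(\<Sum>g\<in>{g \<in> S. P g}. F g) = (\<Sum>g\<in>S. if P g then F g else 0)"
    by (rule sum.inter_filter) simp
  also have "\<dots> = (\<Sum>i<s. if P (zs i) then F (zs i) else 0)"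
    unfolding S_zs by (subst sum.reindex[OF inj_zs]) simp
  finally show ?thesis .
qed

lemma ev_dot:
  assumes \<rho>: "qenv \<rho>" "length \<rho> = d" "y < d" "\<rho> ! y < M" and m: "qmem m"
    and row: "ev w m \<rho> row = b" "b + N \<le> 2 ^ w"
  shows "cg w (ev w m \<rho> (dot d row y)) (comp_sum (\<lambda>i. int (m (b + i))) (zs (\<rho> ! y)))"
proof -
  let ?y = "\<rho> ! y"
  let ?\<rho> = "\<rho> @ [b]"
  have q: "qenv ?\<rho>" "?\<rho> ! y = ?y" using \<rho> qenv_append by (simp_all add: nth_append)
  have r: "ev w m ?\<rho> (rt (Var y)) = root (zs ?y)" using ev_arr(2)[OF q(1) m, of "Var y"] q \<rho> by simp
  have b: "?\<rho> ! d = b" using \<rho> by (simp add: nth_append)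
  have rN: "b + root (zs ?y) < 2 ^ w" using zs_root[OF \<rho>(4)] row(2) by linarith
  have 1: "ev w m ?\<rho> (Ld (Op Add (Var d) (rt (Var y)))) = m (b + root (zs ?y))"
    using b r rN by simp
  let ?e = "Op Add (Var (d + 1)) (IfEq (rt (Var (d + 2))) (rt (Var y)) (Ld (Op Add (Var d) (it (Var (d + 2))))) (Num 0))"
  let ?f = "\<lambda>g. if root (zs g) = root (zs ?y) then int (m (b + zs g)) else 0"
  have "cg w (foldl (\<lambda>x g. ev w m (?\<rho> @ [x, g]) ?e) 0 [0..<s]) (0 + sum ?f {..<s})"
  proof (rule cg_fold)
    show "cg w 0 0" by (simp add: cg_def)
    fix g x v assume g: "g < s" and x: "cg w x v"
    let ?\<rho>' = "\<rho> @ [b, x, g]"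
    have q': "qenv ?\<rho>'" "?\<rho>' ! y = ?y" "?\<rho>' ! d = b" "?\<rho>' ! (d + 1) = x" "?\<rho>' ! (d + 2) = g"
      using \<rho> qenv_append by (simp_all add: nth_append)
    have gM: "g < M" using g M_def by simp
    have e: "ev w m ?\<rho>' (rt (Var (d + 2))) = root (zs g)" "ev w m ?\<rho>' (it (Var (d + 2))) = zs g"
      "ev w m ?\<rho>' (rt (Var y)) = root (zs ?y)"
      using ev_arr[OF q'(1) m, of "Var (d + 2)"] ev_arr[OF q'(1) m, of "Var y"] q' gM \<rho>(4) by simp_all
    have "b + zs g < 2 ^ w" using zs_range[OF gM] row(2) by linarith
    then have "ev w m ?\<rho>' (IfEq (rt (Var (d + 2))) (rt (Var y)) (Ld (Op Add (Var d) (it (Var (d + 2))))) (Num 0))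
        = (if root (zs g) = root (zs ?y) then m (b + zs g) else 0)"
      using e q'(3) by simp
    then have "cg w (ev w m ?\<rho>' (IfEq (rt (Var (d + 2))) (rt (Var y)) (Ld (Op Add (Var d) (it (Var (d + 2))))) (Num 0))) (?f g)"
      by (simp add: cg_def)
    from cg_Add[OF x this] show "cg w (ev w m (?\<rho> @ [x, g]) ?e) (v + ?f g)" using q'(4) by simp
  qed
  then have 2: "cg w (ev w m ?\<rho> (Fold 1 (Num 0) ?e)) (sum ?f {..<s})"
    using q(1) unfolding ev.simps(8) ev.simps(2) qenv_def by simp
  have "cg w (ev w m \<rho> (dot d row y)) (int (m (b + root (zs ?y))) - sum ?f {..<s})"
    unfolding dot_def ev.simps(7) row(1) ev.simps(3) 1 by (rule cg_Sub[OF cg_int 2])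
  then show ?thesis by (simp add: comp_sum_def sum_S)
qed

lemma sum_S': "(\<Sum>g\<in>S. F g) = (\<Sum>i<s. F (zs i))"
  unfolding S_zs by (subst sum.reindex[OF inj_zs]) simp

lemma row_le: "t \<le> Suc (Suc T) \<Longrightarrow> i < N \<Longrightarrow> tab N t i 0 + N \<le> 2 ^ w"
  using tab_less[of t i "N - 1"] N_pos by (simp add: tab_def)

lemma tab_row: "tab N t i 0 + j = tab N t i j"
  by (simp add: tab_def)

lemma ev_dot_edges:
  assumes \<rho>: "qenv \<rho>" "length \<rho> = d" "y < d" "\<rho> ! y < M" and m: "qmem m"
    and e: "ev w m \<rho> e = a" "a < N"
  shows "cg w (ev w m \<rho> (dot d (edge_row e) y)) (comp_sum (\<lambda>b. int (subtree_edges a b)) (zs (\<rho> ! y)))"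
proof -
  have 3: "\<rho> ! 3 = N" using \<rho>(1) by (simp add: qenv_def)
  have r: "ev w m \<rho> (edge_row e) = tab N 2 a 0"
    unfolding edge_row_def by (subst ev_rd_N(1)[OF 3]) (use e N_pos T4 in simp_all)
  have "tab N 2 a 0 + N \<le> 2 ^ w" by (rule row_le) (use e T4 in simp_all)
  from ev_dot[OF \<rho> m r this]
  have 1: "cg w (ev w m \<rho> (dot d (edge_row e) y)) (comp_sum (\<lambda>i. int (m (tab N 2 a i))) (zs (\<rho> ! y)))"
    by (simp only: tab_row)
  have "comp_sum (\<lambda>i. int (m (tab N 2 a i))) (zs (\<rho> ! y)) = comp_sum (\<lambda>b. int (subtree_edges a b)) (zs (\<rho> ! y))"
    by (rule comp_sum_cong)
       (use zs_range[OF \<rho>(4)] m e(2) in \<open>simp_all add: qmem_def data_mem_def edges_mem_def\<close>)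
  with 1 show ?thesis by simp
qed

text \<open>The predecessors that happen to be stored; all further reasoning uses only that they are
  a valid choice.\<close>

definition pr_of :: "(nat \<Rightarrow> nat) \<Rightarrow> nat \<Rightarrow> nat \<Rightarrow> nat \<Rightarrow> nat" where
  "pr_of m j f x = m (tab N (5 + 3 * j) f x)"

lemma good_pred_pr_of: "qmem m \<Longrightarrow> good_pred (pr_of m) s"
  using s_le by (simp add: good_pred_def pr_of_def qmem_def data_mem_def pred_mem_def)

lemma ev_dot_prefix:
  assumes \<rho>: "qenv \<rho>" "length \<rho> = d" "y < d" "\<rho> ! y < M" and m: "qmem m"
    and e: "ev w m \<rho> je = j" "j < s" "ev w m \<rho> fe = f" "f < N" "ev w m \<rho> xe = x" "x < N"
  shows "cg w (ev w m \<rho> (dot d (prefix_row je fe xe) y))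
    (comp_sum (\<lambda>b. int (low_prefix j (pr_of m j f x) b)) (zs (\<rho> ! y)))"
proof -
  have 3: "\<rho> ! 3 = N" using \<rho>(1) by (simp add: qenv_def)
  have jk: "j < k" using e(2) s_le by simp
  have l: "ev w m \<rho> (t_level 6 je) = 6 + 3 * j" "ev w m \<rho> (t_level 5 je) = 5 + 3 * j"
    using ev_level[of m \<rho> je 6] ev_level[of m \<rho> je 5] e(1) jk by simp_all
  have le: "6 + 3 * j \<le> Suc (Suc T)" "5 + 3 * j \<le> Suc (Suc T)" using jk by (simp_all add: T_def)
  let ?p = "pr_of m j f x"
  have p: "ev w m \<rho> (rd (t_level 5 je) fe xe) = ?p"
    unfolding pr_of_def by (subst ev_rd_N(2)[OF 3]) (use e l le in simp_all)
  have pN: "?p < N"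
    using good_pred_pr_of[OF m] e(2,4,6) unfolding good_pred_def is_pred_def by blast
  have r: "ev w m \<rho> (prefix_row je fe xe) = tab N (6 + 3 * j) ?p 0"
    unfolding prefix_row_def by (subst ev_rd_N(1)[OF 3]) (use p pN l le N_pos in simp_all)
  have "tab N (6 + 3 * j) ?p 0 + N \<le> 2 ^ w" by (rule row_le[OF le(1) pN])
  from ev_dot[OF \<rho> m r this]
  have 1: "cg w (ev w m \<rho> (dot d (prefix_row je fe xe) y))
      (comp_sum (\<lambda>i. int (m (tab N (6 + 3 * j) ?p i))) (zs (\<rho> ! y)))"
    by (simp only: tab_row)
  have pm: "m (tab N (6 + 3 * j) ?p b) = low_prefix j ?p b" if "b < N" for b
    using m that jk pN by (simp add: qmem_def data_mem_def prefix_mem_def)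
  have "comp_sum (\<lambda>i. int (m (tab N (6 + 3 * j) ?p i))) (zs (\<rho> ! y))
      = comp_sum (\<lambda>b. int (low_prefix j ?p b)) (zs (\<rho> ! y))"
    by (rule comp_sum_cong) (use zs_range[OF \<rho>(4)] pm in simp_all)
  with 1 show ?thesis by simp
qed

lemma ev_link1:
  assumes xy: "x < M" "y < M" and m: "qmem m"
  shows "cg w (ev w m [a, s, b, N, Z, R, U, Y, x, y] link1_expr) (link1 (zs x) (zs y))"
proof -
  let ?\<rho> = "[a, s, b, N, Z, R, U, Y, x, y]"
  let ?G = "\<lambda>c. comp_sum (\<lambda>b. int (subtree_edges c b)) (zs y)"
  let ?e = "Op Add (Var 10) (IfEq (rt (Var 11)) (rt (Var 8)) (dot 12 (edge_row (it (Var 11))) 9) (Num 0))"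
  let ?f = "\<lambda>g. if root (zs g) = root (zs x) then ?G (zs g) else 0"
  have 1: "cg w (ev w m ?\<rho> (dot 10 (edge_row (rt (Var 8))) 9)) (?G (root (zs x)))"
    using ev_dot_edges[of ?\<rho> 10 9 m "rt (Var 8)" "root (zs x)"] ev_arr(2)[of ?\<rho> m "Var 8"] xy m zs_root[OF xy(1)]
    by simp
  have "cg w (foldl (\<lambda>u g. ev w m (?\<rho> @ [u, g]) ?e) 0 [0..<s]) (0 + sum ?f {..<s})"
  proof (rule cg_fold)
    show "cg w 0 0" by (simp add: cg_def)
    fix g u v assume g: "g < s" and u: "cg w u v"
    let ?\<rho>' = "[a, s, b, N, Z, R, U, Y, x, y, u, g]"
    have gM: "g < M" using g M_def by simp
    have e: "ev w m ?\<rho>' (rt (Var 11)) = root (zs g)" "ev w m ?\<rho>' (rt (Var 8)) = root (zs x)"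
      "ev w m ?\<rho>' (it (Var 11)) = zs g"
      using ev_arr[of ?\<rho>' m "Var 11"] ev_arr[of ?\<rho>' m "Var 8"] gM xy m by simp_all
    have d: "cg w (ev w m ?\<rho>' (dot 12 (edge_row (it (Var 11))) 9)) (?G (zs g))"
      using ev_dot_edges[of ?\<rho>' 12 9 m "it (Var 11)" "zs g"] e(3) xy m zs_range[OF gM] by simp
    have "cg w (ev w m ?\<rho>' (IfEq (rt (Var 11)) (rt (Var 8)) (dot 12 (edge_row (it (Var 11))) 9) (Num 0))) (?f g)"
      using d e by (simp add: cg_def)
    from cg_Add[OF u this] show "cg w (ev w m (?\<rho> @ [u, g]) ?e) (v + ?f g)" by simp
  qed
  then have 2: "cg w (ev w m ?\<rho> (Fold 1 (Num 0) ?e)) (sum ?f {..<s})" unfolding ev.simps(8) by simp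
  have "cg w (ev w m ?\<rho> link1_expr) (?G (root (zs x)) - sum ?f {..<s})"
    unfolding link1_expr_def ev.simps(3) by (rule cg_Sub[OF 1 2])
  then show ?thesis by (simp add: link1_def comp_sum_def[of _ "zs x"] sum_S)
qed

lemma ev_blocked:
  assumes xy: "x < M" "y < M" and f: "f < s" and j: "j < s" and m: "qmem m"
  shows "cg w (ev w m [a, s, b, N, Z, R, U, Y, x, y, u1, f, u2, j] blocked_expr)
    (\<Sum>c\<in>{c \<in> root ` {g \<in> S. guard g = zs f}. guard (zs x) < low j c \<and> low j c < zs x}.
       comp_sum (\<lambda>b. int (subtree_edges c b)) (zs y))"
proof -
  let ?\<rho> = "[a, s, b, N, Z, R, U, Y, x, y, u1, f, u2, j]"
  let ?G = "\<lambda>c. comp_sum (\<lambda>b. int (subtree_edges c b)) (zs y)"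
  let ?e = "Op Add (Var 14) (IfEq (gd (Var 15)) (it (Var 11))
       (IfEq first_expr (Num 0)
         (IfLess (gd (Var 8)) (rd (t_level 4 (Var 13)) (rt (Var 15)) (Num 0))
           (IfLess (rd (t_level 4 (Var 13)) (rt (Var 15)) (Num 0)) (it (Var 8))
             (dot 16 (edge_row (rt (Var 15))) 9) (Num 0)) (Num 0)) (Num 0)) (Num 0))"
  let ?h = "\<lambda>g. root (zs g)"
  \<comment> \<open>\<open>guard\<close> is the parent of the top, so the whole condition depends on
    the top alone and \<open>sum_first_occurrences\<close> applies.\<close>
  let ?Q = "\<lambda>c. par c = zs f \<and> guard (zs x) < low j c \<and> low j c < zs x"
  let ?f = "\<lambda>g. if ?Q (?h g) \<and> (\<forall>g'<g. ?h g' \<noteq> ?h g) then ?G (?h g) else 0"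
  have "cg w (foldl (\<lambda>u g. ev w m (?\<rho> @ [u, g]) ?e) 0 [0..<s]) (0 + sum ?f {..<s})"
  proof (rule cg_fold)
    show "cg w 0 0" by (simp add: cg_def)
    fix g u v assume g: "g < s" and u: "cg w u v"
    let ?\<rho>' = "[a, s, b, N, Z, R, U, Y, x, y, u1, f, u2, j, u, g]"
    have gM: "g < M" "f < M" using g f M_def by simp_all
    have e: "ev w m ?\<rho>' (gd (Var 15)) = guard (zs g)" "ev w m ?\<rho>' (it (Var 11)) = zs f"
      "ev w m ?\<rho>' (gd (Var 8)) = guard (zs x)" "ev w m ?\<rho>' (it (Var 8)) = zs x"
      "ev w m ?\<rho>' (rt (Var 15)) = root (zs g)"
      using ev_arr[of ?\<rho>' m "Var 15"] ev_arr[of ?\<rho>' m "Var 8"] ev_arr[of ?\<rho>' m "Var 11"] gM xy m by simp_all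
    have jk: "j < k" using j s_le by simp
    have "ev w m ?\<rho>' (t_level 4 (Var 13)) = 4 + 3 * j" using ev_level[of m ?\<rho>' "Var 13" 4] jk by simp
    moreover have "4 + 3 * j \<le> Suc (Suc T)" using jk by (simp add: T_def)
    moreover have "m (tab N (4 + 3 * j) (root (zs g)) 0) = low j (root (zs g))"
      using m jk zs_root[OF gM(1)] N_pos by (simp add: qmem_def data_mem_def low_mem_def)
    ultimately have l: "ev w m ?\<rho>' (rd (t_level 4 (Var 13)) (rt (Var 15)) (Num 0)) = low j (root (zs g))"
      using ev_rd_N(2)[of ?\<rho>' m "t_level 4 (Var 13)" "rt (Var 15)" "Num 0"] e(5) zs_root[OF gM(1)] N_pos by simp
    let ?r = "IfLess (Var 17) (Var 15) (IfEq (rt (Var 17)) (rt (Var 15)) (Num 1) (Var 16)) (Var 16)"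
    have "foldl (\<lambda>t h. ev w m (?\<rho>' @ [t, h]) ?r) 0 [0..<s]
        = (if \<exists>h<s. h < g \<and> ?h h = ?h g then (\<lambda>_. 1) (Max {h. h < s \<and> h < g \<and> ?h h = ?h g}) else 0)"
    proof (rule foldl_last)
      fix h t assume h: "h < s"
      let ?\<rho>'' = "[a, s, b, N, Z, R, U, Y, x, y, u1, f, u2, j, u, g, t, h]"
      have hM: "h < M" using h M_def by simp
      have "ev w m ?\<rho>'' (rt (Var 17)) = ?h h" "ev w m ?\<rho>'' (rt (Var 15)) = ?h g"
        using ev_arr(2)[of ?\<rho>'' m "Var 17"] ev_arr(2)[of ?\<rho>'' m "Var 15"] gM hM m by simp_all
      then show "ev w m (?\<rho>' @ [t, h]) ?r = (if h < g \<and> ?h h = ?h g then 1 else t)" by simp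
    qed
    moreover have "(\<exists>h<s. h < g \<and> ?h h = ?h g) \<longleftrightarrow> \<not> (\<forall>g'<g. ?h g' \<noteq> ?h g)"
      using less_trans[OF _ g] by blast
    moreover have "ev w m ?\<rho>' first_expr = foldl (\<lambda>t h. ev w m (?\<rho>' @ [t, h]) ?r) 0 [0..<s]"
      unfolding first_expr_def ev.simps(8) by simp
    ultimately have fst: "ev w m ?\<rho>' first_expr = (if \<forall>g'<g. ?h g' \<noteq> ?h g then 0 else 1)" by simp
    have d: "cg w (ev w m ?\<rho>' (dot 16 (edge_row (rt (Var 15))) 9)) (?G (?h g))"
      using ev_dot_edges[of ?\<rho>' 16 9 m "rt (Var 15)" "root (zs g)"] e(5) xy m zs_root[OF gM(1)] by simp
    have z: "cg w 0 0" by (simp add: cg_def)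
    have n0: "ev w m \<rho> (Num 0) = 0" for \<rho> by simp
    have "cg w (ev w m ?\<rho>' (IfEq (gd (Var 15)) (it (Var 11))
       (IfEq first_expr (Num 0)
         (IfLess (gd (Var 8)) (rd (t_level 4 (Var 13)) (rt (Var 15)) (Num 0))
           (IfLess (rd (t_level 4 (Var 13)) (rt (Var 15)) (Num 0)) (it (Var 8))
             (dot 16 (edge_row (rt (Var 15))) 9) (Num 0)) (Num 0)) (Num 0)) (Num 0))) (?f g)"
      unfolding ev.simps(5,6) e l fst n0 using d z by (auto simp del: ev.simps)
    from cg_Add[OF u this] show "cg w (ev w m (?\<rho> @ [u, g]) ?e) (v + ?f g)" by simp
  qed
  then have 1: "cg w (ev w m ?\<rho> blocked_expr) (sum ?f {..<s})"
    unfolding blocked_expr_def ev.simps(8) by simp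
  have "{c \<in> root ` {g \<in> S. guard g = zs f}. guard (zs x) < low j c \<and> low j c < zs x}
      = {c \<in> ?h ` {..<s}. ?Q c}"
    unfolding S_zs by auto
  with 1 show ?thesis using sum_first_occurrences[of ?Q ?h ?G s] by simp
qed

lemma sub_exact: "y \<le> x \<Longrightarrow> x < 2 ^ w' \<Longrightarrow> eval_binop w' Sub x y = x - y"
proof -
  assume *: "y \<le> x" "x < 2 ^ w'"
  have "int (x - y) < 2 ^ w'" using *(2) by (metis less_imp_diff_less of_nat_less_iff of_nat_numeral of_nat_power)
  then have "(int x - int y) mod 2 ^ w' = int (x - y)" using *(1) by (simp add: of_nat_diff)
  then show ?thesis by simp
qed

lemma ev_link2:
  assumes xy: "x < M" "y < M" and f: "f < s" and j: "j < s" and m: "qmem m"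
  shows "cg w (ev w m [a, s, b, N, Z, R, U, Y, x, y, u1, f, u2, j] link2_expr)
    (link2 (pr_of m) (zs f) j (zs x) (zs y))"
proof -
  let ?\<rho> = "[a, s, b, N, Z, R, U, Y, x, y, u1, f, u2, j]"
  have fM: "f < M" using f M_def by simp
  have e: "ev w m ?\<rho> (it (Var 11)) = zs f" "ev w m ?\<rho> (it (Var 8)) = zs x" "ev w m ?\<rho> (gd (Var 8)) = guard (zs x)"
    using ev_arr[of ?\<rho> m "Var 11"] ev_arr[of ?\<rho> m "Var 8"] fM xy m by simp_all
  have "ev w m ?\<rho> (Op Sub (it (Var 8)) (Num 1)) = eval_binop w Sub (zs x) 1"
    unfolding ev.simps(3) e by simp
  then have e': "ev w m ?\<rho> (Op Sub (it (Var 8)) (Num 1)) = zs x - 1"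
    using sub_exact[of 1 "zs x" w] zs_range[OF xy(1)] N_less by simp
  have p: "zs x - 1 < N" using zs_range[OF xy(1)] by linarith
  have d1: "cg w (ev w m ?\<rho> (dot 14 (prefix_row (Var 13) (it (Var 11)) (Op Sub (it (Var 8)) (Num 1))) 9))
      (comp_sum (\<lambda>b. int (low_prefix j (pr_of m j (zs f) (zs x - 1)) b)) (zs y))"
    using ev_dot_prefix[of ?\<rho> 14 9 m "Var 13" j "it (Var 11)" "zs f" "Op Sub (it (Var 8)) (Num 1)" "zs x - 1",
        OF _ _ _ _ m _ j e(1) _ e' p] xy zs_range[OF fM] by simp
  have d2: "cg w (ev w m ?\<rho> (dot 14 (prefix_row (Var 13) (it (Var 11)) (gd (Var 8))) 9))
      (comp_sum (\<lambda>b. int (low_prefix j (pr_of m j (zs f) (guard (zs x))) b)) (zs y))"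
    using ev_dot_prefix[of ?\<rho> 14 9 m "Var 13" j "it (Var 11)" "zs f" "gd (Var 8)" "guard (zs x)"]
      xy m j e zs_range[OF fM] zs_range[OF xy(1)] zs_guard[OF xy(1)] by simp
  show ?thesis
    unfolding link2_expr_def link2_def ev.simps(3)
    by (rule cg_Sub[OF cg_Sub[OF d1 d2] ev_blocked[OF xy f j m]])
qed

lemma ev_link:
  assumes xy: "x < M" "y < M" and m: "qmem m"
  shows "ev w m [a, s, b, N, Z, R, U, Y, x, y] link_expr = 0 \<longleftrightarrow> link (pr_of m) s (zs x) (zs y) = 0"
proof -
  let ?\<rho> = "[a, s, b, N, Z, R, U, Y, x, y]"
  let ?in = "Op Add (Var 12) link2_expr"
  let ?e = "Op Add (Var 10) (IfEq (anc_expr (it (Var 8)) (it (Var 11))) (Num 1) (Fold 1 (Num 0) ?in) (Num 0))"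
  let ?L = "\<lambda>f. \<Sum>j<s. link2 (pr_of m) (zs f) j (zs x) (zs y)"
  let ?f = "\<lambda>f. if anc (zs x) (zs f) then ?L f else 0"
  have "cg w (foldl (\<lambda>u f. ev w m (?\<rho> @ [u, f]) ?e) 0 [0..<s]) (0 + sum ?f {..<s})"
  proof (rule cg_fold)
    show "cg w 0 0" by (simp add: cg_def)
    fix f u v assume f: "f < s" and u: "cg w u v"
    let ?\<rho>' = "[a, s, b, N, Z, R, U, Y, x, y, u, f]"
    have fM: "f < M" using f M_def by simp
    have e: "ev w m ?\<rho>' (it (Var 8)) = zs x" "ev w m ?\<rho>' (it (Var 11)) = zs f"
      using ev_arr[of ?\<rho>' m "Var 8"] ev_arr[of ?\<rho>' m "Var 11"] fM xy m by simp_all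
    have "child_mem m" using m by (simp add: qmem_def data_mem_def)
    then have anc: "ev w m ?\<rho>' (anc_expr (it (Var 8)) (it (Var 11))) = (if anc (zs x) (zs f) then 1 else 0)"
      using ev_anc_expr_N[of ?\<rho>' m "it (Var 8)" "it (Var 11)"] e zs_range[OF fM] zs_range[OF xy(1)] by simp
    have "cg w (foldl (\<lambda>t j. ev w m (?\<rho>' @ [t, j]) ?in) 0 [0..<s]) (0 + ?L f)"
    proof (rule cg_fold)
      show "cg w 0 0" by (simp add: cg_def)
      fix j t v assume j: "j < s" and t: "cg w t v"
      have "cg w (ev w m [a, s, b, N, Z, R, U, Y, x, y, u, f, t, j] link2_expr)
          (link2 (pr_of m) (zs f) j (zs x) (zs y))"
        by (rule ev_link2[OF xy f j m])
      from cg_Add[OF t this]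
      show "cg w (ev w m (?\<rho>' @ [t, j]) ?in) (v + link2 (pr_of m) (zs f) j (zs x) (zs y))"
        by (simp del: eval_binop.simps)
    qed
    then have "cg w (ev w m ?\<rho>' (Fold 1 (Num 0) ?in)) (?L f)" unfolding ev.simps(8) by simp
    then have "cg w (ev w m ?\<rho>' (IfEq (anc_expr (it (Var 8)) (it (Var 11))) (Num 1) (Fold 1 (Num 0) ?in) (Num 0))) (?f f)"
      unfolding ev.simps(5) anc by (simp add: cg_def)
    from cg_Add[OF u this] show "cg w (ev w m (?\<rho> @ [u, f]) ?e) (v + ?f f)" by simp
  qed
  then have 2: "cg w (ev w m ?\<rho> (Fold 1 (Num 0) ?e)) (sum ?f {..<s})" unfolding ev.simps(8) by simp
  have "cg w (ev w m ?\<rho> link_expr) (link1 (zs x) (zs y) + sum ?f {..<s})"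
    unfolding link_expr_def ev.simps(3) by (rule cg_Add[OF ev_link1[OF xy m] 2])
  moreover have "link (pr_of m) s (zs x) (zs y) = link1 (zs x) (zs y) + sum ?f {..<s}"
    by (simp add: link_def sum_S')
  ultimately have cg: "cg w (ev w m ?\<rho> link_expr) (link (pr_of m) s (zs x) (zs y))" by simp
  have "ev w m ?\<rho> link_expr < 2 ^ w" unfolding link_expr_def ev.simps(3) by (rule eval_binop_less)
  note l = this
  note lb = link_bounds[OF good_pred_pr_of[OF m], of "zs x" "zs y"]
  have "link (pr_of m) s (zs x) (zs y) \<le> int (N * N + s * (s * (N * (N * N))))"
    using lb(2) zs_range[OF xy(1)] zs_range[OF xy(2)] card_S by simp
  also have "\<dots> < int (2 ^ w)" using link_less by (simp only: of_nat_less_iff)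
  finally have u: "link (pr_of m) s (zs x) (zs y) < 2 ^ w" by simp
  have "0 \<le> link (pr_of m) s (zs x) (zs y)"
    using lb(1) zs_range[OF xy(1)] zs_range[OF xy(2)] by simp
  from cg_eq_0_iff[OF cg l this u] show ?thesis .
qed

end

text \<open>Entry \<open>i\<close> is computed during the fill, with the cells from
  \<open>B + i\<close> on still untouched. Relabelling in place relies on this.\<close>

lemma fill_array:
  assumes step: "\<And>i m'. i < \<rho> ! b \<Longrightarrow> same_but (\<lambda>a. B \<le> a \<and> a < B + \<rho> ! b) m m' \<Longrightarrow>
      (\<forall>j. i \<le> j \<longrightarrow> m' (B + j) = m (B + j)) \<Longrightarrow>
      ev w m' (\<rho> @ [i]) ae = B + i \<and> ev w m' (\<rho> @ [i]) e = f i"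
  shows "same_but (\<lambda>a. B \<le> a \<and> a < B + \<rho> ! b) m (cv w \<rho> (For b (St ae e)) m)"
    "\<And>i. i < \<rho> ! b \<Longrightarrow> cv w \<rho> (For b (St ae e)) m (B + i) = f i"
proof -
  let ?X = "\<lambda>a. B \<le> a \<and> a < B + \<rho> ! b"
  let ?I = "\<lambda>i m'. same_but ?X m m' \<and> (\<forall>j. i \<le> j \<longrightarrow> m' (B + j) = m (B + j)) \<and> (\<forall>j<i. m' (B + j) = f j)"
  have "?I (\<rho> ! b) (foldl (\<lambda>m i. cv w (\<rho> @ [i]) (St ae e) m) m [0..<\<rho> ! b])"
  proof (rule foldl_upt_inv[where I = ?I])
    fix i m' assume i: "i < \<rho> ! b" and I: "?I i m'"
    have 1: "ev w m' (\<rho> @ [i]) ae = B + i" "ev w m' (\<rho> @ [i]) e = f i"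
      using step[OF i] I by blast+
    show "?I (Suc i) (cv w (\<rho> @ [i]) (St ae e) m')"
      unfolding cv.simps 1 using I i by (auto simp: same_but_def less_Suc_eq)
  qed (simp add: same_but_refl)
  then show "same_but ?X m (cv w \<rho> (For b (St ae e)) m)"
    "\<And>i. i < \<rho> ! b \<Longrightarrow> cv w \<rho> (For b (St ae e)) m (B + i) = f i" by simp_all
qed

text \<open>Failed vertices are read from behind the query header; for \<open>i = s\<close> and
  \<open>i = s + 1\<close> the address \<open>A + (i - s)\<close> is that of \<open>u\<close> and of
  \<open>v\<close>. Row 1 of table 0 turns them into numbers.\<close>

definition items_com :: com where
  "items_com = For 2 (St (Op Add (Var 4) (Var 8)) (rd (Num 0) (Num 1)
     (IfLess (Var 8) (Var 1) (Ld (Op Add (Op Add (Var 0) (Num 3)) (Var 8)))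
       (Ld (Op Add (Var 0) (Op Sub (Var 8) (Var 1)))))))"

definition guards_com :: com where
  "guards_com = For 2 (St (Op Add (Var 6) (Var 8)) (Fold 1 (Num 0)
     (IfEq (rd (Num 1) (it (Var 10)) (it (Var 8))) (Num 0) (Var 9)
       (IfLess (Var 9) (it (Var 10)) (it (Var 10)) (Var 9)))))"

definition roots_com :: com where
  "roots_com = For 2 (St (Op Add (Var 5) (Var 8)) (rd (Num 1) (gd (Var 8)) (it (Var 8))))"

definition labels_com :: com where
  "labels_com = For 2 (St (Op Add (Var 7) (Var 8)) (rt (Var 8)))"

text \<open>Union in the style of quick-find. The labels of both items are bound before the loop,
  which overwrites the array they come from.\<close>

definition relabel_com :: com where
  "relabel_com = LetC link_expr (LetC (lb (Var 8)) (LetC (lb (Var 9))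
     (For 2 (St (Op Add (Var 7) (Var 13))
       (IfEq (Var 10) (Num 0) (lb (Var 13)) (IfEq (lb (Var 13)) (Var 11) (Var 12) (lb (Var 13))))))))"

text \<open>Failed query vertices need a test of their own: a failed \<open>u\<close> is still an
  item of the piece above it and carries the label of that piece.\<close>

definition answer_com :: com where
  "answer_com = St (Num 0) (IfEq (Fold 1 (Num 0)
       (IfEq (it (Var 9)) (it (Var 1)) (Num 1) (IfEq (it (Var 9)) (it (Op Add (Var 1) (Num 1))) (Num 1) (Var 8))))
     (Num 0) (IfEq (lb (Var 1)) (lb (Op Add (Var 1) (Num 1))) (Num 1) (Num 0)) (Num 0))"

text \<open>The bindings build the environment \<open>[A, s, M, N, Z, R, U, Y]\<close>. Loops run
  over variable 1 or 2, that is, over failures or items, which keeps the time polynomial in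
  \<open>k\<close>.\<close>

definition query_com :: com where
  "query_com = LetC (Ld (Op Add (Var 0) (Num 2))) (LetC (Op Add (Var 1) (Num 2)) (LetC (Ld (Num 0))
     (LetC (Op Add (Op Add (Var 0) (Num 3)) (Var 1)) (LetC (Op Add (Var 4) (Var 2))
     (LetC (Op Add (Var 5) (Var 2)) (LetC (Op Add (Var 6) (Var 2))
     (Seq items_com (Seq guards_com (Seq roots_com (Seq labels_com
     (Seq (For 2 (For 2 relabel_com)) answer_com)))))))))))"

context query_layout
begin

abbreviation "cells B \<equiv> (\<lambda>a. B \<le> a \<and> a < B + M)"

abbreviation "q\<rho> \<equiv> [A, s, M, N, Z, R, U, Y]"

lemma data_mem_below:
  assumes "data_mem m" "\<And>a. a < A \<Longrightarrow> m' a = m a" shows "data_mem m'"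
proof -
  have eq: "m' (tab N t i j) = m (tab N t i j)" if "t < T" "i < N" "j < N" for t i j
  proof -
    have "t \<le> T - 1" "T - 1 + 1 = T" using that(1) by simp_all
    with tab_less_mult[of t "T - 1" i N j] that(2,3) have "tab N t i j < A" by (simp add: A_def)
    then show ?thesis by (rule assms(2))
  qed
  have T: "1 < T" "2 < T" "\<And>j. j < k \<Longrightarrow> 4 + 3 * j < T" "\<And>j. j < k \<Longrightarrow> 5 + 3 * j < T" "\<And>j. j < k \<Longrightarrow> 6 + 3 * j < T"
    by (simp_all add: T_def)
  note d = assms(1)[unfolded data_mem_def]
  have "child_mem m'" using conjunct1[OF d] unfolding child_mem_def by (simp add: eq[OF T(1)[unfolded One_nat_def]])
  moreover have "edges_mem m'"
    using d[THEN conjunct2, THEN conjunct1] unfolding edges_mem_def by (simp add: eq[OF T(2)])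
  moreover have "low_mem m'"
    using d[THEN conjunct2, THEN conjunct2, THEN conjunct1] unfolding low_mem_def by (simp add: eq[OF T(3)])
  moreover have "pred_mem m'"
    using d[THEN conjunct2, THEN conjunct2, THEN conjunct2, THEN conjunct1] unfolding pred_mem_def by (simp add: eq[OF T(4)])
  moreover have "prefix_mem m'"
    using d[THEN conjunct2, THEN conjunct2, THEN conjunct2, THEN conjunct2] unfolding prefix_mem_def by (simp add: eq[OF T(5)])
  ultimately show ?thesis unfolding data_mem_def by blast
qed

lemma data_mem_same: "data_mem m \<Longrightarrow> same_but (cells B) m m' \<Longrightarrow> A \<le> B \<Longrightarrow> data_mem m'"
  by (erule data_mem_below) (simp add: same_but_def)

lemma arr_same: "arr b f m \<Longrightarrow> same_but (cells B) m m' \<Longrightarrow> b + M \<le> B \<or> B + M \<le> b \<Longrightarrow> arr b f m'"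
  by (auto simp: arr_def same_but_def)

lemma ev_it: "qenv \<rho> \<Longrightarrow> arr Z zs m \<Longrightarrow> ev w m \<rho> e < M \<Longrightarrow> ev w m \<rho> (it e) = zs (ev w m \<rho> e)"
  using arr_less(1) by (simp add: it_def qenv_def arr_def)

lemma ev_gd: "qenv \<rho> \<Longrightarrow> arr U f m \<Longrightarrow> ev w m \<rho> e < M \<Longrightarrow> ev w m \<rho> (gd e) = f (ev w m \<rho> e)"
  using arr_less(3) by (simp add: gd_def qenv_def arr_def)

lemma ev_lb: "qenv \<rho> \<Longrightarrow> arr Y f m \<Longrightarrow> ev w m \<rho> e < M \<Longrightarrow> ev w m \<rho> (lb e) = f (ev w m \<rho> e)"
  using arr_less(4) by (simp add: lb_def qenv_def arr_def)

lemma bounds: "A < 2 ^ w" "A + 3 < 2 ^ w" "A + 3 + s < 2 ^ w" "A + 2 < 2 ^ w" "Z + M < 2 ^ w" "R + M < 2 ^ w" "U + M < 2 ^ w"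
    "s + 2 < 2 ^ w" "A + 1 < 2 ^ w" "s + 1 < 2 ^ w"
  using Y_less by (simp_all add: Y_def U_def R_def Z_def M_def)

lemma items_com_correct:
  assumes num: "\<And>x. x < n \<Longrightarrow> m (tab N 0 1 x) = num x"
    and inp: "m A = u" "m (A + 1) = v" "\<And>i. i < s \<Longrightarrow> m (A + 3 + i) = xs i"
    and less: "u < n" "v < n" "\<And>i. i < s \<Longrightarrow> xs i < n"
    and zs: "\<And>i. i < M \<Longrightarrow> zs i = num (if i < s then xs i else if i = s then u else v)"
  defines "m' \<equiv> cv w q\<rho> items_com m"
  shows "same_but (cells Z) m m'" "arr Z zs m'"
proof -
  have step: "ev w m' (q\<rho> @ [i]) (Op Add (Var 4) (Var 8)) = Z + i \<and>
     ev w m' (q\<rho> @ [i]) (rd (Num 0) (Num 1)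
       (IfLess (Var 8) (Var 1) (Ld (Op Add (Op Add (Var 0) (Num 3)) (Var 8)))
         (Ld (Op Add (Var 0) (Op Sub (Var 8) (Var 1)))))) = zs i" (is "_ \<and> ev _ _ ?\<rho> (rd _ _ ?e) = _")
    if i: "i < M" and sm: "same_but (cells Z) m m'" for i m'
  proof -
    have low: "m' a = m a" if "a < Z" for a using sm that by (simp add: same_but_def)
    let ?x = "if i < s then xs i else if i = s then u else v"
    have x: "ev w m' ?\<rho> ?e = ?x"
    proof (cases "i < s")
      case True
      then have "A + 3 + i < 2 ^ w" "A + 3 + i < Z" using bounds by (simp_all add: Z_def)
      then show ?thesis using True inp(3)[OF True] low[of "A + 3 + i"] bounds(2) by (simp add: numeral_3_eq_3)
    next
      case False
      have iM: "i < 2 ^ w" using arr_less(1)[OF i] by simp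
      have sub: "eval_binop w Sub i s = i - s" by (rule sub_exact) (use False iM in simp_all)
      have "ev w m' ?\<rho> ?e = m' ((A + (i - s)) mod 2 ^ w)" using False sub by (simp del: eval_binop.simps(2))
      moreover have "i = s \<or> i = s + 1" using False i M_def by auto
      ultimately show ?thesis using inp(1,2) low[of A] low[of "A + 1"] bounds(1,9) by (auto simp: Z_def)
    qed
    have xn: "?x < n" using less by simp
    then have xN: "?x < N" by (simp add: N_def)
    have "ev w m' ?\<rho> (rd (Num 0) (Num 1) ?e) = m' (tab N 0 1 ?x)"
      using ev_rd_N(2)[of ?\<rho> m' "Num 0" "Num 1" ?e] x xN xn by (simp add: N_def)
    moreover have "tab N 0 1 ?x < A"
      using tab_less_mult[of 0 "T - 1" 1 N ?x] xN xn T4 by (simp add: A_def N_def)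
    ultimately have "ev w m' ?\<rho> (rd (Num 0) (Num 1) ?e) = zs i"
      using low[of "tab N 0 1 ?x"] num[OF xn] zs[OF i] by (simp add: Z_def)
    moreover have "ev w m' ?\<rho> (Op Add (Var 4) (Var 8)) = Z + i" using arr_less(1)[OF i] by simp
    ultimately show ?thesis by blast
  qed
  have b: "q\<rho> ! 2 = M" by simp
  show "same_but (cells Z) m m'" unfolding m'_def items_com_def
    by (rule fill_array(1)[of q\<rho> 2 Z m w "Op Add (Var 4) (Var 8)" _ zs, unfolded b]) (rule step)
  show "arr Z zs m'" unfolding m'_def items_com_def arr_def
    by (intro allI impI, rule fill_array(2)[of q\<rho> 2 Z m w "Op Add (Var 4) (Var 8)" _ zs, unfolded b]) (rule step)
qed

lemma guards_com_correct:
  assumes m: "arr Z zs m" "data_mem m"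
  defines "m' \<equiv> cv w q\<rho> guards_com m"
  shows "same_but (cells U) m m'" "arr U (\<lambda>i. guard (zs i)) m'"
proof -
  let ?e = "IfEq (rd (Num 1) (it (Var 10)) (it (Var 8))) (Num 0) (Var 9) (IfLess (Var 9) (it (Var 10)) (it (Var 10)) (Var 9))"
  have step: "ev w m' (q\<rho> @ [i]) (Op Add (Var 6) (Var 8)) = U + i \<and>
     ev w m' (q\<rho> @ [i]) (Fold 1 (Num 0) ?e) = guard (zs i)"
    if i: "i < M" and sm: "same_but (cells U) m m'" for i m'
  proof -
    have m': "arr Z zs m'" "child_mem m'"
      using arr_same[OF m(1) sm] data_mem_same[OF m(2) sm] by (simp_all add: U_def R_def Z_def data_mem_def)
    let ?y = "zs i"
    let ?P = "\<lambda>z. anc z ?y \<and> z \<noteq> ?y"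
    note y = zs_range[OF i, THEN conjunct1] zs_range[OF i, THEN conjunct2]
    have e: "ev w m' ([A, s, M, N, Z, R, U, Y, i] @ [t, g]) ?e
        = (if ?P (zs g) then max t (zs g) else t)" if g: "g < s" for t g
    proof -
      let ?\<rho> = "[A, s, M, N, Z, R, U, Y, i, t, g]"
      have gM: "g < M" using g M_def by simp
      have z: "ev w m' ?\<rho> (it (Var 8)) = ?y" "ev w m' ?\<rho> (it (Var 10)) = zs g"
        using ev_it[of ?\<rho> m' "Var 8"] ev_it[of ?\<rho> m' "Var 10"] m' i gM by simp_all
      have "ev w m' ?\<rho> (rd (Num 1) (it (Var 10)) (it (Var 8))) = child (zs g) ?y"
        using ev_rd_N(2)[of ?\<rho> m' "Num 1" "it (Var 10)" "it (Var 8)"] z m'(2) zs_range[OF gM] y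
        by (simp add: child_mem_def)
      then show ?thesis using z child_pos_iff[of "zs g" ?y] by auto
    qed
    let ?I = "\<lambda>g t. t \<le> guard ?y \<and> (\<forall>h<g. ?P (zs h) \<longrightarrow> zs h \<le> t)"
    let ?f = "foldl (\<lambda>t g. ev w m' ([A, s, M, N, Z, R, U, Y, i] @ [t, g]) ?e) 0 [0..<s]"
    have I: "?I s ?f"
    proof (rule foldl_upt_inv[where I = ?I])
      fix g t assume g: "g < s" and I: "?I g t"
      have gS: "zs g \<in> insert 0 S" unfolding S_zs using g by blast
      have le: "zs g \<le> guard ?y" if P: "?P (zs g)"
        by (rule guard_Max[OF y gS conjunct1[OF P] conjunct2[OF P]])
      show "?I (Suc g) (ev w m' ([A, s, M, N, Z, R, U, Y, i] @ [t, g]) ?e)"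
        unfolding e[OF g]
      proof (intro conjI allI impI)
        show "(if ?P (zs g) then max t (zs g) else t) \<le> guard ?y"
          using le conjunct1[OF I] by (simp only: max.bounded_iff split: if_split) blast
        fix h assume h: "h < Suc g" "?P (zs h)"
        show "zs h \<le> (if ?P (zs g) then max t (zs g) else t)"
        proof (cases "h = g")
          case False
          then have "h < g" using h(1) by simp
          then have "zs h \<le> t" by (rule conjunct2[OF I, rule_format, OF _ h(2)])
          then show ?thesis by (simp only: le_max_iff_disj split: if_split) blast
        qed (use h(2) in simp)
      qed
    qed simp
    have "guard ?y \<le> ?f"
    proof (cases "guard ?y = 0")
      case False
      then have "guard ?y \<in> zs ` {..<s}" using root_props(3)[OF y] False unfolding S_zs[symmetric] by simp
      then obtain h where h: "h < s" "guard ?y = zs h" by (rule imageE) simp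
      have "?P (zs h)" using root_props(6,7)[OF y] unfolding h(2) by simp
      then have "zs h \<le> ?f" by (rule conjunct2[OF I, rule_format, OF h(1)])
      then show ?thesis unfolding h(2) .
    qed simp
    with conjunct1[OF I] have "?f = guard ?y" by (rule antisym)
    then show ?thesis using arr_less(3)[OF i] by simp
  qed
  have b: "q\<rho> ! 2 = M" by simp
  show "same_but (cells U) m m'" unfolding m'_def guards_com_def
    by (rule fill_array(1)[of q\<rho> 2 U m w "Op Add (Var 6) (Var 8)" _ "\<lambda>i. guard (zs i)", unfolded b]) (rule step)
  show "arr U (\<lambda>i. guard (zs i)) m'" unfolding m'_def guards_com_def arr_def
    by (intro allI impI, rule fill_array(2)[of q\<rho> 2 U m w "Op Add (Var 6) (Var 8)" _ "\<lambda>i. guard (zs i)", unfolded b]) (rule step)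
qed

lemma roots_com_correct:
  assumes m: "arr Z zs m" "data_mem m" "arr U (\<lambda>i. guard (zs i)) m"
  defines "m' \<equiv> cv w q\<rho> roots_com m"
  shows "same_but (cells R) m m'" "arr R (\<lambda>i. root (zs i)) m'"
proof -
  have step: "ev w m' (q\<rho> @ [i]) (Op Add (Var 5) (Var 8)) = R + i \<and>
     ev w m' (q\<rho> @ [i]) (rd (Num 1) (gd (Var 8)) (it (Var 8))) = root (zs i)"
    if i: "i < M" and sm: "same_but (cells R) m m'" for i m'
  proof -
    have m': "arr Z zs m'" "child_mem m'" "arr U (\<lambda>i. guard (zs i)) m'"
      using arr_same[OF m(1) sm] arr_same[OF m(3) sm] data_mem_same[OF m(2) sm]
      by (simp_all add: U_def R_def Z_def data_mem_def)
    note y = zs_range[OF i, THEN conjunct1] zs_range[OF i, THEN conjunct2]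
    let ?\<rho> = "[A, s, M, N, Z, R, U, Y, i]"
    have z: "ev w m' ?\<rho> (it (Var 8)) = zs i" "ev w m' ?\<rho> (gd (Var 8)) = guard (zs i)"
      using ev_it[of ?\<rho> m' "Var 8"] ev_gd[of ?\<rho> _ m' "Var 8"] m' i by simp_all
    have "ev w m' ?\<rho> (rd (Num 1) (gd (Var 8)) (it (Var 8))) = child (guard (zs i)) (zs i)"
      using ev_rd_N(2)[of ?\<rho> m' "Num 1" "gd (Var 8)" "it (Var 8)"] z m'(2) y zs_guard[OF i]
      by (simp add: child_mem_def)
    then show ?thesis using arr_less(2)[OF i] child_guard[OF y] by simp
  qed
  have b: "q\<rho> ! 2 = M" by simp
  show "same_but (cells R) m m'" unfolding m'_def roots_com_def
    by (rule fill_array(1)[of q\<rho> 2 R m w "Op Add (Var 5) (Var 8)" _ "\<lambda>i. root (zs i)", unfolded b]) (rule step)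
  show "arr R (\<lambda>i. root (zs i)) m'" unfolding m'_def roots_com_def arr_def
    by (intro allI impI, rule fill_array(2)[of q\<rho> 2 R m w "Op Add (Var 5) (Var 8)" _ "\<lambda>i. root (zs i)", unfolded b]) (rule step)
qed

lemma qmem_same: "qmem m \<Longrightarrow> same_but (cells Y) m m' \<Longrightarrow> qmem m'"
  unfolding qmem_def
  using arr_same[of Z zs m Y m'] arr_same[of R _ m Y m'] arr_same[of U _ m Y m'] data_mem_same[of m Y m']
  by (simp add: Y_def U_def R_def Z_def)

lemma labels_com_correct:
  assumes m: "qmem m"
  defines "m' \<equiv> cv w q\<rho> labels_com m"
  shows "qmem m'" "arr Y (\<lambda>i. root (zs i)) m'"
proof -
  have step: "ev w m' (q\<rho> @ [i]) (Op Add (Var 7) (Var 8)) = Y + i \<and> ev w m' (q\<rho> @ [i]) (rt (Var 8)) = root (zs i)"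
    if i: "i < M" and sm: "same_but (cells Y) m m'" for i m'
    using ev_arr(2)[of "[A, s, M, N, Z, R, U, Y, i]" m' "Var 8"] qmem_same[OF m sm] i arr_less(4)[OF i] by simp
  have b: "q\<rho> ! 2 = M" by simp
  have "same_but (cells Y) m m'" unfolding m'_def labels_com_def
    by (rule fill_array(1)[of q\<rho> 2 Y m w "Op Add (Var 7) (Var 8)" _ "\<lambda>i. root (zs i)", unfolded b]) (rule step)
  then show "qmem m'" by (rule qmem_same[OF m])
  show "arr Y (\<lambda>i. root (zs i)) m'" unfolding m'_def labels_com_def arr_def
    by (intro allI impI, rule fill_array(2)[of q\<rho> 2 Y m w "Op Add (Var 7) (Var 8)" _ "\<lambda>i. root (zs i)", unfolded b]) (rule step)
qed

section \<open>Classes of linked items by merging labels\<close>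

definition linked_items :: "(nat \<Rightarrow> nat) \<Rightarrow> nat \<Rightarrow> nat \<Rightarrow> bool" where
  "linked_items m x y \<longleftrightarrow> link (pr_of m) s (zs x) (zs y) \<noteq> 0"

lemma relabel_com_correct:
  assumes m: "qmem m" "arr Y l m" and xy: "x < M" "y < M"
  defines "m' \<equiv> cv w (q\<rho> @ [x, y]) relabel_com m"
  shows "same_but (cells Y) m m'" "arr Y (\<lambda>q. if linked_items m x y \<and> l q = l x then l y else l q) m'"
proof -
  let ?v = "ev w m [A, s, M, N, Z, R, U, Y, x, y] link_expr"
  let ?\<rho> = "[A, s, M, N, Z, R, U, Y, x, y, ?v, l x, l y]"
  let ?e = "IfEq (Var 10) (Num 0) (lb (Var 13)) (IfEq (lb (Var 13)) (Var 11) (Var 12) (lb (Var 13)))"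
  let ?f = "\<lambda>q. if linked_items m x y \<and> l q = l x then l y else l q"
  have v: "?v = 0 \<longleftrightarrow> \<not> linked_items m x y" unfolding linked_items_def using ev_link[OF xy m(1)] by simp
  have "ev w m [A, s, M, N, Z, R, U, Y, x, y, ?v] (lb (Var 8)) = l x"
    "ev w m [A, s, M, N, Z, R, U, Y, x, y, ?v, l x] (lb (Var 9)) = l y"
    using ev_lb[of _ l m] m(2) xy by simp_all
  then have m'_eq: "m' = cv w ?\<rho> (For 2 (St (Op Add (Var 7) (Var 13)) ?e)) m"
    unfolding m'_def relabel_com_def cv.simps(2) by (simp del: cv.simps)
  have step: "ev w m' (?\<rho> @ [q]) (Op Add (Var 7) (Var 13)) = Y + q \<and> ev w m' (?\<rho> @ [q]) ?e = ?f q"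
    if q: "q < M" and rest: "\<forall>j. q \<le> j \<longrightarrow> m' (Y + j) = m (Y + j)" for q m'
  proof -
    have "ev w m' (?\<rho> @ [q]) (lb (Var 13)) = m' (Y + q)" using arr_less(4)[OF q] by (simp add: lb_def)
    also have "\<dots> = l q" using rest m(2) q by (simp add: arr_def)
    finally have "ev w m' (?\<rho> @ [q]) (lb (Var 13)) = l q" .
    then show ?thesis using arr_less(4)[OF q] v by simp
  qed
  have b: "?\<rho> ! 2 = M" by simp
  show "same_but (cells Y) m m'" unfolding m'_eq
    by (rule fill_array(1)[of ?\<rho> 2 Y m w "Op Add (Var 7) (Var 13)" ?e ?f, unfolded b]) (rule step)
  show "arr Y ?f m'" unfolding m'_eq arr_def
    by (intro allI impI, rule fill_array(2)[of ?\<rho> 2 Y m w "Op Add (Var 7) (Var 13)" ?e ?f, unfolded b]) (rule step)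
qed

text \<open>Merging the labels of the linked pairs one after the other computes the classes of the generated
  equivalence relation.\<close>

definition label_inv :: "(nat \<Rightarrow> nat) \<Rightarrow> (nat \<times> nat) set \<Rightarrow> (nat \<Rightarrow> nat) \<Rightarrow> bool" where
  "label_inv m0 D l \<longleftrightarrow>
     (\<forall>i<M. \<forall>j<M. l i = l j \<longrightarrow> (root (zs i), root (zs j)) \<in> (linked (pr_of m0) s (zs ` {..<M}) \<union> (linked (pr_of m0) s (zs ` {..<M}))\<inverse>)\<^sup>*) \<and>
     (\<forall>i<M. \<forall>j<M. root (zs i) = root (zs j) \<longrightarrow> l i = l j) \<and>
     (\<forall>(x, y)\<in>D. linked_items m0 x y \<longrightarrow> l x = l y)"

text \<open>The one new coincidence of labels is justified by the link from \<open>x\<close> to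
  \<open>y\<close>. Replacing a label everywhere never separates items with equal labels, so earlier
  merges persist.\<close>

lemma label_inv_relabel:
  assumes I: "label_inv m0 D l" and xy: "x < M" "y < M"
  shows "label_inv m0 (insert (x, y) D) (\<lambda>q. if linked_items m0 x y \<and> l q = l x then l y else l q)"
proof -
  let ?K = "linked (pr_of m0) s (zs ` {..<M})"
  let ?E = "(?K \<union> ?K\<inverse>)\<^sup>*"
  have E: "(b, a) \<in> ?E" if "(a, b) \<in> ?E" for a b
    by (rule symD[OF sym_rtrancl[OF sym_Un_converse] that])
  have l: "(root (zs i), root (zs j)) \<in> ?E" if "i < M" "j < M" "l i = l j" for i j
    using I that unfolding label_inv_def by blast
  have k: "(root (zs x), root (zs y)) \<in> ?E" if "linked_items m0 x y"
    using that xy unfolding linked_def linked_items_def by blast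
  have "(root (zs i), root (zs j)) \<in> ?E"
    if i: "i < M" and j: "j < M" and L: "linked_items m0 x y" and eq: "l i = l x" "l y = l j" for i j
    by (rule rtrancl_trans[OF rtrancl_trans[OF l[OF i xy(1) eq(1)] k[OF L]] l[OF xy(2) j eq(2)]])
  then have "(root (zs i), root (zs j)) \<in> ?E" "(root (zs j), root (zs i)) \<in> ?E"
    if "i < M" "j < M" "linked_items m0 x y" "l i = l x" "l y = l j" for i j
    using that E by blast+
  note c = this
  let ?l = "\<lambda>q. if linked_items m0 x y \<and> l q = l x then l y else l q"
  have d: "?l a = ?l b" if "(a, b) \<in> insert (x, y) D" "linked_items m0 a b" for a b
  proof (cases "(a, b) \<in> D")
    case True
    then have "l a = l b" using I that(2) unfolding label_inv_def by blast
    then show ?thesis by simp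
  next
    case False
    then have "a = x" "b = y" using that(1) by simp_all
    then show ?thesis using that(2) by simp
  qed
  show ?thesis unfolding label_inv_def
  proof (intro conjI allI impI)
    show "\<forall>(a, b)\<in>insert (x, y) D. linked_items m0 a b \<longrightarrow> ?l a = ?l b"
      using d by blast
  next
    fix i j assume ij: "i < M" "j < M" and eq: "root (zs i) = root (zs j)"
    then have "l i = l j" using I unfolding label_inv_def by blast
    then show "?l i = ?l j" by simp
  next
    fix i j assume ij: "i < M" "j < M"
      and eq: "(if linked_items m0 x y \<and> l i = l x then l y else l i) = (if linked_items m0 x y \<and> l j = l x then l y else l j)"
    show "(root (zs i), root (zs j)) \<in> ?E"
      using eq l[OF ij] c(1)[OF ij] c(2)[OF ij(2,1)] by (auto split: if_splits)
  qed
qed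

lemma label_inv_final:
  assumes I: "label_inv m0 ({..<M} \<times> {..<M}) l" and ij: "i < M" "j < M"
  shows "l i = l j \<longleftrightarrow> (root (zs i), root (zs j)) \<in> (linked (pr_of m0) s (zs ` {..<M}) \<union> (linked (pr_of m0) s (zs ` {..<M}))\<inverse>)\<^sup>*"
    (is "_ \<longleftrightarrow> _ \<in> (?K \<union> _)\<^sup>*")
proof
  have r: "l a = l b" if "a < M" "b < M" "root (zs a) = root (zs b)" for a b
    using I that unfolding label_inv_def by blast
  have d: "l a = l b" if "a < M" "b < M" "linked_items m0 a b" for a b
    using I that unfolding label_inv_def by blast
  assume "(root (zs i), root (zs j)) \<in> (?K \<union> ?K\<inverse>)\<^sup>*"
  \<comment> \<open>The relation lives on tops while labels belong to items, so the induction
    carries along an item with the current top.\<close>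
  then have "\<exists>a<M. root (zs a) = root (zs j) \<and> l a = l i"
  proof (induction rule: rtrancl_induct)
    case base
    then show ?case using ij by blast
  next
    case (step b c)
    from step.IH obtain a where a: "a < M" "root (zs a) = b" "l a = l i" by blast
    from step.hyps(2) obtain x y where xy: "x < M" "y < M" "b = root (zs x)" "c = root (zs y)"
      "linked_items m0 x y \<or> linked_items m0 y x"
      unfolding linked_def linked_items_def by blast
    have "l x = l y" using d[OF xy(1,2)] d[OF xy(2,1)] xy(5) by auto
    moreover have "l a = l x" by (rule r[OF a(1) xy(1)]) (use a xy in simp)
    ultimately show ?case using a(3) xy(2,4) by auto
  qed
  then obtain a where "a < M" "root (zs a) = root (zs j)" "l a = l i" by blast
  then show "l i = l j" using r[of a j] ij by simp
next
  assume "l i = l j"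
  then show "(root (zs i), root (zs j)) \<in> (?K \<union> ?K\<inverse>)\<^sup>*" using I ij unfolding label_inv_def by blast
qed

lemma pr_of_same:
  assumes "same_but (cells Y) m m'" "j < s" "f < N" "x < N" shows "pr_of m' j f x = pr_of m j f x"
proof -
  have j: "j < k" using assms(2) s_le by simp
  then have "5 + 3 * j < T" by (simp add: T_def)
  then have "5 + 3 * j \<le> T - 1" "T - 1 + 1 = T" by simp_all
  with tab_less_mult[of "5 + 3 * j" "T - 1" f N x] assms(3,4) have "tab N (5 + 3 * j) f x < A" by (simp add: A_def)
  then show ?thesis using assms(1) by (simp add: pr_of_def same_but_def Y_def U_def R_def Z_def)
qed

text \<open>Relabelling touches the label array only, so links evaluated on the way are those of the
  initial memory. The stored predecessors agree merely for arguments in range, hence the detour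
  through every summand.\<close>

lemma linked_items_same:
  assumes sm: "same_but (cells Y) m m'" and xy: "x < M" "y < M"
  shows "linked_items m' x y = linked_items m x y"
proof -
  have N: "zs x - 1 < N" "guard (zs x) < N" using zs_range[OF xy(1)] zs_guard[OF xy(1)] by linarith+
  have l2: "link2 (pr_of m') (zs f) j (zs x) (zs y) = link2 (pr_of m) (zs f) j (zs x) (zs y)" if fj: "f < s" "j < s" for f j
  proof -
    have fN: "zs f < N" using zs_range[of f] fj M_def by simp
    show ?thesis unfolding link2_def pr_of_same[OF sm fj(2) fN N(1)] pr_of_same[OF sm fj(2) fN N(2)] by (rule refl)
  qed
  have l: "(\<Sum>j<s. link2 (pr_of m') (zs f) j (zs x) (zs y)) = (\<Sum>j<s. link2 (pr_of m) (zs f) j (zs x) (zs y))" if "f < s" for f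
    by (rule sum.cong[OF refl], rule l2[OF that], simp only: lessThan_iff)
  have i: "(if P then a else 0) = (if P then b else 0)" if "a = b" for P and a b :: int using that by (rule arg_cong)
  have "(\<Sum>f<s. if anc (zs x) (zs f) then \<Sum>j<s. link2 (pr_of m') (zs f) j (zs x) (zs y) else 0)
      = (\<Sum>f<s. if anc (zs x) (zs f) then \<Sum>j<s. link2 (pr_of m) (zs f) j (zs x) (zs y) else 0)"
    by (rule sum.cong[OF refl], rule i, rule l, simp only: lessThan_iff)
  then have "link (pr_of m') s (zs x) (zs y) = link (pr_of m) s (zs x) (zs y)"
    unfolding link_def sum_S' by (simp only:)
  then show ?thesis unfolding linked_items_def by (simp only:)
qed

lemma label_inv_0: "label_inv m0 {} (\<lambda>i. root (zs i))"
  unfolding label_inv_def by simp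

lemma relabel_all:
  assumes m: "qmem m" "arr Y (\<lambda>i. root (zs i)) m"
  defines "m' \<equiv> cv w q\<rho> (For 2 (For 2 relabel_com)) m"
  shows "qmem m'" "\<exists>l. arr Y l m' \<and> label_inv m ({..<M} \<times> {..<M}) l"
proof -
  let ?I = "\<lambda>D m'. same_but (cells Y) m m' \<and> (\<exists>l. arr Y l m' \<and> label_inv m D l)"
  have step: "?I (insert (x, y) D) (cv w (q\<rho> @ [x, y]) relabel_com m1)"
    if xy: "x < M" "y < M" and I: "?I D m1" for x y D m1
  proof -
    from I obtain l where sm: "same_but (cells Y) m m1" and l: "arr Y l m1" "label_inv m D l" by blast
    note r = relabel_com_correct[OF qmem_same[OF m(1) sm] l(1) xy]
    have "same_but (cells Y) m (cv w (q\<rho> @ [x, y]) relabel_com m1)"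
      using sm r(1) unfolding same_but_def by simp
    with r(2) label_inv_relabel[OF l(2) xy] show ?thesis
      unfolding linked_items_same[OF sm xy] by blast
  qed
  have row: "?I ({..<Suc x} \<times> {..<M}) (cv w (q\<rho> @ [x]) (For 2 relabel_com) m1)"
    if x: "x < M" and I: "?I ({..<x} \<times> {..<M}) m1" for x m1
  proof -
    let ?D = "\<lambda>y. {..<x} \<times> {..<M} \<union> {x} \<times> {..<y}"
    have "?I (?D M) (foldl (\<lambda>m y. cv w (q\<rho> @ [x, y]) relabel_com m) m1 [0..<M])"
    proof (rule foldl_upt_inv[where I = "\<lambda>y. ?I (?D y)"])
      show "?I (?D 0) m1" using I by simp
      fix y m2 assume y: "y < M" and J: "?I (?D y) m2"
      have "insert (x, y) (?D y) = ?D (Suc y)" by auto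
      with step[OF x y J] show "?I (?D (Suc y)) (cv w (q\<rho> @ [x, y]) relabel_com m2)" by (simp only:)
    qed
    moreover have "?D M = {..<Suc x} \<times> {..<M}" by auto
    moreover have "foldl (\<lambda>m y. cv w (q\<rho> @ [x, y]) relabel_com m) m1 [0..<M] = cv w (q\<rho> @ [x]) (For 2 relabel_com) m1"
      by simp
    ultimately show ?thesis by (simp only:)
  qed
  have "?I ({..<M} \<times> {..<M}) (foldl (\<lambda>m x. cv w (q\<rho> @ [x]) (For 2 relabel_com) m) m [0..<M])"
  proof (rule foldl_upt_inv[where I = "\<lambda>x. ?I ({..<x} \<times> {..<M})"])
    show "?I ({..<0} \<times> {..<M}) m" using m(2) label_inv_0[of m] by (auto simp: same_but_refl)
  qed (rule row)
  moreover have "foldl (\<lambda>m x. cv w (q\<rho> @ [x]) (For 2 relabel_com) m) m [0..<M] = m'"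
    unfolding m'_def by simp
  ultimately have I: "?I ({..<M} \<times> {..<M}) m'" by (simp only:)
  then show "qmem m'" using qmem_same[OF m(1)] by blast
  show "\<exists>l. arr Y l m' \<and> label_inv m ({..<M} \<times> {..<M}) l" using I by blast
qed

lemma cells_order: "A \<le> Z" "A \<le> R" "A \<le> U" "Z + M \<le> R" "Z + M \<le> U" "R + M \<le> U"
  using Z_def R_def U_def by linarith+

theorem query_com_correct:
  assumes num: "\<And>x. x < n \<Longrightarrow> m (tab N 0 1 x) = num x"
    and inp: "m A = u" "m (A + 1) = v" "m (A + 2) = s" "\<And>i. i < s \<Longrightarrow> m (A + 3 + i) = xs i"
    and less: "u < n" "v < n" "\<And>i. i < s \<Longrightarrow> xs i < n"
    and zs: "\<And>i. i < M \<Longrightarrow> zs i = num (if i < s then xs i else if i = s then u else v)"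
    and data: "data_mem m" "m 0 = N"
  shows "cv w [A] query_com m 0 = (if zs s \<notin> S \<and> zs (s + 1) \<notin> S \<and> reach (zs s) (zs (s + 1)) then 1 else 0)"
proof -
  define m1 where "m1 = cv w q\<rho> items_com m"
  define m2 where "m2 = cv w q\<rho> guards_com m1"
  define m3 where "m3 = cv w q\<rho> roots_com m2"
  define m4 where "m4 = cv w q\<rho> labels_com m3"
  define m5 where "m5 = cv w q\<rho> (For 2 (For 2 relabel_com)) m4"
  have e: "ev w m [A] (Ld (Op Add (Var 0) (Num 2))) = s" "ev w m [A, s] (Op Add (Var 1) (Num 2)) = M"
    "ev w m [A, s, M] (Ld (Num 0)) = N" "ev w m [A, s, M, N] (Op Add (Op Add (Var 0) (Num 3)) (Var 1)) = Z"
    "ev w m [A, s, M, N, Z] (Op Add (Var 4) (Var 2)) = R" "ev w m [A, s, M, N, Z, R] (Op Add (Var 5) (Var 2)) = U"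
    "ev w m [A, s, M, N, Z, R, U] (Op Add (Var 6) (Var 2)) = Y"
    using bounds inp(3) data(2) by (simp_all add: M_def Z_def R_def U_def Y_def)
  have eq: "cv w [A] query_com m = cv w q\<rho> answer_com m5"
    unfolding query_com_def by (simp only: cv.simps(2,3) append.simps e m1_def m2_def m3_def m4_def m5_def)
  note i = items_com_correct[OF num inp(1,2,4) less zs, folded m1_def]
  have 1: "data_mem m1" by (rule data_mem_same[OF data(1) i(1) cells_order(1)])
  note g = guards_com_correct[OF i(2) 1, folded m2_def]
  have 2: "arr Z zs m2" by (rule arr_same[OF i(2) g(1) disjI1[OF cells_order(5)]])
  have 3: "data_mem m2" by (rule data_mem_same[OF 1 g(1) cells_order(3)])
  note r = roots_com_correct[OF 2 3 g(2), folded m3_def]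
  have "arr Z zs m3" by (rule arr_same[OF 2 r(1) disjI1[OF cells_order(4)]])
  moreover have "arr U (\<lambda>i. guard (zs i)) m3" by (rule arr_same[OF g(2) r(1) disjI2[OF cells_order(6)]])
  moreover have "data_mem m3" by (rule data_mem_same[OF 3 r(1) cells_order(2)])
  ultimately have "qmem m3" using r(2) unfolding qmem_def by blast
  note l = labels_com_correct[OF this, folded m4_def]
  note all = relabel_all[OF l, folded m5_def]
  from all(2) obtain L where L: "arr Y L m5" "label_inv m4 ({..<M} \<times> {..<M}) L" by blast
  have sM: "s < M" "s + 1 < M" by (simp_all add: M_def)
  let ?e = "IfEq (it (Var 9)) (it (Var 1)) (Num 1) (IfEq (it (Var 9)) (it (Op Add (Var 1) (Num 1))) (Num 1) (Var 8))"
  let ?P = "\<lambda>g. zs g = zs s \<or> zs g = zs (s + 1)"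
  have s1: "ev w m5 (q\<rho> @ \<sigma>) (Op Add (Var 1) (Num 1)) = s + 1" for \<sigma> using bounds(10) by simp
  have s0: "ev w m5 (q\<rho> @ \<sigma>) (Var 1) = s" for \<sigma> by simp
  have q: "qenv (q\<rho> @ \<sigma>)" for \<sigma> by simp
  have Zm: "arr Z zs m5" using all(1) unfolding qmem_def by blast
  have lbs: "ev w m5 (q\<rho> @ []) (lb (Var 1)) = L s" "ev w m5 (q\<rho> @ []) (lb (Op Add (Var 1) (Num 1))) = L (s + 1)"
    using ev_lb[OF q L(1), of "[]" "Var 1"] ev_lb[OF q L(1), of "[]" "Op Add (Var 1) (Num 1)"] s0 s1 sM by (simp_all only:)
  have its: "ev w m5 (q\<rho> @ \<sigma>) (it (Var 1)) = zs s" "ev w m5 (q\<rho> @ \<sigma>) (it (Op Add (Var 1) (Num 1))) = zs (s + 1)" for \<sigma>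
    using ev_it[OF q Zm, of \<sigma> "Var 1"] ev_it[OF q Zm, of \<sigma> "Op Add (Var 1) (Num 1)"] s0[of \<sigma>] s1[of \<sigma>] sM by (simp_all only:)
  have "foldl (\<lambda>a g. ev w m5 (q\<rho> @ [a, g]) ?e) 0 [0..<s]
      = (if \<exists>g<s. ?P g then (\<lambda>_. 1) (Max {g. g < s \<and> ?P g}) else 0)"
  proof (rule foldl_last)
    fix g a assume g: "g < s"
    then have gM: "g < M" using M_def by simp
    have "ev w m5 (q\<rho> @ [a, g]) (it (Var 9)) = zs g" using ev_it[OF q Zm, of "[a, g]" "Var 9"] gM by simp
    then show "ev w m5 (q\<rho> @ [a, g]) ?e = (if ?P g then 1 else a)"
      unfolding ev.simps(5) its by simp
  qed
  moreover have "(\<exists>g<s. ?P g) \<longleftrightarrow> zs s \<in> S \<or> zs (s + 1) \<in> S"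
  proof -
    have "a \<in> S \<longleftrightarrow> (\<exists>g<s. zs g = a)" for a unfolding S_zs by blast
    then show ?thesis by (simp only:) blast
  qed
  moreover have "q\<rho> ! 1 = s" "ev w m5 q\<rho> (Num 0) = 0" by simp_all
  ultimately have F: "ev w m5 q\<rho> (Fold 1 (Num 0) ?e) = (if zs s \<in> S \<or> zs (s + 1) \<in> S then 1 else 0)"
    by (simp only: ev.simps(8))
  have l0: "ev w m5 q\<rho> (lb (Var 1)) = L s" "ev w m5 q\<rho> (lb (Op Add (Var 1) (Num 1))) = L (s + 1)"
    using lbs by (simp_all only: append_Nil2)
  have ans: "cv w [A] query_com m 0 = (if zs s \<in> S \<or> zs (s + 1) \<in> S then 0 else if L s = L (s + 1) then 1 else 0)"
    unfolding eq answer_com_def cv.simps(1) ev.simps(5) F l0 by simp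
  have reach: "reach (zs s) (zs (s + 1)) \<longleftrightarrow>
      (root (zs s), root (zs (s + 1))) \<in> (linked (pr_of m4) s (zs ` {..<M}) \<union> (linked (pr_of m4) s (zs ` {..<M}))\<inverse>)\<^sup>*"
    if "zs s \<notin> S" "zs (s + 1) \<notin> S"
  proof (rule reach_iff_linked)
    show "good_pred (pr_of m4) s" by (rule good_pred_pr_of[OF l(1)])
    show "card S \<le> s" by (simp only: card_S order_refl)
    show "zs ` {..<M} \<subseteq> {1..<N}"
    proof
      fix z assume "z \<in> zs ` {..<M}"
      then obtain i where "i < M" "z = zs i" by (metis imageE lessThan_iff)
      then show "z \<in> {1..<N}" using zs_range[of i] by (simp add: Suc_le_eq)
    qed
    show "S \<subseteq> zs ` {..<M}" unfolding S_zs by (rule image_mono) (simp add: M_def)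
    show "zs s \<in> zs ` {..<M}" "zs (s + 1) \<in> zs ` {..<M}" using sM by blast+
  qed (fact that)+
  show ?thesis
  proof (cases "zs s \<in> S \<or> zs (s + 1) \<in> S")
    case False
    then have n: "zs s \<notin> S" "zs (s + 1) \<notin> S" by blast+
    have "reach (zs s) (zs (s + 1)) \<longleftrightarrow> L s = L (s + 1)"
      using reach[OF n] label_inv_final[OF L(2) sM] by (simp only:)
    then show ?thesis unfolding ans using n by (simp only: if_True if_False simp_thms)
  next
    case True
    then have "\<not> (zs s \<notin> S \<and> zs (s + 1) \<notin> S \<and> reach (zs s) (zs (s + 1)))" by blast
    then show ?thesis unfolding ans using True by (simp only: if_True if_False)
  qed
qed

end

section \<open>The data structure\<close>

text \<open>A walk can be shortened to a path with the same ends and no new vertices, so avoiding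
  \<open>S\<close> is preserved. Membership of \<open>u\<close> is what the trivial path
  needs.\<close>

lemma conn_iff:
  assumes "pair_graph G" "u \<in> pverts G"
  shows "conn G u v S \<longleftrightarrow> u \<notin> S \<and> v \<notin> S \<and> (\<lambda>p q. (p, q) \<in> parcs G \<and> p \<notin> S \<and> q \<notin> S)\<^sup>*\<^sup>* u v"
proof
  interpret pair_graph G by fact
  let ?R = "\<lambda>p q. (p, q) \<in> parcs G \<and> p \<notin> S \<and> q \<notin> S"
  have walk: "set p \<inter> S = {} \<Longrightarrow> hd p \<notin> S \<and> last p \<notin> S \<and> ?R\<^sup>*\<^sup>* (hd p) (last p)"
    if "vwalk p (with_proj G)" for p
    using that
  proof (induction rule: vwalk_induct)
    case (Cons a b es)
    then have "?R a b" by auto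
    moreover have "b \<notin> S \<and> last (b # es) \<notin> S \<and> ?R\<^sup>*\<^sup>* b (last (b # es))" using Cons by auto
    ultimately show ?case by (auto intro: converse_rtranclp_into_rtranclp)
  qed simp
  show "u \<notin> S \<and> v \<notin> S \<and> ?R\<^sup>*\<^sup>* u v" if "conn G u v S"
    using that walk unfolding conn_def vpath_def by blast
  assume *: "u \<notin> S \<and> v \<notin> S \<and> ?R\<^sup>*\<^sup>* u v"
  then have "?R\<^sup>*\<^sup>* u v" by blast
  then have "\<exists>p. vwalk p (with_proj G) \<and> hd p = u \<and> last p = v \<and> set p \<inter> S = {}"
    using assms(2) *
  proof (induction rule: converse_rtranclp_induct)
    case base
    then show ?case by (intro exI[of _ "[v]"]) (auto simp: vwalk_def)
  next
    case (step y z)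
    have "z \<in> pverts G" using arc_snd_in_verts[of "(y, z)"] step.hyps(1) by simp
    with step obtain p where p: "vwalk p (with_proj G)" "hd p = z" "last p = v" "set p \<inter> S = {}" by blast
    then have ne: "p \<noteq> []" by (auto simp: vwalk_def)
    have "vwalk (y # p) (with_proj G)"
      by (rule vwalk_consI[OF p(1)]) (use step p(2) in simp_all)
    then show ?case using p ne step.hyps(1) by (intro exI[of _ "y # p"]) auto
  qed
  then obtain p where p: "vwalk p (with_proj G)" "hd p = u" "last p = v" "set p \<inter> S = {}" by blast
  have "vpath (vwalk_to_vpath p) (with_proj G)" by (rule vwalk_to_vpath_vpath[OF p(1)])
  moreover have "set (vwalk_to_vpath p) \<inter> S = {}" using vwalk_to_vpath_subset[of _ p] p(4) by blast
  ultimately show "conn G u v S"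
    unfolding conn_def using p(2,3) vwalk_to_vpath_hd[of p] vwalk_to_vpath_last[of p] by metis
qed

text \<open>Carries reachability over along the renaming by \<open>num\<close>; steps of
  \<open>E\<close> end inside the image, so injectivity on \<open>V\<close> is enough to trace a
  walk back.\<close>

lemma rtranclp_bij:
  assumes f: "inj_on f V" "\<And>p q. E p q \<Longrightarrow> q \<in> f ` V" "\<And>x y. x \<in> V \<Longrightarrow> y \<in> V \<Longrightarrow> E (f x) (f y) \<longleftrightarrow> A x y"
    and A: "\<And>x y. A x y \<Longrightarrow> y \<in> V" and u: "u \<in> V" and v: "v \<in> V"
  shows "E\<^sup>*\<^sup>* (f u) (f v) \<longleftrightarrow> A\<^sup>*\<^sup>* u v"
proof
  assume "A\<^sup>*\<^sup>* u v"
  then have "v \<in> V \<and> E\<^sup>*\<^sup>* (f u) (f v)"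
  proof (induction rule: rtranclp_induct)
    case (step y z)
    have z: "z \<in> V" by (rule A[OF step.hyps(2)])
    have "E (f y) (f z)" using f(3)[OF conjunct1[OF step.IH] z] step.hyps(2) by (simp only:)
    then show ?case using z rtranclp.rtrancl_into_rtrancl[OF conjunct2[OF step.IH]] by (simp only: simp_thms)
  qed (simp only: u rtranclp.rtrancl_refl simp_thms)
  then show "E\<^sup>*\<^sup>* (f u) (f v)" by blast
next
  assume "E\<^sup>*\<^sup>* (f u) (f v)"
  moreover have "\<exists>z\<in>V. p = f z \<and> A\<^sup>*\<^sup>* u z" if "E\<^sup>*\<^sup>* (f u) p" for p
    using that
  proof (induction rule: rtranclp_induct)
    case (step p q)
    obtain y where y: "y \<in> V" "p = f y" "A\<^sup>*\<^sup>* u y" using step.IH by (elim bexE conjE) (rule that)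
    obtain z where z: "z \<in> V" "q = f z" using f(2)[OF step.hyps(2)] by (elim imageE) (rule that)
    have "A y z" using f(3)[OF y(1) z(1)] step.hyps(2) unfolding y(2) z(2) by (simp only:)
    from rtranclp.rtrancl_into_rtrancl[OF y(3) this] z show ?case by (intro bexI[of _ z]) (simp_all only: simp_thms)
  next
    case base
    show ?case using u by (intro bexI[of _ u]) (simp_all only: simp_thms rtranclp.rtrancl_refl)
  qed
  ultimately obtain z where z: "z \<in> V" "f v = f z" "A\<^sup>*\<^sup>* u z" by blast
  have "v = z" by (rule inj_onD[OF f(1) z(2) v z(1)])
  then show "A\<^sup>*\<^sup>* u v" using z(3) by (simp only:)
qed

lemma nth_matrix:
  assumes "x < m" "y < n"
  shows "length [f i j. i \<leftarrow> [0..<m], j \<leftarrow> [0..<n]] = m * n" "[f i j. i \<leftarrow> [0..<m], j \<leftarrow> [0..<n]] ! (x * n + y) = f x y"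
proof -
  have len: "length [f i j. i \<leftarrow> [0..<m], j \<leftarrow> [0..<n]] = m * n" for m
    by (induction m) simp_all
  then show "length [f i j. i \<leftarrow> [0..<m], j \<leftarrow> [0..<n]] = m * n" .
  show "[f i j. i \<leftarrow> [0..<m], j \<leftarrow> [0..<n]] ! (x * n + y) = f x y"
    using assms
  proof (induction m)
    case (Suc m)
    show ?case
    proof (cases "x < m")
      case True
      then have "x * n + n \<le> m * n" using mult_le_mono1[of "Suc x" m n] by simp
      then have "x * n + y < m * n" using Suc.prems by linarith
      then show ?thesis using Suc True len[of m] by (simp add: nth_append)
    next
      case False
      then have "x = m" using Suc.prems by simp
      then show ?thesis using Suc.prems len[of m] by (simp add: nth_append)
    qed
  qed simp
qed

text \<open>The factor \<open>c\<close> of the word length becomes an exponent, so any fixed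
  polynomial in \<open>n + k\<close> fits into a word for a suitable \<open>c\<close>.\<close>

lemma word_length_bound: "(n + k + 2) ^ c \<le> 2 ^ word_length c n k"
proof -
  let ?L = "nat \<lceil>log 2 (real (n + k + 2))\<rceil>"
  have "real (n + k + 2) = 2 powr log 2 (real (n + k + 2))" by simp
  also have "\<dots> \<le> 2 powr real ?L" by (rule powr_mono) linarith+
  also have "\<dots> = real (2 ^ ?L)" by (subst powr_realpow) simp_all
  finally have "n + k + 2 \<le> 2 ^ ?L" by (simp only: of_nat_le_iff)
  then have "(n + k + 2) ^ c \<le> (2 ^ ?L) ^ c" by (rule power_mono) simp
  then show ?thesis by (simp add: word_length_def power_mult[symmetric] mult.commute)
qed

text \<open>The origin of the exponent 6: for \<open>B = n + k + 2\<close>, the memory of a query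
  and the values of \<open>link\<close> are at most \<open>2 * B ^ 5\<close>, and
  \<open>2 \<le> B\<close>.\<close>

lemma size_bounds:
  fixes N B k s :: nat
  assumes B: "N \<le> B" "s + 2 \<le> B" "4 + 3 * k + 3 \<le> 4 * B" and w: "B ^ 6 \<le> W" and N0: "0 < N"
  shows "(4 + 3 * k + 3) * N * N \<le> W" "N * N * N < W"
    "(4 + 3 * k) * N * N + 3 + s + 4 * (s + 2) \<le> W" "N * N + s * (s * (N * (N * N))) < W" "B < W"
proof -
  have 2: "2 \<le> B" using B by linarith
  have N2: "N * N \<le> B ^ 2" using mult_le_mono[OF B(1,1)] by (simp only: power2_eq_square)
  have N3: "N * N * N \<le> B ^ 3" using mult_le_mono[OF N2 B(1)] by (simp only: power3_eq_cube power2_eq_square)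
  have p: "2 * B ^ i \<le> B ^ j" if "j = Suc i" for i j
    unfolding that power_Suc by (rule mult_le_mono1[OF 2])
  have q: "B ^ 2 < B ^ 3" "B ^ 3 < B ^ 4" "B ^ 4 < B ^ 5" "B ^ 5 < B ^ 6" "B ^ 1 < B ^ 2"
    by (rule power_strict_increasing; use 2 in simp)+
  have p4: "2 * B ^ 1 \<le> B ^ 2" "2 * B ^ 2 \<le> B ^ 3" "2 * B ^ 3 \<le> B ^ 4" "2 * B ^ 4 \<le> B ^ 5" "2 * B ^ 5 \<le> B ^ 6"
    by (rule p; simp)+
  have c: "4 * B \<le> B ^ 3" using p4(1,2) by (simp only: power_one_right)
  have "(4 + 3 * k + 3) * (N * N) \<le> B ^ 3 * B ^ 2" by (rule mult_le_mono[OF order_trans[OF B(3) c] N2])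
  also have "B ^ 3 * B ^ 2 = B ^ 5" by (subst power_add[symmetric]) simp
  finally have T: "(4 + 3 * k + 3) * N * N \<le> B ^ 5" by (simp only: mult.assoc)
  show "(4 + 3 * k + 3) * N * N \<le> W" by (rule order_trans[OF T order_trans[OF less_imp_le[OF q(4)] w]])
  have "B ^ 3 < B ^ 6" by (rule less_trans[OF q(2) less_trans[OF q(3,4)]])
  from less_le_trans[OF le_less_trans[OF N3 this] w] show "N * N * N < W" .
  have "(4 + 3 * k) * N * N \<le> (4 + 3 * k + 3) * N * N" by (intro mult_le_mono1) simp
  note A = order_trans[OF this T]
  have "3 + s + 4 * (s + 2) \<le> 5 * B + 1" using B(2) by presburger
  also have "\<dots> \<le> 2 * (4 * B)" using 2 by presburger
  also have "\<dots> \<le> 2 * B ^ 3" by (rule mult_le_mono2[OF c])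
  also note p4(3)
  also note less_imp_le[OF q(3)]
  finally have "3 + s + 4 * (s + 2) \<le> B ^ 5" .
  from add_mono[OF A this] have "(4 + 3 * k) * N * N + (3 + s + 4 * (s + 2)) \<le> 2 * B ^ 5" by (simp only: mult_2)
  from order_trans[OF this order_trans[OF p4(5) w]]
  show "(4 + 3 * k) * N * N + 3 + s + 4 * (s + 2) \<le> W" by (simp only: add.assoc)
  have s: "s \<le> B" using B(2) by linarith
  have "s * (s * (N * (N * N))) \<le> B * (B * (B ^ 3))"
    by (rule mult_le_mono[OF s mult_le_mono[OF s N3[unfolded mult.assoc]]])
  also have "B * (B * (B ^ 3)) = B ^ 5" by (simp only: power_Suc[symmetric]) simp
  finally have E: "s * (s * (N * (N * N))) \<le> B ^ 5" .
  have "N * N < B ^ 5" by (rule le_less_trans[OF N2 less_trans[OF q(1) less_trans[OF q(2,3)]]])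
  from add_less_le_mono[OF this E] have "N * N + s * (s * (N * (N * N))) < 2 * B ^ 5" by (simp only: mult_2)
  from less_le_trans[OF this order_trans[OF p4(5) w]] show "N * N + s * (s * (N * (N * N))) < W" .
  have "B ^ 1 < B ^ 6" by (rule less_trans[OF q(5) less_trans[OF q(1) \<open>B ^ 3 < B ^ 6\<close>]])
  then have "B < B ^ 6" by (simp only: power_one_right)
  from less_le_trans[OF this w] show "B < W" .
qed

text \<open>All loops of the construction have length \<open>n\<close>, \<open>k\<close> or
  \<open>N\<close>; reducing \<open>n + 1\<close> modulo \<open>2 ^ w\<close> can only decrease
  it.\<close>

lemma okC_build_com:
  assumes "m 0 \<le> X" "m 1 \<le> X" "m 0 + 1 \<le> X"
  shows "okC X w [0] build_com m"
proof -
  have "(m 0 + 1) mod 2 ^ w \<le> X" "(m 0 + 1 mod 2 ^ w) mod 2 ^ w \<le> X"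
    using order_trans[OF mod_less_eq_dividend assms(3)] by (simp_all add: mod_simps)
  with assms(1,2) show ?thesis
    by (simp add: build_com_def number_com_def tables_com_def header_com_def fill_levels_def fill_def copy_com_def
      clear_com_def dfs_com_def dfs_step_com_def next_expr_def child_expr_def edges_expr_def nbr_expr_def low_expr_def
      low_at_def pred_expr_def prefix_expr_def t_adj_def t_ord_def t_par_def t_level_def anc_expr_def par_expr_def
      adj_expr_def addr_def rd_def del: eval_binop.simps(3-))
qed

lemma okE_link_expr: "s \<le> X \<Longrightarrow> okE X [a, s, b, c, d, e, f, g, x, y] link_expr"
  by (simp add: link_expr_def link2_expr_def link1_expr_def blocked_expr_def first_expr_def prefix_row_def edge_row_def
      dot_def it_def rt_def gd_def lb_def t_level_def anc_expr_def addr_def rd_def)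

lemma okC_relabel_com: "s \<le> X \<Longrightarrow> b \<le> X \<Longrightarrow> okC X w [a, s, b, c, d, e, f, g, x, y] relabel_com m"
  unfolding relabel_com_def okC.simps(2) by (simp add: okE_link_expr lb_def)

lemma okC_query_com:
  assumes s: "ev w m [a] (Ld (Op Add (Var 0) (Num 2))) = s" and X: "s + 2 \<le> X"
  shows "okC X w [a] query_com m"
proof -
  have b: "ev w m [a, s] (Op Add (Var 1) (Num 2)) \<le> X"
    using order_trans[OF mod_less_eq_dividend X, of "2 ^ w"] by (simp add: mod_simps)
  have main: "okC X w [a, s, b, c, d, e, f, g]
      (Seq items_com (Seq guards_com (Seq roots_com (Seq labels_com (Seq (For 2 (For 2 relabel_com)) answer_com))))) m"
    if "b \<le> X" for b c d e f g
    using X that by (simp add: okC_relabel_com items_com_def guards_com_def roots_com_def labels_com_def answer_com_def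
      it_def rt_def gd_def lb_def addr_def rd_def)
  show ?thesis
    unfolding query_com_def okC.simps(2) s append.simps by (intro conjI main[OF b]; simp del: ev.simps)
qed

lemma init_state_conf: "init_state xs x = conf 0 ((\<lambda>_. 0)(0 := x)) (\<lambda>i. if i < length xs then xs ! i else 0)"
  by (simp add: init_state_def)

lemma init_words:
  assumes "\<And>y. y \<in> set xs \<Longrightarrow> y < 2 ^ w" "x < 2 ^ w"
  shows "words w (\<lambda>i. if i < length xs then xs ! i else 0) [x]"
  using assms by (auto simp: words_def)

lemma query_answered:
  assumes G: "pair_graph G" "pverts G = {0..<n}" and w: "(n + k + 2) ^ 6 \<le> 2 ^ w"
    and N: "N = n + 1" and T: "T = 4 + 3 * k"
    and tl: "tree_layout w n k N T par adj" and num: "bij_betw num {..<n} {1..n}"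
    and adj: "\<forall>x<n. \<forall>y<n. adj (num x) (num y) \<longleftrightarrow> (x, y) \<in> parcs G"
    and m: "m 0 = N" "\<forall>x<n. m (tab N 0 1 x) = num x" "tree_layout.child_mem N par m"
      "tree_layout.edges_mem N par adj m" "tree_layout.low_mem k N par adj m"
      "tree_layout.pred_mem k N par adj m" "tree_layout.prefix_mem k N par adj m"
    and mw: "\<And>a. m a < 2 ^ w"
    and uv: "u < n" "v < n" and xs: "distinct xs" "set xs \<subseteq> {..<n}" "length xs \<le> k"
  shows "\<exists>t\<le>timeC (k + 2) query_com + 2.
    answers w (program_of query_com 0) (map m [0..<T * N * N]) (query_input u v xs) t (conn G u v (set xs))"
proof -
  interpret tree_layout w n k N T par adj by (rule tl)
  define A where "A = T * N * N"
  define s where "s = length xs"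
  define M where "M = s + 2"
  define Z where "Z = A + 3 + s"
  define R where "R = Z + M"
  define U where "U = R + M"
  define Y where "Y = U + M"
  define zs where "zs i = num (if i < s then xs ! i else if i = s then u else v)" for i
  define S where "S = num ` set xs"
  have sk: "s \<le> k" using xs(3) by (simp add: s_def)
  have B: "N \<le> n + k + 2" "s + 2 \<le> n + k + 2" "4 + 3 * k + 3 \<le> 4 * (n + k + 2)"
    using sk by (simp_all add: N)
  note sb = size_bounds[OF B w N_pos, folded T]
  have inj: "inj_on num {..<n}" and img: "num ` {..<n} = {1..n}" using num by (simp_all add: bij_betw_def)
  have x: "xs ! i < n" if "i < s" for i using subsetD[OF xs(2) nth_mem[of i]] that by (simp add: s_def)
  have numN: "1 \<le> num i" "num i < N" if "i < n" for i
  proof -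
    have "num i \<in> {1..n}" unfolding img[symmetric] by (rule imageI) (use that in simp)
    then show "1 \<le> num i" "num i < N" by (simp_all add: N)
  qed
  have zs_eq: "zs i = num (xs ! i)" if "i < s" for i using that by (simp add: zs_def)
  have S_zs: "S = zs ` {..<s}"
  proof -
    have "set xs = (\<lambda>i. xs ! i) ` {..<s}" by (auto simp: set_conv_nth s_def)
    then show ?thesis unfolding S_def image_image by (simp only: image_image) (rule image_cong[OF refl], simp add: zs_eq)
  qed
  have inj_zs: "inj_on zs {..<s}"
  proof (rule inj_onI)
    fix i j assume ij: "i \<in> {..<s}" "j \<in> {..<s}" "zs i = zs j"
    then have i: "i < s" "j < s" by simp_all
    have "num (xs ! i) = num (xs ! j)" using ij(3) unfolding zs_eq[OF i(1)] zs_eq[OF i(2)] .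
    from inj_onD[OF inj this] have "xs ! i = xs ! j" using x[OF i(1)] x[OF i(2)] by (simp only: lessThan_iff simp_thms)
    then show "i = j" using nth_eq_iff_index_eq[OF xs(1)] i by (simp add: s_def)
  qed
  have Y_less: "Y + M \<le> 2 ^ w"
    using sb(3) by (simp add: Y_def U_def R_def Z_def M_def A_def)
  interpret q: query_layout w n k N T par adj S s zs A M Z R U Y
  proof
    show "S \<subseteq> {1..<N}" unfolding S_def using numN xs(2) by auto
    show "0 < zs i \<and> zs i < N" if "i < M" for i
    proof -
      have "(if i < s then xs ! i else if i = s then u else v) < n" using x[of i] uv by simp
      from numN[OF this] show ?thesis unfolding zs_def by linarith
    qed
  qed (fact S_zs inj_zs sk M_def A_def Z_def R_def U_def Y_def Y_less sb(4))+
  let ?xs = "map m [0..<A] @ query_input u v xs"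
  let ?m = "\<lambda>i. if i < length ?xs then ?xs ! i else 0"
  \<comment> \<open>A query sees only the first \<open>A\<close> words of the constructed memory;
    every table it reads lies there.\<close>
  have low: "?m a = m a" if "a < A" for a using that by (simp add: nth_append)
  have inp: "?m A = u" "?m (A + 1) = v" "?m (A + 2) = s" "\<And>i. i < s \<Longrightarrow> ?m (A + 3 + i) = xs ! i"
    by (simp_all add: nth_append query_input_def s_def numeral_2_eq_2 numeral_3_eq_3)
  have A0: "0 < A" using N_pos T4 by (simp add: A_def)
  have nw: "n < 2 ^ w" "s < 2 ^ w" using sb(5) sk by linarith+
  have words: "words w ?m [A]"
  proof (rule init_words)
    show "A < 2 ^ w" by (rule q.bounds(1))
    fix y assume "y \<in> set ?xs"
    then have "(\<exists>a. y = m a) \<or> y < n \<or> y = s"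
      using uv xs(2) by (auto simp: query_input_def s_def)
    then show "y < 2 ^ w" using mw nw by auto
  qed
  have "ev w ?m [A] (Ld (Op Add (Var 0) (Num 2))) = ?m ((A + 2 mod 2 ^ w) mod 2 ^ w)" by simp
  also have "(A + 2 mod 2 ^ w) mod 2 ^ w = A + 2" unfolding mod_add_right_eq by (rule mod_less[OF q.bounds(4)])
  finally have ok: "okC (k + 2) w [A] query_com ?m"
    unfolding inp(3) by (rule okC_query_com) (use sk in simp)
  have "0 < (2::nat) ^ w" by simp
  from program_of_correct[OF ok words this] obtain t f where t: "t \<le> timeC (k + 2) query_com + 2"
    "halts_within w (program_of query_com 0) t (conf 0 ((\<lambda>_. 0)(0 := A)) ?m) f" "regs f 0 = cv w [A] query_com ?m 0"
    by (elim exE conjE) (rule that; assumption)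
  have tabA: "tab N 0 1 x < A" if "x < n" for x
    using tab_less_mult[of 0 "T - 1" 1 N x] that T4 by (simp add: A_def N)
  have cv: "cv w [A] query_com ?m 0 = (if zs s \<notin> S \<and> zs (s + 1) \<notin> S \<and> q.reach (zs s) (zs (s + 1)) then 1 else 0)"
  proof (rule q.query_com_correct[where num = num and u = u and v = v and xs = "\<lambda>i. xs ! i"])
    show "?m (tab N 0 1 x) = num x" if "x < n" for x using low[OF tabA[OF that]] m(2) that by simp
    have "q.data_mem m" unfolding q.data_mem_def by (intro conjI m(3-7))
    then show "q.data_mem ?m" by (rule q.data_mem_below[where m = m and m' = ?m]) (rule low)
    show "?m A = u" "?m (A + 1) = v" "?m (A + 2) = s" by (rule inp)+
    show "?m (A + 3 + i) = xs ! i" if "i < s" for i by (rule inp(4)[OF that])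
    show "u < n" "v < n" by (rule uv)+
    show "xs ! i < n" if "i < s" for i by (rule x[OF that])
    show "zs i = num (if i < s then xs ! i else if i = s then u else v)" if "i < M" for i by (rule zs_def)
    show "?m 0 = N" using low[OF A0] m(1) by simp
  qed
  have in_S: "num a \<in> S \<longleftrightarrow> a \<in> set xs" if "a < n" for a
    unfolding S_def using inj_on_image_mem_iff[OF inj _ xs(2)] that by simp
  have z: "zs s = num u" "zs (s + 1) = num v" by (simp_all add: zs_def)
  have "q.reach (num u) (num v) \<longleftrightarrow> (\<lambda>p q. (p, q) \<in> parcs G \<and> p \<notin> set xs \<and> q \<notin> set xs)\<^sup>*\<^sup>* u v"
    unfolding q.reach_def
  proof (rule rtranclp_bij[OF inj])
    show "q \<in> num ` {..<n}" if "adj p q \<and> p \<notin> S \<and> q \<notin> S" for p q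
      unfolding img using adj_range[OF adj_sym[of p q]] that by (simp add: N Suc_le_eq less_Suc_eq_le)
    show "(adj (num x) (num y) \<and> num x \<notin> S \<and> num y \<notin> S) = ((x, y) \<in> parcs G \<and> x \<notin> set xs \<and> y \<notin> set xs)"
      if "x \<in> {..<n}" "y \<in> {..<n}" for x y
      using adj that in_S by simp
    show "y \<in> {..<n}" if "(x, y) \<in> parcs G \<and> x \<notin> set xs \<and> y \<notin> set xs" for x y
    proof -
      interpret pair_graph G by (rule G(1))
      have "y \<in> pverts G" using arc_snd_in_verts[of "(x, y)"] that by simp
      then show ?thesis by (simp add: G(2))
    qed
  qed (use uv in simp_all)
  moreover have "u \<in> pverts G" using uv by (simp add: G(2))
  ultimately have "regs f 0 = (if conn G u v (set xs) then 1 else 0)"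
    unfolding t(3) cv z conn_iff[OF G(1) \<open>u \<in> pverts G\<close>] using in_S[OF uv(1)] in_S[OF uv(2)] by simp
  moreover have "init_state ?xs A = conf 0 ((\<lambda>_. 0)(0 := A)) ?m" by (rule init_state_conf)
  ultimately have "answers w (program_of query_com 0) (map m [0..<A]) (query_input u v xs) t (conn G u v (set xs))"
    unfolding answers_def using t(2) by (intro exI[of _ f]) simp
  with t(1) show ?thesis unfolding A_def by (intro exI[of _ t] conjI)
qed

lemma built:
  assumes G: "pair_graph G" "n = card (pverts G)" "pverts G = {0..<n}" and w: "(n + k + 2) ^ 6 \<le> 2 ^ w"
  obtains D t where "t \<le> timeC (n + k + 1) build_com + 2"
    "constructs w (program_of build_com 1) (graph_input G k) t D" "length D \<le> (4 + 3 * k) * 4 * n\<^sup>2"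
    "\<forall>u<n. \<forall>v<n. \<forall>xs. distinct xs \<longrightarrow> set xs \<subseteq> {..<n} \<longrightarrow> length xs \<le> k \<longrightarrow>
      (\<exists>t\<le>timeC (k + 2) query_com + 2.
        answers w (program_of query_com 0) D (query_input u v xs) t (conn G u v (set xs)))"
proof -
  note finish = that
  define N where "N = n + 1"
  define T where "T = 4 + 3 * k"
  let ?xs = "graph_input G k"
  define m where "m i = (if i < length ?xs then ?xs ! i else 0)" for i
  have B: "N \<le> n + k + 2" "0 + 2 \<le> n + k + 2" "4 + 3 * k + 3 \<le> 4 * (n + k + 2)" "0 < N"
    by (simp_all add: N_def)
  note sb = size_bounds[OF B(1-3) w B(4), folded T_def]
  interpret layout w n k N T
    by unfold_locales (fact N_def T_def sb(1,2))+
  let ?f = "\<lambda>i j. if (i, j) \<in> parcs G then 1 else 0 :: nat"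
  define L where "L = [?f i j. i \<leftarrow> [0..<n], j \<leftarrow> [0..<n]]"
  have xs: "?xs = [n, k] @ L"
    unfolding L_def graph_input_def Let_def G(2)[symmetric] by (rule refl)
  have L01: "y \<le> 1" if "y \<in> set L" for y
    using that unfolding L_def by (auto split: if_splits)
  have m01: "m 0 = n" "m 1 = k" unfolding m_def xs by simp_all
  have mA: "m (2 + x * n + y) = ?f x y" if "x < n" "y < n" for x y
  proof -
    have "Suc x * n \<le> n * n" by (rule mult_le_mono1) (use that in simp)
    then have "x * n + y < n * n" using that by simp
    with nth_matrix[OF that, of ?f, folded L_def] show ?thesis
      unfolding m_def xs by (simp add: nth_append)
  qed
  have m_eq: "m = (\<lambda>i. if i < length ?xs then ?xs ! i else 0)" by (simp add: m_def fun_eq_iff)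
  have words: "words w m [0]" unfolding m_eq
  proof (rule init_words)
    fix y assume "y \<in> set ?xs"
    then have "y = n \<or> y = k \<or> y \<le> 1" unfolding xs using L01[of y] by (simp only: set_append Un_iff list.set insert_iff empty_iff) blast
    then show "y < 2 ^ w" using sb(5) by linarith
  qed simp
  have ok: "okC (n + k + 1) w [0] build_com m" by (rule okC_build_com; unfold m01; linarith)
  define m' where "m' = cv w [0] build_com m"
  have one: "(1::nat) < 2 ^ w" using sb(5) by linarith
  from program_of_correct[OF ok words one, folded m'_def] obtain t f where t: "t \<le> timeC (n + k + 1) build_com + 2"
    "halts_within w (program_of build_com 1) t (conf 0 ((\<lambda>_. 0)(0 := 0)) m) f" "regs f 0 = m' 1" "mem f = m'"
    by (elim exE conjE) (rule that; assumption)
  have con: "constructs w (program_of build_com 1) ?xs t (map m' [0..<m' 1])"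
    unfolding constructs_def init_state_conf m_eq[symmetric] using t(2-4) by (intro exI[of _ f]) simp
  show ?thesis
  proof (cases "n = 0")
    \<comment> \<open>Without vertices there are no queries, and all that counts is that the header
      command returns size 0.\<close>
    case True
    have "\<exists>m0. m' = cv w [0, n, k, N, T] header_com m0"
      unfolding m'_def build_com_cv[OF m01] tables_com_def cv.simps(3) by (rule exI, rule refl)
    then obtain m0 where m0: "m' = cv w [0, n, k, N, T] header_com m0" by (rule exE)
    have m1: "m' 1 = 0" unfolding m0 header_com_def cv.simps(1,3) using True one by simp
    have "map m' [0..<m' 1] = []" unfolding m1 by simp
    note con' = con[unfolded this]
    show ?thesis
      by (rule finish[OF t(1) con']) (simp_all add: True)
  next
    case False
    interpret pair_graph G by (rule G(1))
    have sym: "(y, x) \<in> parcs G" if "(x, y) \<in> parcs G" for x y using arcs_symmetric that by blast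
    from False have n: "0 < n" by simp
    note bc = build_com_correct[of "\<lambda>x y. (x, y) \<in> parcs G", OF n sym m01 mA m'_def]
    obtain par adj num where tl: "tree_layout w n k N T par adj" and num: "bij_betw num {..<n} {1..n}"
      and adj: "\<forall>x<n. \<forall>y<n. adj (num x) (num y) \<longleftrightarrow> (x, y) \<in> parcs G" and m': "m' 0 = N" "m' 1 = T * N * N"
      and tabs: "\<forall>x<n. m' (tab N 0 1 x) = num x" "tree_layout.child_mem N par m'"
      "tree_layout.edges_mem N par adj m'" "tree_layout.low_mem k N par adj m'"
      "tree_layout.pred_mem k N par adj m'" "tree_layout.prefix_mem k N par adj m'"
      by (rule exE[OF bc], assumption, assumption, assumption, elim exE conjE, (rule that; assumption))
    have mw: "m' a < 2 ^ w" for a using cv_words[OF words ok] unfolding m'_def words_def by blast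
    \<comment> \<open>For a nonempty graph \<open>N = n + 1 \<le> 2 * n\<close>; this is the factor
      4 in the space bound.\<close>
    have "N * N \<le> (2 * n) * (2 * n)" by (rule mult_le_mono; use n in \<open>simp add: N_def\<close>)
    from mult_le_mono2[OF this, of T] have "m' 1 \<le> (4 + 3 * k) * 4 * n\<^sup>2"
      unfolding m'(2) T_def by (simp add: power2_eq_square ac_simps)
    then have len: "length (map m' [0..<m' 1]) \<le> (4 + 3 * k) * 4 * n\<^sup>2" by simp
    have qu: "\<exists>t\<le>timeC (k + 2) query_com + 2.
        answers w (program_of query_com 0) (map m' [0..<m' 1]) (query_input u v xs) t (conn G u v (set xs))"
      if "u < n" "v < n" "distinct xs" "set xs \<subseteq> {..<n}" "length xs \<le> k" for u v xs
      unfolding m'(2) by (rule query_answered[OF G(1,3) w N_def T_def tl num adj m'(1) tabs mw that])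
    show ?thesis
      by (rule finish[OF t(1) con len]) (intro allI impI qu)
  qed
qed

section \<open>Asymptotic form of the bounds\<close>

lemma poly_bounded_pow: "poly_bounded (\<lambda>n. (n + a) ^ d)"
  by (induction d) (simp_all only: power_0 power_Suc, (intro poly_bounded_intros; assumption)+)

lemma polynomially_bounded_real:
  assumes "poly_bounded g" shows "polynomially_bounded (\<lambda>n. real (g n))"
proof -
  obtain C d where g: "\<And>X. g X \<le> C * (X + 1) ^ d" using assms unfolding poly_bounded_def by blast
  have "real (g n) \<le> real (C * 2 ^ d) * real n ^ d" if "1 \<le> n" for n
  proof -
    have "(n + 1) ^ d \<le> (2 * n) ^ d" by (rule power_mono) (use that in simp_all)
    from order_trans[OF g mult_le_mono2[OF this]] have "g n \<le> C * 2 ^ d * n ^ d"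
      by (simp add: power_mult_distrib mult.assoc)
    then have "real (g n) \<le> real (C * 2 ^ d * n ^ d)" by (simp only: of_nat_le_iff)
    then show ?thesis by simp
  qed
  then have "(\<lambda>n. real (g n)) \<in> O(\<lambda>n. real n ^ d)"
    by (intro bigoI[of _ "real (C * 2 ^ d)"] eventually_sequentiallyI[of 1]) simp
  then show ?thesis unfolding polynomially_bounded_def by blast
qed

text \<open>\<open>ln k \<ge> 1\<close> holds from \<open>k = 3\<close> on, so an exponent linear in
  \<open>k\<close> is within the required growth.\<close>

lemma linear_bigo: "(\<lambda>k. real d * real k) \<in> O(\<lambda>k. real k * ln (real k))"
proof (intro bigoI[of _ "real d"] eventually_sequentiallyI[of 3])
  fix k :: nat assume k: "3 \<le> k"
  then have "exp 1 \<le> real k" using exp_le by linarith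
  then have l: "1 \<le> ln (real k)" using k by (subst ln_ge_iff) simp_all
  have "real d * (real k * 1) \<le> real d * (real k * ln (real k))"
    by (intro mult_left_mono l) simp_all
  then show "norm (real d * real k) \<le> real d * norm (real k * ln (real k))" using l by simp
qed

lemma Suc_le_exp: "k + 1 \<le> (2::nat) ^ k"
  by (induction k) simp_all

theorem theorem6p1:
  shows "\<exists>(c::nat) (P::program) (Q::program) (f::nat \<Rightarrow> real) (r::nat \<Rightarrow> real) (p::nat \<Rightarrow> real) (q::nat \<Rightarrow> real).
    c \<ge> 1 \<and>
    f \<in> O(\<lambda>k. real k * ln (real k)) \<and>
    polynomially_bounded r \<and> polynomially_bounded p \<and> polynomially_bounded q \<and>
    (\<forall>(G::nat pair_pre_digraph) (k::nat) (n::nat) (w::nat).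
      pair_graph G \<longrightarrow> n = card (pverts G) \<longrightarrow> pverts G = {0..<n} \<longrightarrow> w = word_length c n k \<longrightarrow>
      (\<exists>(D::nat list) (t::nat).
        constructs w P (graph_input G k) t D \<and>
        real t \<le> 2 powr (f k) * r n \<and>
        real (length D) \<le> q k * real n ^ 2 \<and>
        (\<forall>u \<in> pverts G. \<forall>v \<in> pverts G. \<forall>S. S \<subseteq> pverts G \<longrightarrow> card S \<le> k \<longrightarrow>
          (\<forall>xs. distinct xs \<longrightarrow> set xs = S \<longrightarrow>
            (\<exists>t'. answers w Q D (query_input u v xs) t' (conn G u v S) \<and> real t' \<le> p k)))))"
proof -
  obtain C d where C: "\<And>X. timeC X build_com \<le> C * (X + 1) ^ d"
    using poly_bounded_timeC[of build_com] unfolding poly_bounded_def by blast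
  obtain C' d' where C': "\<And>X. timeC X query_com \<le> C' * (X + 1) ^ d'"
    using poly_bounded_timeC[of query_com] unfolding poly_bounded_def by blast
  let ?r = "\<lambda>n. C * (n + 2) ^ d + 2"
  let ?p = "\<lambda>k. C' * (k + 3) ^ d' + 2"
  let ?q = "\<lambda>k::nat. (4 + 3 * k) * 4"
  have r: "polynomially_bounded (\<lambda>n. real (?r n))" and p: "polynomially_bounded (\<lambda>k. real (?p k))"
    and q: "polynomially_bounded (\<lambda>k. real (?q k))"
    by (intro polynomially_bounded_real poly_bounded_intros poly_bounded_pow)+
  have main: "\<exists>D t. constructs w (program_of build_com 1) (graph_input G k) t D \<and>
      real t \<le> 2 powr (real d * real k) * real (?r n) \<and> real (length D) \<le> real (?q k) * real n ^ 2 \<and>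
      (\<forall>u \<in> pverts G. \<forall>v \<in> pverts G. \<forall>S. S \<subseteq> pverts G \<longrightarrow> card S \<le> k \<longrightarrow>
        (\<forall>xs. distinct xs \<longrightarrow> set xs = S \<longrightarrow>
          (\<exists>t'. answers w (program_of query_com 0) D (query_input u v xs) t' (conn G u v S) \<and> real t' \<le> real (?p k))))"
    if G: "pair_graph G" "n = card (pverts G)" "pverts G = {0..<n}" and w: "w = word_length 6 n k" for G k n w
  proof -
    have w6: "(n + k + 2) ^ 6 \<le> 2 ^ w" unfolding w by (rule word_length_bound)
    obtain D t where t: "t \<le> timeC (n + k + 1) build_com + 2"
      and con: "constructs w (program_of build_com 1) (graph_input G k) t D"
      and len: "length D \<le> ?q k * n\<^sup>2"
      and qu: "\<forall>u<n. \<forall>v<n. \<forall>xs. distinct xs \<longrightarrow> set xs \<subseteq> {..<n} \<longrightarrow> length xs \<le> k \<longrightarrow>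
        (\<exists>t\<le>timeC (k + 2) query_com + 2.
          answers w (program_of query_com 0) D (query_input u v xs) t (conn G u v (set xs)))"
      by (rule built[OF G w6])
    \<comment> \<open>The construction time is polynomial in \<open>n + k\<close>. The bound
      \<open>k + 1 \<le> 2 ^ k\<close> separates \<open>k\<close> from \<open>n\<close>, and the
      degree \<open>d\<close> turns \<open>2 ^ k\<close> into \<open>2 ^ (d * k)\<close>.\<close>
    have "n + k + 1 + 1 \<le> 2 ^ k * (n + 2)"
    proof -
      from mult_le_mono1[OF Suc_le_exp, of k "n + 2"] have "(k + 1) * (n + 2) \<le> 2 ^ k * (n + 2)" .
      moreover have "n + k + 1 + 1 \<le> (k + 1) * (n + 2)" by simp
      ultimately show ?thesis by linarith
    qed
    then have pw: "(n + k + 1 + 1) ^ d \<le> (2 ^ k * (n + 2)) ^ d" by (rule power_mono) simp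
    have e: "(2 ^ k * (n + 2)) ^ d = 2 ^ (d * k) * (n + 2) ^ d"
      unfolding power_mult_distrib power_mult[symmetric] mult.commute[of k d] by (rule refl)
    have "C * (n + k + 1 + 1) ^ d \<le> C * (2 ^ (d * k) * (n + 2) ^ d)"
      by (rule mult_le_mono2[OF pw[unfolded e]])
    moreover have "2 \<le> 2 ^ (d * k) * (2::nat)" by simp
    ultimately have "t \<le> C * (2 ^ (d * k) * (n + 2) ^ d) + 2 ^ (d * k) * 2"
      using t C[of "n + k + 1"] by linarith
    also have "\<dots> = 2 ^ (d * k) * ?r n" by (simp only: add_mult_distrib2 mult.left_commute)
    finally have "real t \<le> real (2 ^ (d * k) * ?r n)" by (simp only: of_nat_le_iff)
    also have "\<dots> = 2 ^ (d * k) * real (?r n)" by (simp only: of_nat_mult of_nat_power of_nat_numeral)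
    also have "(2::real) ^ (d * k) = 2 powr (real d * real k)"
      using powr_realpow[of 2 "d * k"] by (simp only: of_nat_mult)
    finally have rt: "real t \<le> 2 powr (real d * real k) * real (?r n)" .
    have "real (length D) \<le> real (?q k * n\<^sup>2)" using len by (simp only: of_nat_le_iff)
    then have rl: "real (length D) \<le> real (?q k) * real n ^ 2" by (simp only: of_nat_mult of_nat_power)
    have ans: "\<exists>t'. answers w (program_of query_com 0) D (query_input u v xs) t' (conn G u v S) \<and> real t' \<le> real (?p k)"
      if uv: "u \<in> pverts G" "v \<in> pverts G" and S: "S \<subseteq> pverts G" "card S \<le> k" and xs: "distinct xs" "set xs = S"
      for u v S xs
    proof -
      have "u < n" "v < n" "set xs \<subseteq> {..<n}" "length xs \<le> k"
        using uv S xs distinct_card[OF xs(1)] unfolding G(3) by auto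
      from qu[rule_format, OF this(1,2) xs(1) this(3,4)] obtain t' where t': "t' \<le> timeC (k + 2) query_com + 2"
        "answers w (program_of query_com 0) D (query_input u v xs) t' (conn G u v (set xs))"
        by (elim exE conjE) (rule that; assumption)
      have "k + 2 + 1 = k + 3" by simp
      note c = C'[of "k + 2", unfolded this]
      have "t' \<le> ?p k" using t'(1) c by linarith
      then have "real t' \<le> real (?p k)" by (simp only: of_nat_le_iff)
      with t'(2) show ?thesis unfolding xs(2) by (intro exI[of _ t'] conjI)
    qed
    show ?thesis
      by (rule exI[of _ D], rule exI[of _ t]) (intro conjI con rt rl ballI allI impI ans; assumption)
  qed
  \<comment> \<open>The factor 6 of the word length is the exponent in \<open>size_bounds\<close>;
    the programs return cell 1, the size of the data, and cell 0, the answer.\<close>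
  show ?thesis
    by (rule exI[of _ 6], rule exI[of _ "program_of build_com 1"], rule exI[of _ "program_of query_com 0"],
        rule exI[of _ "\<lambda>k. real d * real k"], rule exI[of _ "\<lambda>n. real (?r n)"], rule exI[of _ "\<lambda>k. real (?p k)"],
        rule exI[of _ "\<lambda>k. real (?q k)"])
       (intro conjI linear_bigo r p q allI impI main; simp)
qed

end
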